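(* Let $F:T^*\mathbb{T}^d\to T^*\mathbb{T}^d$ be a twist map. Then $F$ is without conjugate points if and only if there is a continuous foliation of $T^*\mathbb{T}^d$ by Lipschitz, Lagrangian, $F$-invariant graphs.
   Context: Let $d\ge 1$ and $\mathbb{T}^d=\mathbb{R}^d/\mathbb{Z}^d$. Identify $T^*\mathbb{R}^d$ with $\mathbb{R}^d\times(\mathbb{R}^d)^*$ and $T^*\mathbb{T}^d$ with $\mathbb{T}^d\times(\mathbb{R}^d)^*$. A generating function is a $C^2$ map $S:\mathbb{R}^d\times\mathbb{R}^d\to\mathbb{R}$ such that (i) $S(x+r,y+r)=S(x,y)$ for all $x,y\in\mathbb{R}^d$ and $r\in\mathbb{Z}^d$; (ii) there is $A>0$ with $\sum_{i,j}\frac{\partial^2 S}{\partial x_i\partial y_j}(x,y)\,\xi_i\xi_j\le -A\|\xi\|^2$ for all $x,y,\xi\in\mathbb{R}^d$. Write $\partial_1S,\partial_2S$ for the partial differentials in the first and second variable. Condition (ii) implies that $x\mapsto\partial_2S(x,y_0)$ and $y\mapsto\partial_1S(x_0,y)$ are diffeomorphisms from $\mathbb{R}^d$ onto $(\mathbb{R}^d)^*$ for all $x_0,y_0$. Such an $S$ defines a symplectic diffeomorphism $\overline{F}$ of $\mathbb{R}^d\times(\mathbb{R}^d)^*$ by $\overline{F}(x,p)=(x',p')$ if and only if $p=-\partial_1S(x,x')$ and $p'=\partial_2S(x,x')$. By (i) it commutes with the translations $(x,p)\mapsto(x+s,p)$, $s\in\mathbb{Z}^d$, and so is the lift of a symplectic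 diffeomorphism $F$ of $T^*\mathbb{T}^d$. A twist map is a diffeomorphism $F$ of $T^*\mathbb{T}^d$ obtained in this way. Let $\pi:T^*\mathbb{T}^d\to\mathbb{T}^d$ be the canonical projection and $V(x,p)=\ker\big(D\pi|_{T_{(x,p)}T^*\mathbb{T}^d}\big)$. $F$ is without conjugate points if for all $(x,p)\in T^*\mathbb{T}^d$ and all $n\in\mathbb{Z}\setminus\{0\}$, $V(F^n(x,p))\cap DF^n(x,p)\cdot V(x,p)=\{0\}$. Conventions: a graph is the image of a section $x\mapsto(x,\eta(x))$ of $T^*\mathbb{T}^d$ defined on all of $\mathbb{T}^d$; it is Lipschitz if $\eta$ is Lipschitz; a Lipschitz graph is Lagrangian if $\eta$ is a closed 1-form, i.e. its lift to $\mathbb{R}^d$ is the differential $Du$ of a $C^1$ function $u:\mathbb{R}^d\to\mathbb{R}$ (with Lipschitz differential). A graph $\mathcal{G}$ is $F$-invariant if $F(\mathcal{G})=\mathcal{G}$. A continuous foliation is a topological ($C^0$) foliation, the leaves of which are here required to be such graphs (in particular the leaves form a partition of $T^*\mathbb{T}^d$). *)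

theory Defs
  imports "HOL-Analysis.Analysis"
begin

section \<open>The torus\<close>

definition int_lattice :: "(real^'n) set" where
  "int_lattice = {r. \<forall>i. r $ i \<in> \<int>}"

lemma zero_int_lattice: "0 \<in> int_lattice"
  by (simp add: int_lattice_def)

lemma int_lattice_add: "r \<in> int_lattice \<Longrightarrow> s \<in> int_lattice \<Longrightarrow> r + s \<in> int_lattice"
  by (simp add: int_lattice_def)

lemma int_lattice_diff: "r \<in> int_lattice \<Longrightarrow> s \<in> int_lattice \<Longrightarrow> r - s \<in> int_lattice"
  by (simp add: int_lattice_def)

lemma closed_int_lattice: "closed (int_lattice :: (real^'n) set)"
proof -
  have "closed (\<Inter>i. (\<lambda>r::real^'n. r $ i) -` \<int>)"
    by (intro closed_INT ballI closed_vimage_vec_nth closed_Ints)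
  also have "(\<Inter>i. (\<lambda>r::real^'n. r $ i) -` \<int>) = int_lattice"
    by (auto simp: int_lattice_def)
  finally show ?thesis .
qed

definition torus_rel :: "real^'n \<Rightarrow> real^'n \<Rightarrow> bool" where
  "torus_rel x y \<longleftrightarrow> y - x \<in> int_lattice"

quotient_type (overloaded) 'n torus = "real^'n::finite" / torus_rel
proof (rule equivpI)
  show "reflp (torus_rel :: real^'n \<Rightarrow> _)"
    by (simp add: reflp_def torus_rel_def zero_int_lattice)
  show "symp (torus_rel :: real^'n \<Rightarrow> _)"
    unfolding symp_def torus_rel_def
    by (metis diff_0 int_lattice_diff minus_diff_eq zero_int_lattice)
  show "transp (torus_rel :: real^'n \<Rightarrow> _)"
    unfolding transp_def torus_rel_def
    by (metis add_diff_eq diff_add_cancel int_lattice_add)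
qed

text \<open>The quotient map \<open>\<real>\<^sup>d \<rightarrow> \<real>\<^sup>d/\<int>\<^sup>d\<close>.\<close>
definition torus_proj :: "real^'n \<Rightarrow> 'n torus" where
  "torus_proj = abs_torus"

lemma torus_proj_eq_iff: "torus_proj x = torus_proj y \<longleftrightarrow> y - x \<in> int_lattice"
  using torus.abs_eq_iff[of x y] by (simp add: torus_rel_def torus_proj_def)

lemma torus_proj_add: "r \<in> int_lattice \<Longrightarrow> torus_proj (x + r) = torus_proj x"
  by (metis add_diff_cancel_left' torus_proj_eq_iff)

lemma surj_torus_proj: "surj torus_proj"
  unfolding surj_def torus_proj_def by (metis Quotient3_abs_rep Quotient3_torus)

text \<open>The topology is the quotient topology; the metric is the flat one, the distance of two
  points being the distance of their fibres (cosets of the lattice) in \<open>\<real>\<^sup>d\<close>.\<close>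
instantiation torus :: (finite) metric_space
begin

definition dist_torus :: "'a torus \<Rightarrow> 'a torus \<Rightarrow> real" where
  "dist_torus x y = setdist (torus_proj -` {x}) (torus_proj -` {y})"

definition open_torus :: "'a torus set \<Rightarrow> bool" where
  "open_torus U \<longleftrightarrow> open (torus_proj -` U)"

definition uniformity_torus :: "('a torus \<times> 'a torus) filter" where
  "uniformity_torus = (INF e\<in>{0<..}. principal {(x, y). dist x y < e})"

instance
proof
  have lt: "\<exists>b. torus_proj b = y \<and> dist a b < e"
    if "dist x y < e" "torus_proj a = x" for x y :: "'a torus" and a e
  proof -
    have "torus_proj -` {x} \<noteq> {}" "torus_proj -` {y} \<noteq> {}"
      using surj_torus_proj by (metis empty_iff surjD vimage_singleton_eq)+
    with that obtain a' b' where ab: "torus_proj a' = x" "torus_proj b' = y" "dist a' b' < e"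
      unfolding dist_torus_def by (auto elim!: setdist_ltE)
    have "a - a' \<in> int_lattice"
      using ab(1) that(2) torus_proj_eq_iff by metis
    then have "torus_proj (b' + (a - a')) = y"
      using ab(2) torus_proj_add by blast
    moreover have "dist a (b' + (a - a')) = dist a' b'"
      by (simp add: dist_norm algebra_simps)
    ultimately show ?thesis
      using ab(3) by auto
  qed
  have le: "dist x y \<le> dist a b" if "torus_proj a = x" "torus_proj b = y"
    for x y :: "'a torus" and a b
    using that unfolding dist_torus_def by (auto intro: setdist_le_dist)
  show "dist x y = 0 \<longleftrightarrow> x = y" for x y :: "'a torus"
  proof
    assume 0: "dist x y = 0"
    obtain a where a: "torus_proj a = x"
      using surj_torus_proj by (metis surjD)
    obtain b where b: "torus_proj b = y"
      using surj_torus_proj by (metis surjD)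
    have "\<exists>r\<in>int_lattice. dist r (b - a) < e" if "e > 0" for e
    proof -
      obtain c where c: "torus_proj c = y" "dist a c < e"
        using lt[of x y e a] 0 a \<open>e > 0\<close> by auto
      then have "b - c \<in> int_lattice"
        using b torus_proj_eq_iff by metis
      moreover have "dist (b - c) (b - a) = dist a c"
        by (simp add: dist_norm)
      ultimately show ?thesis
        using c(2) by metis
    qed
    then have "b - a \<in> closure int_lattice"
      by (simp add: closure_approachable)
    then have "b - a \<in> int_lattice"
      by (simp add: closed_int_lattice)
    then show "x = y"
      using a b torus_proj_eq_iff by metis
  qed (simp add: dist_torus_def setdist_refl)
  show "dist x y \<le> dist x z + dist y z" for x y z :: "'a torus"
  proof (rule field_le_epsilon)
    fix e :: real assume "e > 0"
    obtain c where c: "torus_proj c = z"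
      using surj_torus_proj by (metis surjD)
    have sym: "dist u v = dist v u" for u v :: "'a torus"
      by (simp add: dist_torus_def setdist_sym)
    obtain a where a: "torus_proj a = x" "dist c a < dist x z + e/2"
      using lt[of z x "dist x z + e/2" c] c sym[of x z] \<open>e > 0\<close> by auto
    obtain b where b: "torus_proj b = y" "dist c b < dist y z + e/2"
      using lt[of z y "dist y z + e/2" c] c sym[of y z] \<open>e > 0\<close> by auto
    have "dist x y \<le> dist a b"
      using a b le by blast
    also have "\<dots> \<le> dist c a + dist c b"
      by (rule dist_triangle3)
    finally show "dist x y \<le> dist x z + dist y z + e"
      using a b by simp
  qed
  show unif: "uniformity = (INF e\<in>{0<..}. principal {(x, y). dist (x::'a torus) y < e})"
    by (rule uniformity_torus_def)
  have ev: "(\<forall>\<^sub>F (x', y) in uniformity. x' = x \<longrightarrow> y \<in> U) \<longleftrightarrow>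
      (\<exists>e>0. \<forall>y. dist x y < e \<longrightarrow> y \<in> U)" for x :: "'a torus" and U
  proof -
    have "(\<forall>\<^sub>F (x', y) in uniformity. x' = x \<longrightarrow> y \<in> U) \<longleftrightarrow>
      (\<exists>e\<in>{0<..}. \<forall>\<^sub>F (x', y) in principal {(x, y). dist (x::'a torus) y < e}.
         x' = x \<longrightarrow> y \<in> U)"
      unfolding unif
    proof (rule eventually_INF_base)
      fix s t :: real assume "s \<in> {0<..}" "t \<in> {0<..}"
      then show "\<exists>u\<in>{0<..}. principal {(x, y). dist (x::'a torus) y < u} \<le>
          inf (principal {(x, y). dist x y < s}) (principal {(x, y). dist x y < t})"
        by (intro bexI[of _ "min s t"]) auto
    qed auto
    then show ?thesis
      by (auto simp: eventually_principal)
  qed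
  show "open U \<longleftrightarrow> (\<forall>x\<in>U. \<forall>\<^sub>F (x', y) in uniformity. x' = x \<longrightarrow> y \<in> U)"
    for U :: "'a torus set"
    unfolding ev open_torus_def open_dist
  proof safe
    fix x assume *: "\<forall>a\<in>torus_proj -` U. \<exists>e>0. \<forall>b. dist b a < e \<longrightarrow> b \<in> torus_proj -` U"
      and "x \<in> U"
    obtain a where a: "torus_proj a = x"
      using surj_torus_proj by (metis surjD)
    then obtain e where e: "e > 0" "\<And>b. dist b a < e \<Longrightarrow> torus_proj b \<in> U"
      using * \<open>x \<in> U\<close> by auto
    have "y \<in> U" if "dist x y < e" for y
      using lt[OF that a] e(2) by (auto simp: dist_commute)
    then show "\<exists>e>0. \<forall>y. dist x y < e \<longrightarrow> y \<in> U"
      using e(1) by blast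
  next
    fix a assume *: "\<forall>x\<in>U. \<exists>e>0. \<forall>y. dist x y < e \<longrightarrow> y \<in> U" and "torus_proj a \<in> U"
    then obtain e where e: "e > 0" "\<And>y. dist (torus_proj a) y < e \<Longrightarrow> y \<in> U"
      by blast
    have "torus_proj b \<in> U" if "dist b a < e" for b
      using e(2)[of "torus_proj b"] le[of a "torus_proj a" b "torus_proj b"] that
      by (simp add: dist_commute)
    then show "\<exists>e>0. \<forall>b. dist b a < e \<longrightarrow> b \<in> torus_proj -` U"
      using e(1) by auto
  qed
qed

end

text \<open>The dual of \<open>\<real>\<^sup>d\<close> is identified with \<open>\<real>\<^sup>d\<close> through components: \<open>p\<close> stands for the
  linear form \<open>v \<mapsto> p \<bullet> v\<close>. The cotangent bundle of the torus is \<open>'n torus \<times> real^'n\<close>.\<close>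
definition cotangent_proj :: "(real^'n) \<times> (real^'n) \<Rightarrow> 'n torus \<times> (real^'n)" where
  "cotangent_proj = map_prod torus_proj id"

section \<open>Twist maps\<close>

definition C2 :: "('a::real_normed_vector \<Rightarrow> 'b::real_normed_vector) \<Rightarrow> bool" where
  "C2 f \<longleftrightarrow> (\<exists>(f' :: 'a \<Rightarrow> 'a \<Rightarrow>\<^sub>L 'b) (f'' :: 'a \<Rightarrow> 'a \<Rightarrow>\<^sub>L ('a \<Rightarrow>\<^sub>L 'b)).
     (\<forall>x. (f has_derivative blinfun_apply (f' x)) (at x)) \<and>
     (\<forall>x. (f' has_derivative blinfun_apply (f'' x)) (at x)) \<and>
     continuous_on UNIV f'')"

definition gradient :: "(real^'n \<Rightarrow> real) \<Rightarrow> real^'n \<Rightarrow> real^'n" where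
  "gradient f x = (\<chi> i. frechet_derivative f (at x) (axis i 1))"

definition partial1 :: "(real^'n \<Rightarrow> real^'n \<Rightarrow> real) \<Rightarrow> real^'n \<Rightarrow> real^'n \<Rightarrow> real^'n" where
  "partial1 S x y = gradient (\<lambda>x. S x y) x"

definition partial2 :: "(real^'n \<Rightarrow> real^'n \<Rightarrow> real) \<Rightarrow> real^'n \<Rightarrow> real^'n \<Rightarrow> real^'n" where
  "partial2 S x y = gradient (\<lambda>y. S x y) y"

text \<open>\<open>mixed_partial S x y i j\<close> is \<open>\<partial>\<^sup>2S/\<partial>x\<^sub>i\<partial>y\<^sub>j\<close> at \<open>(x, y)\<close>.\<close>
definition mixed_partial ::
    "(real^'n \<Rightarrow> real^'n \<Rightarrow> real) \<Rightarrow> real^'n \<Rightarrow> real^'n \<Rightarrow> 'n \<Rightarrow> 'n \<Rightarrow> real" where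
  "mixed_partial S x y i j = gradient (\<lambda>x. partial2 S x y $ j) x $ i"

definition generating_function :: "(real^'n \<Rightarrow> real^'n \<Rightarrow> real) \<Rightarrow> bool" where
  "generating_function S \<longleftrightarrow>
     C2 (\<lambda>(x, y). S x y) \<and>
     (\<forall>x y. \<forall>r\<in>int_lattice. S (x + r) (y + r) = S x y) \<and>
     (\<exists>A>0. \<forall>x y \<xi>.
        (\<Sum>i\<in>UNIV. \<Sum>j\<in>UNIV. mixed_partial S x y i j * \<xi> $ i * \<xi> $ j) \<le> - A * (norm \<xi>)\<^sup>2)"

definition generates ::
    "(real^'n \<Rightarrow> real^'n \<Rightarrow> real) \<Rightarrow> ((real^'n) \<times> (real^'n) \<Rightarrow> (real^'n) \<times> (real^'n)) \<Rightarrow> bool" where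
  "generates S Fbar \<longleftrightarrow>
     (\<forall>x p x' p'. Fbar (x, p) = (x', p') \<longleftrightarrow> p = - partial1 S x x' \<and> p' = partial2 S x x')"

definition twist_map :: "('n torus \<times> (real^'n) \<Rightarrow> 'n torus \<times> (real^'n)) \<Rightarrow> bool" where
  "twist_map F \<longleftrightarrow>
     (\<exists>S Fbar. generating_function S \<and> generates S Fbar \<and>
        (\<forall>z. F (cotangent_proj z) = cotangent_proj (Fbar z)))"

section \<open>Conjugate points\<close>

text \<open>Differentials of maps between \<open>\<bbbT>\<^sup>d\<close> and its cotangent bundle, where the tangent spaces
  are identified with those of the covering spaces \<open>\<real>\<^sup>d\<close> and \<open>\<real>\<^sup>d \<times> \<real>\<^sup>d\<close> through the covering
  maps \<open>\<rho>\<close> (of the source) and \<open>\<sigma>\<close> (of the target). The map \<open>H\<close> is a local lift of \<open>G\<close> at a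
  point \<open>a\<close> above \<open>z\<close>. The linear map \<open>L\<close> does not depend on \<open>a\<close> and \<open>H\<close>: after a deck
  translation of the source, two such lifts that are differentiable at \<open>a\<close> differ near \<open>a\<close> by a
  constant lattice vector.\<close>
definition has_covering_derivative ::
    "('a::real_normed_vector \<Rightarrow> 'm) \<Rightarrow> ('b::real_normed_vector \<Rightarrow> 'k) \<Rightarrow>
     ('m \<Rightarrow> 'k) \<Rightarrow> ('a \<Rightarrow> 'b) \<Rightarrow> 'm \<Rightarrow> bool" where
  "has_covering_derivative \<rho> \<sigma> G L z \<longleftrightarrow>
     (\<exists>a H. \<rho> a = z \<and> (\<forall>\<^sub>F w in nhds a. G (\<rho> w) = \<sigma> (H w)) \<and> (H has_derivative L) (at a))"

definition covering_derivative ::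
    "('a::real_normed_vector \<Rightarrow> 'm) \<Rightarrow> ('b::real_normed_vector \<Rightarrow> 'k) \<Rightarrow>
     ('m \<Rightarrow> 'k) \<Rightarrow> 'm \<Rightarrow> 'a \<Rightarrow> 'b" where
  "covering_derivative \<rho> \<sigma> G z = (SOME L. has_covering_derivative \<rho> \<sigma> G L z)"

text \<open>The kernel of the differential of the canonical projection \<open>fst\<close>.\<close>
definition vertical :: "'n torus \<times> (real^'n) \<Rightarrow> ((real^'n) \<times> (real^'n)) set" where
  "vertical z = {v. covering_derivative cotangent_proj torus_proj fst z v = 0}"

definition int_iterate :: "('a \<Rightarrow> 'a) \<Rightarrow> int \<Rightarrow> 'a \<Rightarrow> 'a" where
  "int_iterate F n = (if 0 \<le> n then F ^^ nat n else inv F ^^ nat (- n))"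

definition without_conjugate_points ::
    "('n torus \<times> (real^'n) \<Rightarrow> 'n torus \<times> (real^'n)) \<Rightarrow> bool" where
  "without_conjugate_points F \<longleftrightarrow>
     (\<forall>z. \<forall>n::int. n \<noteq> 0 \<longrightarrow>
        vertical (int_iterate F n z) \<inter>
          covering_derivative cotangent_proj cotangent_proj (int_iterate F n) z ` vertical z = {0})"

section \<open>Graphs and foliations\<close>

definition section_graph :: "('n torus \<Rightarrow> real^'n) \<Rightarrow> ('n torus \<times> (real^'n)) set" where
  "section_graph \<eta> = range (\<lambda>x. (x, \<eta> x))"

text \<open>The lift of the 1-form \<open>\<eta>\<close> to \<open>\<real>\<^sup>d\<close> is the differential of a function \<open>u\<close>; if \<open>\<eta>\<close> is
  Lipschitz, as it is below, such a \<open>u\<close> is automatically \<open>C\<^sup>1\<close> with Lipschitz differential.\<close>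
definition closed_form :: "('n torus \<Rightarrow> real^'n) \<Rightarrow> bool" where
  "closed_form \<eta> \<longleftrightarrow>
     (\<exists>u :: real^'n \<Rightarrow> real. \<forall>x. (u has_derivative (\<lambda>v. \<eta> (torus_proj x) \<bullet> v)) (at x))"

definition lipschitz_lagrangian_graph :: "('n torus \<times> (real^'n)) set \<Rightarrow> bool" where
  "lipschitz_lagrangian_graph G \<longleftrightarrow>
     (\<exists>\<eta>. G = section_graph \<eta> \<and> (\<exists>K. K-lipschitz_on UNIV \<eta>) \<and> closed_form \<eta>)"

text \<open>A topological foliation of the \<open>2d\<close>-manifold \<open>\<bbbT>\<^sup>d \<times> \<real>\<^sup>d\<close> with \<open>d\<close>-dimensional leaves: a
  partition into connected sets such that around every point there is a topological chart
  \<open>\<phi> : U \<rightarrow> \<real>\<^sup>d \<times> \<real>\<^sup>d\<close> in which, for every leaf \<open>L\<close>, the connected components of \<open>L \<inter> U\<close> (the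
  plaques) are slices where the second coordinate is constant.\<close>
definition continuous_foliation :: "('n torus \<times> (real^'n)) set set \<Rightarrow> bool" where
  "continuous_foliation \<F> \<longleftrightarrow>
     partition_on UNIV \<F> \<and> (\<forall>L\<in>\<F>. connected L) \<and>
     (\<forall>z. \<exists>U (\<phi> :: _ \<Rightarrow> (real^'n) \<times> (real^'n)) \<psi>.
        open U \<and> z \<in> U \<and> homeomorphism U UNIV \<phi> \<psi> \<and>
        (\<forall>L\<in>\<F>. components (L \<inter> U) = {\<psi> ` (UNIV \<times> {c}) | c. c \<in> snd ` \<phi> ` (L \<inter> U)}))"

end

theory Submission
  imports Defs
begin

text \<open>If the leaves of a foliation are invariant Lagrangian graphs with potentials \<open>U\<close>, then
  \<open>S x y - U y + U x\<close> attains its minimum exactly at the steps of the dynamics on the leaf. Hence all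
  orbits minimize the action, and comparing two orbits with the same initial position shows that the
  vertical fibre is expanded at a positive rate, which excludes conjugate points.

  Conversely, without conjugate points a mountain pass argument shows that any two points of the
  cover are joined by exactly one orbit of \<open>n\<close> steps, so that all orbits minimize. The action of the
  orbit from \<open>x\<close> to \<open>x + r\<close> in \<open>N\<close> steps then does not depend on \<open>x\<close>, for \<open>r\<close> in the lattice.
  Therefore, for every cohomology class \<open>c\<close>, almost calibrated loops pass through every point (the
  projected Aubry set is the whole torus), and the critical subsolution of class \<open>c\<close> is unique up to
  a constant and \<open>C\<^sup>1\<^sup>,\<^sup>1\<close>; its differential is an invariant graph. Leaves of different classes are
  disjoint, since a common orbit would make the mean of the two potentials a subsolution of the mean
  class whose calibrated steps are common to both leaves. Continuity and properness in \<open>c\<close> and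
  invariance of domain show that these leaves form a foliation.\<close>

section \<open>Calculus in Euclidean spaces\<close>

text \<open>The twist condition is not inherited by iterates, so uniqueness of the orbit between two
  points in several steps cannot come from monotonicity. What the absence of conjugate points gives
  is only that certain Hessians at critical points are nondegenerate. These Hessians depend
  continuously on the initial momentum, which ranges over a connected space, and one of them belongs
  to a global minimum; so all of them are positive definite. A coercive function whose critical
  points are all strict local minima has just one, since between two of them there would be a
  mountain pass. The second obstacle is regularity: a leaf is merely Lipschitz and is never
  differentiated. Statements about it are obtained by moving one point of a calibrated pair: the
  linear terms of action and potential cancel and a quadratic error remains. The same device shows
  that the critical value is constant, that the fibre expands, and that critical subsolutions are
  differentiable.\<close>

lemma gradient_mvt:
  fixes f :: "'a::euclidean_space \<Rightarrow> real"
  assumes der: "\<And>x. (f has_derivative (\<lambda>h. V x \<bullet> h)) (at x)"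
  shows "\<exists>t. 0 < t \<and> t < 1 \<and> f (x + h) - f x = V (x + t *\<^sub>R h) \<bullet> h"
proof -
  have g: "((\<lambda>t. f (x + t *\<^sub>R h)) has_derivative (\<lambda>s. V (x + t *\<^sub>R h) \<bullet> (s *\<^sub>R h)))
      (at t within {0..1})" for t :: real
    by (rule has_derivative_compose[OF _ der]) (auto intro!: derivative_eq_intros)
  obtain t :: real where "t \<in> {0<..<1}" "f (x + 1 *\<^sub>R h) - f (x + 0 *\<^sub>R h) = V (x + t *\<^sub>R h) \<bullet> ((1 - 0) *\<^sub>R h)"
    using mvt_simple[of "0::real" 1 "\<lambda>t. f (x + t *\<^sub>R h)", OF _ g] by auto
  then show ?thesis
    by auto
qed

lemma gradient_continuous:
  fixes f :: "'a::euclidean_space \<Rightarrow> real"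
  assumes "\<And>x. (f has_derivative (\<lambda>h. V x \<bullet> h)) (at x)"
  shows "continuous_on UNIV f"
proof (rule continuous_at_imp_continuous_on, rule ballI)
  fix x show "isCont f x" by (rule has_derivative_continuous[OF assms])
qed

text \<open>The mean value theorem in direction \<open>v\<close>, applied to
  \<open>f (y + t *\<^sub>R w) - f y\<close>, turns the second difference into a difference of
  \<open>V\<close> at two points at distance O(t) from \<open>x\<close>, where the expansion of
  \<open>V\<close> at \<open>x\<close> applies. The formula treats \<open>v\<close> and
  \<open>w\<close> differently on purpose: interchanging them yields the symmetry of
  \<open>H\<close>.\<close>

lemma second_difference_limit:
  fixes f :: "'a::euclidean_space \<Rightarrow> real"
  assumes der: "\<And>x. (f has_derivative (\<lambda>h. V x \<bullet> h)) (at x)"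
    and der2: "(V has_derivative H) (at x)"
  shows "((\<lambda>t. (f (x + t *\<^sub>R v + t *\<^sub>R w) - f (x + t *\<^sub>R v) - f (x + t *\<^sub>R w) + f x) / t\<^sup>2)
           \<longlongrightarrow> H w \<bullet> v) (at_right 0)"
proof -
  define g where "g t = f (x + t *\<^sub>R v + t *\<^sub>R w) - f (x + t *\<^sub>R v) - f (x + t *\<^sub>R w) + f x" for t
  define N where "N = norm v + norm w + 1"
  have N: "N > 0" "norm v \<le> N" "norm v + norm w \<le> N" by (auto simp: N_def add_nonneg_pos)
  interpret H: bounded_linear H using der2 by (rule has_derivative_bounded_linear)
  have "((\<lambda>t. g t / t\<^sup>2) \<longlongrightarrow> H w \<bullet> v) (at_right 0)"
  proof (rule tendstoI)
    fix e :: real assume "e > 0"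
    \<comment> \<open>Two expansion errors of size \<open>e' * (t * N)\<close> are paired with a
      vector of length at most \<open>t * N\<close>, which leaves \<open>e / 2\<close> after
      division by \<open>t\<^sup>2\<close>.\<close>
    define e' where "e' = e / (4 * N * N)"
    have e': "e' > 0" using \<open>e > 0\<close> N by (simp add: e'_def)
    obtain d where d: "d > 0" "\<And>y. norm (y - x) < d \<Longrightarrow> norm (V y - V x - H (y - x)) \<le> e' * norm (y - x)"
      using der2 e' unfolding has_derivative_at_alt by blast
    have "\<bar>g t / t\<^sup>2 - H w \<bullet> v\<bar> < e" if t: "0 < t" "t < d / N" for t
    proof -
      have tN: "t * N < d" using t N by (simp add: field_simps)
      have der3: "((\<lambda>y. f (y + t *\<^sub>R w) - f y) has_derivative (\<lambda>h. (V (y + t *\<^sub>R w) - V y) \<bullet> h)) (at y)" for y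
      proof -
        have "((\<lambda>y. f (y + t *\<^sub>R w)) has_derivative (\<lambda>h. V (y + t *\<^sub>R w) \<bullet> h)) (at y)"
          by (rule has_derivative_compose[OF _ der]) (auto intro!: derivative_eq_intros)
        then show ?thesis by (auto intro!: derivative_eq_intros der simp: inner_diff_left)
      qed
      obtain s where s: "0 < s" "s < 1"
        "(f (x + t *\<^sub>R v + t *\<^sub>R w) - f (x + t *\<^sub>R v)) - (f (x + t *\<^sub>R w) - f x)
           = (V (x + s *\<^sub>R t *\<^sub>R v + t *\<^sub>R w) - V (x + s *\<^sub>R t *\<^sub>R v)) \<bullet> (t *\<^sub>R v)"
        using gradient_mvt[OF der3, of x "t *\<^sub>R v"] by auto
      define y1 where "y1 = x + s *\<^sub>R t *\<^sub>R v + t *\<^sub>R w"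
      define y2 where "y2 = x + s *\<^sub>R t *\<^sub>R v"
      have n2: "norm (y2 - x) \<le> t * N"
      proof -
        have "norm (y2 - x) = s * t * norm v" using s t by (simp add: y2_def)
        also have "\<dots> \<le> 1 * t * norm v" using s t by (intro mult_right_mono) auto
        also have "\<dots> \<le> t * N" using t N by (simp)
        finally show ?thesis .
      qed
      have n1: "norm (y1 - x) \<le> t * N"
      proof -
        have "norm (y1 - x) \<le> s * t * norm v + t * norm w"
          using s t norm_triangle_ineq[of "s *\<^sub>R t *\<^sub>R v" "t *\<^sub>R w"] by (simp add: y1_def add.assoc)
        also have "\<dots> \<le> 1 * t * norm v + t * norm w" using s t by (intro add_right_mono mult_right_mono) auto
        also have "\<dots> = t * (norm v + norm w)" by (simp add: algebra_simps)
        also have "\<dots> \<le> t * N" using t N by (simp)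
        finally show ?thesis .
      qed
      have b1: "norm (V y1 - V x - H (y1 - x)) \<le> e' * (t * N)"
        by (rule order.trans[OF d(2)]) (use n1 tN e' in \<open>auto intro: mult_left_mono\<close>)
      have b2: "norm (V y2 - V x - H (y2 - x)) \<le> e' * (t * N)"
        by (rule order.trans[OF d(2)]) (use n2 tN e' in \<open>auto intro: mult_left_mono\<close>)
      have Hw: "H (y1 - x) - H (y2 - x) = t *\<^sub>R H w"
        by (simp add: H.diff[symmetric] H.scaleR[symmetric] y1_def y2_def)
      have eq: "V y1 - V y2 - t *\<^sub>R H w = (V y1 - V x - H (y1 - x)) - (V y2 - V x - H (y2 - x))"
        using Hw by (simp add: algebra_simps)
      have b3: "norm (V y1 - V y2 - t *\<^sub>R H w) \<le> 2 * (e' * (t * N))"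
        unfolding eq mult_2 by (rule order.trans[OF norm_triangle_ineq4 add_mono[OF b1 b2]])
      have "g t - t\<^sup>2 * (H w \<bullet> v) = t * ((V y1 - V y2 - t *\<^sub>R H w) \<bullet> v)"
        using s(3) by (simp add: g_def y1_def y2_def algebra_simps power2_eq_square inner_diff_left)
      then have "\<bar>g t - t\<^sup>2 * (H w \<bullet> v)\<bar> \<le> t * (norm (V y1 - V y2 - t *\<^sub>R H w) * norm v)"
        using t Cauchy_Schwarz_ineq2[of "V y1 - V y2 - t *\<^sub>R H w" v] by (simp add: abs_mult)
      also have "\<dots> \<le> t * ((2 * (e' * (t * N))) * N)"
        using b3 N t e' by (intro mult_left_mono mult_mono) auto
      also have "\<dots> = t\<^sup>2 * (e / 2)" using N by (simp add: e'_def power2_eq_square field_simps)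
      finally have *: "\<bar>g t - t\<^sup>2 * (H w \<bullet> v)\<bar> \<le> t\<^sup>2 * (e / 2)" .
      have "g t / t\<^sup>2 - H w \<bullet> v = (g t - t\<^sup>2 * (H w \<bullet> v)) / t\<^sup>2" using t by (simp add: field_simps)
      then have "\<bar>g t / t\<^sup>2 - H w \<bullet> v\<bar> = \<bar>g t - t\<^sup>2 * (H w \<bullet> v)\<bar> / t\<^sup>2" by simp
      also have "\<dots> \<le> e / 2" using * t by (simp add: field_simps)
      also have "\<dots> < e" using \<open>e > 0\<close> by simp
      finally show ?thesis .
    qed
    then have "\<forall>t. 0 < t \<and> t < d / N \<longrightarrow> dist (g t / t\<^sup>2) (H w \<bullet> v) < e" by (simp add: dist_real_def)
    moreover have "0 < d / N" using d N by simp
    ultimately show "\<forall>\<^sub>F t in at_right 0. dist (g t / t\<^sup>2) (H w \<bullet> v) < e"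
      unfolding eventually_at_right_field by blast
  qed
  then show ?thesis by (simp add: g_def)
qed

text \<open>The second difference is symmetric in \<open>v\<close> and \<open>w\<close>, so its two
  limits coincide.\<close>

lemma symmetric_second_derivative:
  fixes f :: "'a::euclidean_space \<Rightarrow> real"
  assumes der: "\<And>x. (f has_derivative (\<lambda>h. V x \<bullet> h)) (at x)"
    and der2: "(V has_derivative H) (at x)"
  shows "H v \<bullet> w = H w \<bullet> v"
proof -
  have "((\<lambda>t. (f (x + t *\<^sub>R v + t *\<^sub>R w) - f (x + t *\<^sub>R v) - f (x + t *\<^sub>R w) + f x) / t\<^sup>2)
           \<longlongrightarrow> H v \<bullet> w) (at_right 0)"
    using second_difference_limit[OF der der2, of w v]
    by (simp add: algebra_simps)
  from tendsto_unique[OF _ this second_difference_limit[OF der der2, of v w]]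
  show ?thesis by simp
qed

text \<open>Two mean value steps: one for \<open>f\<close>, one for the component of
  \<open>V\<close> along \<open>h\<close>, whose gradient is \<open>H x h\<close> by symmetry. Both
  intermediate points lie on the segment, so \<open>H\<close> has to be controlled only there and
  only in the direction \<open>h\<close>.\<close>

lemma hessian_bound_taylor:
  fixes f :: "'a::euclidean_space \<Rightarrow> real"
  assumes der: "\<And>x. (f has_derivative (\<lambda>h. V x \<bullet> h)) (at x)"
    and der2: "\<And>x. (V has_derivative H x) (at x)"
    and bound: "\<And>s. 0 < s \<Longrightarrow> s < 1 \<Longrightarrow> norm (H (x + s *\<^sub>R h) h) \<le> K * norm h"
  shows "\<bar>f (x + h) - f x - V x \<bullet> h\<bar> \<le> K * (norm h)\<^sup>2"
proof -
  obtain t where t: "0 < t" "t < 1" "f (x + h) - f x = V (x + t *\<^sub>R h) \<bullet> h"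
    using gradient_mvt[OF der] by blast
  have "((\<lambda>x. V x \<bullet> h) has_derivative (\<lambda>k. H x h \<bullet> k)) (at x)" for x
    using has_derivative_inner_left[OF der2, of h x] symmetric_second_derivative[OF der der2, of x _ h] by simp
  from gradient_mvt[OF this, of x "t *\<^sub>R h"] obtain s where s: "0 < s" "s < 1"
    "V (x + t *\<^sub>R h) \<bullet> h - V x \<bullet> h = H (x + s *\<^sub>R t *\<^sub>R h) h \<bullet> (t *\<^sub>R h)" by blast
  have "s * t < 1" using s t mult_strict_mono[of s 1 t 1] by simp
  then have n: "norm (H (x + s *\<^sub>R t *\<^sub>R h) h) \<le> K * norm h" using bound[of "s * t"] s t by simp
  have "\<bar>H (x + s *\<^sub>R t *\<^sub>R h) h \<bullet> (t *\<^sub>R h)\<bar> \<le> norm (H (x + s *\<^sub>R t *\<^sub>R h) h) * norm (t *\<^sub>R h)"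
    by (rule Cauchy_Schwarz_ineq2)
  also have "\<dots> \<le> (K * norm h) * norm h"
    using n t order.trans[OF norm_ge_zero n] by (intro mult_mono) (auto intro: mult_left_le_one_le)
  finally show ?thesis using s(3) t(3) by (simp add: power2_eq_square)
qed

lemma gradient_bounded_lipschitz:
  fixes f :: "'a::euclidean_space \<Rightarrow> real"
  assumes "\<And>x. (f has_derivative (\<lambda>h. V x \<bullet> h)) (at x)" "\<And>x. norm (V x) \<le> B"
  shows "\<bar>f y - f x\<bar> \<le> B * norm (y - x)"
proof -
  obtain t where "f (x + (y - x)) - f x = V (x + t *\<^sub>R (y - x)) \<bullet> (y - x)"
    using gradient_mvt[OF assms(1)] by blast
  then show ?thesis
    using Cauchy_Schwarz_ineq2[of "V (x + t *\<^sub>R (y - x))" "y - x"]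
      mult_right_mono[OF assms(2), of "norm (y - x)" "x + t *\<^sub>R (y - x)"] by simp
qed

lemma linear_unit_ball_bound:
  fixes f :: "'a::real_normed_vector \<Rightarrow> 'b::real_normed_vector"
  assumes lin: "linear f" and bound: "\<And>v. v \<in> cball 0 1 \<Longrightarrow> norm (f v) \<le> K"
  shows "norm (f v) \<le> K * norm v"
proof (cases "v = 0")
  case False
  have "f v = norm v *\<^sub>R f (v /\<^sub>R norm v)" using False by (simp add: linear_cmul[OF lin])
  then have "norm (f v) = norm (f (v /\<^sub>R norm v)) * norm v" by (metis norm_scaleR abs_norm_cancel mult.commute)
  moreover have "norm (f (v /\<^sub>R norm v)) \<le> K" using False by (intro bound) simp
  ultimately show ?thesis using mult_right_mono norm_ge_zero by metis
qed (simp add: linear_0[OF lin])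

text \<open>Mountain pass: a gradient step fixes two given zeros and lowers any continuum of least height
  that joins them.\<close>

lemma unique_critical_point:
  fixes f :: "'a::euclidean_space \<Rightarrow> real"
  assumes der: "\<And>x. (f has_derivative (\<lambda>h. V x \<bullet> h)) (at x)"
    and contV: "continuous_on UNIV V"
    and coer: "\<And>c. bounded {x. f x \<le> c}"
    and strict: "\<And>x. V x = 0 \<Longrightarrow> \<exists>e>0. \<forall>y. y \<noteq> x \<and> dist y x < e \<longrightarrow> f x < f y"
    and a: "V a = 0" and b: "V b = 0"
  shows "a = b"
proof (rule ccontr)
  assume "a \<noteq> b"
  have contf: "continuous_on UNIV f" using der by (rule gradient_continuous)
  define K where "K c = {x. f x \<le> c}" for c
  have Kclosed: "closed (K c)" for c
    unfolding K_def using continuous_on_closed_Collect_le[OF contf, of "\<lambda>_. c"] by simp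
  have Kcompact: "compact (K c)" for c
    using coer Kclosed by (auto simp: compact_eq_bounded_closed K_def)
  define comp where "comp c = connected_component_set (K c) a" for c
  \<comment> \<open>\<open>G\<close> collects the heights at which \<open>a\<close> and
    \<open>b\<close> lie in one component of the sublevel set; its infimum \<open>c0\<close> is the
    mountain pass level.\<close>
  define G where "G = {c. b \<in> comp c}"
  have compK: "comp c \<subseteq> K c" for c by (simp add: comp_def connected_component_subset)
  have compmono: "comp c \<subseteq> comp d" if "c \<le> d" for c d
    unfolding comp_def using that by (intro connected_component_mono) (auto simp: K_def)
  have Gne: "G \<noteq> {}"
  proof -
    define R where "R = max (norm a) (norm b)"
    have "bounded (f ` cball 0 R)"
      by (intro compact_imp_bounded compact_continuous_image continuous_on_subset[OF contf]) auto
    then obtain c where c: "\<And>x. x \<in> cball 0 R \<Longrightarrow> f x \<le> c"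
      unfolding bounded_iff by (metis abs_le_D1 imageI real_norm_def)
    have "b \<in> comp c" unfolding comp_def mem_Collect_eq connected_component_def
      by (rule exI[of _ "cball 0 R"]) (auto simp: R_def K_def intro!: c)
    then show ?thesis by (auto simp: G_def)
  qed
  have Gbd: "f b \<le> c" if "c \<in> G" for c using that compK by (auto simp: G_def K_def)
  then have bddG: "bdd_below G" by (auto simp: bdd_below_def)
  define c0 where "c0 = Inf G"
  define S where "S n = comp (c0 + 1 / (real n + 1))" for n :: nat
  have bS: "b \<in> S n" for n
  proof -
    have "Inf G < c0 + 1 / (real n + 1)" by (simp add: c0_def)
    then obtain c where "c \<in> G" "c < c0 + 1 / (real n + 1)" using cInf_lessD[OF Gne] by blast
    then show ?thesis using compmono[of c "c0 + 1 / (real n + 1)"] by (auto simp: S_def G_def)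
  qed
  have aS: "a \<in> S n" for n
    using bS[of n] unfolding S_def comp_def
    by (metis connected_component_eq_empty connected_component_refl empty_iff mem_Collect_eq)
  have Scomp: "compact (S n)" for n
  proof -
    have "closed (S n)" unfolding S_def comp_def using Kclosed by (rule closed_connected_component)
    moreover have "bounded (S n)"
      unfolding S_def using compK Kcompact bounded_subset compact_imp_bounded by metis
    ultimately show ?thesis by (simp add: compact_eq_bounded_closed)
  qed
  have "connected (S n)" for n by (simp add: S_def comp_def connected_connected_component)
  moreover have "S n \<subseteq> S m" if "m \<le> n" for m n
    unfolding S_def using that by (intro compmono) (simp add: frac_le)
  \<comment> \<open>Coercivity makes the sets \<open>S n\<close> compact, and a decreasing sequence
    of compact connected sets has a connected intersection. So a continuum of height at most
    \<open>c0\<close> itself joins \<open>a\<close> and \<open>b\<close>.\<close>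
  ultimately have Ccon: "connected (\<Inter>(range S))" using Scomp by (intro connected_nest) auto
  define C where "C = \<Inter>(range S)"
  have Ccomp: "compact C" unfolding C_def using Scomp by (intro compact_Inter) auto
  have abC: "a \<in> C" "b \<in> C" using aS bS by (auto simp: C_def)
  have Cle: "f x \<le> c0" if "x \<in> C" for x
  proof (rule field_le_epsilon)
    fix e :: real assume "e > 0"
    obtain n where n: "1 / (real n + 1) < e"
      using \<open>e > 0\<close> by (metis add.commute nat_approx_posE of_nat_Suc)
    have "x \<in> S n" using that by (auto simp: C_def)
    then have "f x \<le> c0 + 1 / (real n + 1)" using compK by (auto simp: S_def K_def)
    then show "f x \<le> c0 + e" using n by simp
  qed
  \<comment> \<open>A critical point of \<open>C\<close> at height \<open>c0\<close> would be a
    strict local minimum, but the connected set \<open>C\<close> has other points arbitrarily close,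
    all of height at most \<open>c0\<close>.\<close>
  have noncrit: "V x \<noteq> 0" if x: "x \<in> C" "f x = c0" for x
  proof
    assume "V x = 0"
    then obtain e where e: "e > 0" "\<And>y. y \<noteq> x \<Longrightarrow> dist y x < e \<Longrightarrow> f x < f y" using strict by blast
    have "x islimpt C"
      using Ccon x abC \<open>a \<noteq> b\<close> connected_imp_perfect[of C x] unfolding C_def[symmetric] by blast
    then obtain y where "y \<in> C" "y \<noteq> x" "dist y x < e" using e(1) by (auto simp: islimpt_approachable)
    then show False using e(2)[of y] Cle[of y] x by auto
  qed
  \<comment> \<open>One step length must serve all of \<open>C\<close>. Otherwise bad points
    accumulate at some \<open>x\<close> of height \<open>c0\<close>, where \<open>V x\<close> is
    nonzero and short gradient steps from nearby points go strictly down.\<close>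
  have "\<exists>n::nat. \<forall>x\<in>C. f (x - (1 / (real n + 1)) *\<^sub>R V x) < c0"
  proof (rule ccontr)
    assume "\<not> ?thesis"
    then have "\<forall>n::nat. \<exists>x\<in>C. c0 \<le> f (x - (1 / (real n + 1)) *\<^sub>R V x)" by (auto simp: not_less)
    then obtain X where X: "\<And>n. X n \<in> C" "\<And>n. c0 \<le> f (X n - (1 / (real n + 1)) *\<^sub>R V (X n))" by metis
    obtain x r where xr: "x \<in> C" "strict_mono r" "(X \<circ> r) \<longlonglongrightarrow> x"
      using Ccomp X(1) unfolding compact_def by (metis (no_types, lifting))
    define e where "e n = 1 / (real (r n) + 1)" for n
    have e0: "e \<longlonglongrightarrow> 0"
    proof -
      have "(\<lambda>n. 1 / (real n + 1)) \<longlonglongrightarrow> 0"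
        using LIMSEQ_inverse_real_of_nat by (simp add: inverse_eq_divide add.commute)
      from LIMSEQ_subseq_LIMSEQ[OF this xr(2)] show ?thesis by (simp add: e_def[abs_def] o_def)
    qed
    have epos: "e n > 0" for n by (simp add: e_def add_nonneg_pos)
    define Y where "Y = X \<circ> r"
    have Y: "Y \<longlonglongrightarrow> x" "\<And>n. Y n \<in> C" "\<And>n. c0 \<le> f (Y n - e n *\<^sub>R V (Y n))"
      using xr X by (auto simp: Y_def e_def)
    have VY: "(\<lambda>n. V (Y n)) \<longlonglongrightarrow> V x"
      using continuous_on_tendsto_compose[OF contV Y(1)] by simp
    have eV: "(\<lambda>n. e n *\<^sub>R V (Y n)) \<longlonglongrightarrow> 0" using tendsto_scaleR[OF e0 VY] by simp
    have "(\<lambda>n. Y n - e n *\<^sub>R V (Y n)) \<longlonglongrightarrow> x" using tendsto_diff[OF Y(1) eV] by simp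
    then have "(\<lambda>n. f (Y n - e n *\<^sub>R V (Y n))) \<longlonglongrightarrow> f x"
      using continuous_on_tendsto_compose[OF contf] by simp
    then have "c0 \<le> f x" using Y(3) by (intro LIMSEQ_le_const) auto
    then have Vx: "V x \<noteq> 0" using noncrit xr(1) Cle[of x] by force
    have "\<exists>t. 0 < t \<and> t < 1 \<and> f (Y n + (- e n *\<^sub>R V (Y n))) - f (Y n)
        = V (Y n + t *\<^sub>R (- e n *\<^sub>R V (Y n))) \<bullet> (- e n *\<^sub>R V (Y n))" for n
      by (rule gradient_mvt[OF der])
    then obtain t where t: "\<And>n. 0 < t n" "\<And>n. t n < 1"
      "\<And>n. f (Y n + (- e n *\<^sub>R V (Y n))) - f (Y n)
        = V (Y n + t n *\<^sub>R (- e n *\<^sub>R V (Y n))) \<bullet> (- e n *\<^sub>R V (Y n))" by metis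
    define Z where "Z n = Y n + t n *\<^sub>R (- e n *\<^sub>R V (Y n))" for n
    have "(\<lambda>n. t n *\<^sub>R (- e n *\<^sub>R V (Y n))) \<longlonglongrightarrow> 0"
    proof (rule Lim_null_comparison[OF _ tendsto_norm_zero[OF eV]])
      show "\<forall>\<^sub>F n in sequentially. norm (t n *\<^sub>R (- e n *\<^sub>R V (Y n))) \<le> norm (e n *\<^sub>R V (Y n))"
      proof (intro always_eventually allI)
        fix n
        have "\<bar>t n\<bar> * (\<bar>e n\<bar> * norm (V (Y n))) \<le> 1 * (\<bar>e n\<bar> * norm (V (Y n)))"
          using t(1,2)[of n] by (intro mult_right_mono) auto
        then show "norm (t n *\<^sub>R (- e n *\<^sub>R V (Y n))) \<le> norm (e n *\<^sub>R V (Y n))"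
          by (simp add: abs_mult mult.assoc)
      qed
    qed
    then have "Z \<longlonglongrightarrow> x" unfolding Z_def[abs_def] using tendsto_add[OF Y(1)] by fastforce
    then have "(\<lambda>n. V (Z n)) \<longlonglongrightarrow> V x" using continuous_on_tendsto_compose[OF contV] by simp
    then have "(\<lambda>n. V (Z n) \<bullet> V (Y n)) \<longlonglongrightarrow> V x \<bullet> V x" using VY by (intro tendsto_inner)
    then have "\<forall>\<^sub>F n in sequentially. V (Z n) \<bullet> V (Y n) > 0"
      using Vx by (intro order_tendstoD(1)) auto
    then obtain n where n: "V (Z n) \<bullet> V (Y n) > 0" using eventually_happens by force
    have "f (Y n - e n *\<^sub>R V (Y n)) = f (Y n) - e n * (V (Z n) \<bullet> V (Y n))"
      using t(3)[of n] by (simp add: Z_def algebra_simps)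
    also have "\<dots> < f (Y n)" using n epos by simp
    finally show False using Y(2,3)[of n] Cle[of "Y n"] by simp
  qed
  then obtain n :: nat where n: "\<And>x. x \<in> C \<Longrightarrow> f (x - (1 / (real n + 1)) *\<^sub>R V x) < c0" by blast
  define T where "T x = x - (1 / (real n + 1)) *\<^sub>R V x" for x
  have contT: "continuous_on C T"
    unfolding T_def by (intro continuous_intros continuous_on_subset[OF contV]) auto
  have TC: "compact (T ` C)" "connected (T ` C)"
    using compact_continuous_image[OF contT Ccomp] connected_continuous_image[OF contT] Ccon
    by (auto simp: C_def)
  obtain y where y: "y \<in> T ` C" "\<And>z. z \<in> T ` C \<Longrightarrow> f z \<le> f y"
    using continuous_attains_sup[OF TC(1) _ continuous_on_subset[OF contf]] abC by blast
  have "b \<in> comp (f y)" unfolding comp_def mem_Collect_eq connected_component_def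
  proof (intro exI[of _ "T ` C"] conjI)
    show "T ` C \<subseteq> K (f y)" using y by (auto simp: K_def)
    have "T a = a" "T b = b" using a b by (auto simp: T_def)
    then show "a \<in> T ` C" "b \<in> T ` C" using abC by (metis imageI)+
  qed (rule TC)
  then have "c0 \<le> f y" unfolding c0_def using bddG by (auto simp: G_def intro: cInf_lower)
  moreover have "f y < c0" using y(1) n by (auto simp: T_def)
  ultimately show False by simp
qed

text \<open>The range is open by invariance of domain and closed because coercivity bounds the
  preimages of a convergent sequence; connectedness does the rest. It serves for \<open>S2\<close>
  in its first argument and for the momentum of a leaf as a function of its class.\<close>

lemma inj_coercive_bij:
  fixes f :: "'a::euclidean_space \<Rightarrow> 'a"
  assumes cont: "continuous_on UNIV f" and inj: "inj f"
    and coer: "\<And>c. bounded {x. norm (f x) \<le> c}"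
  shows "bij f" "continuous_on UNIV (inv f)"
proof -
  have op: "open (range f)" using invariance_of_domain[OF cont _ inj] by simp
  have cl: "closed (range f)"
    unfolding closed_sequential_limits
  proof (intro allI impI, elim conjE)
    fix y l assume y: "\<forall>n. y n \<in> range f" "y \<longlonglongrightarrow> l"
    then obtain x where x: "\<And>n. y n = f (x n)" by (auto simp: image_iff choice_iff) 
    have "bounded (range y)" using y(2) by (rule convergent_imp_bounded)
    then obtain c where "\<And>n. norm (f (x n)) \<le> c" unfolding bounded_iff using x by auto
    then have "range x \<subseteq> {x. norm (f x) \<le> c}" by auto
    then have "bounded (range x)" using coer bounded_subset by blast
    then obtain l' r where lr: "strict_mono r" "(x \<circ> r) \<longlonglongrightarrow> l'" using bounded_imp_convergent_subsequence by blast
    have "(\<lambda>n. f ((x \<circ> r) n)) \<longlonglongrightarrow> f l'" using continuous_on_tendsto_compose[OF cont lr(2)] by simp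
    moreover have "(\<lambda>n. f ((x \<circ> r) n)) \<longlonglongrightarrow> l" using LIMSEQ_subseq_LIMSEQ[OF y(2) lr(1)] x by (simp add: o_def)
    ultimately have "l = f l'" using LIMSEQ_unique by blast
    then show "l \<in> range f" by simp
  qed
  have "range f = UNIV" using clopen[of "range f"] op cl by auto
  then show "bij f" using inj by (simp add: bij_def)
  then show "continuous_on UNIV (inv f)"
    using continuous_on_inverse_open[OF open_UNIV cont, of "inv f"] inj \<open>range f = UNIV\<close> by (auto simp: inv_f_f)
qed

section \<open>Twist systems on the universal cover\<close>

lemma linear_gradient_inner:
  fixes g :: "real^'n \<Rightarrow> real"
  assumes "linear g"
  shows "(\<chi> i. g (axis i 1)) \<bullet> h = g h"
proof -
  have "g h = g (\<Sum>i\<in>UNIV. (h $ i) *\<^sub>R axis i 1)"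
    using basis_expansion[of h] by (simp add: scalar_mult_eq_scaleR)
  also have "\<dots> = (\<Sum>i\<in>UNIV. (h $ i) * g (axis i 1))"
    using assms by (simp add: linear_sum linear_cmul)
  finally show ?thesis by (simp add: inner_vec_def mult.commute)
qed

lemma gradient_inner:
  assumes "(f has_derivative f') (at x)"
  shows "gradient f x \<bullet> h = f' h"
proof -
  have "frechet_derivative f (at x) = f'" using frechet_derivative_at[OF assms] by simp
  then show ?thesis
    unfolding gradient_def using linear_gradient_inner[of f' h] has_derivative_linear[OF assms] by simp
qed

lemma exists_lattice_near:
  fixes x :: "real^'n"
  obtains r where "r \<in> int_lattice" "x - r \<in> cbox 0 1"
proof
  show "(\<chi> i. of_int \<lfloor>x $ i\<rfloor>) \<in> int_lattice" by (simp add: int_lattice_def)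
  show "x - (\<chi> i. of_int \<lfloor>x $ i\<rfloor>) \<in> cbox 0 1"
    by (auto simp: mem_box_cart less_imp_le) linarith+
qed

lemma int_lattice_uminus: "r \<in> int_lattice \<Longrightarrow> - r \<in> int_lattice"
  using int_lattice_diff[OF zero_int_lattice] by simp

lemma int_lattice_scaleR_of_nat: "r \<in> int_lattice \<Longrightarrow> real k *\<^sub>R r \<in> int_lattice"
  by (simp add: int_lattice_def)

lemma axis_int_lattice: "axis i 1 \<in> int_lattice"
  by (auto simp: int_lattice_def axis_def)

lemma norm_cube_le: "x \<in> cbox 0 1 \<Longrightarrow> norm (x :: real^'n) \<le> CARD('n)"
proof -
  assume "x \<in> cbox 0 1"
  then have "\<bar>x $ i\<bar> \<le> 1" for i by (simp add: mem_box_cart)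
  then have "(\<Sum>i\<in>UNIV. \<bar>x $ i\<bar>) \<le> (\<Sum>i\<in>(UNIV :: 'n set). 1)" by (intro sum_mono) auto
  then show ?thesis using norm_le_l1_cart[of x] by simp
qed

text \<open>Modulo simultaneous lattice translations the pairs at distance at most \<open>R\<close>
  form a bounded set: once \<open>x\<close> is moved into the unit cube, \<open>y\<close> stays in a
  fixed ball. The extra argument in \<open>C\<close> accommodates a derivative together with its
  direction.\<close>

lemma diagonal_periodic_bounded:
  fixes g :: "((real^'n) \<times> (real^'n)) \<times> 'b::topological_space \<Rightarrow> 'c::real_normed_vector"
  assumes cont: "continuous_on UNIV g"
    and per: "\<And>x y v r. r \<in> int_lattice \<Longrightarrow> g ((x + r, y + r), v) = g ((x, y), v)"
    and "compact C"
  obtains K where "K > 0" "\<And>x y v. norm (y - x) \<le> R \<Longrightarrow> v \<in> C \<Longrightarrow> norm (g ((x, y), v)) \<le> K"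
proof -
  define B where "B = ((cbox 0 1 :: (real^'n) set) \<times> (cball 0 (R + CARD('n)) :: (real^'n) set)) \<times> C"
  have "compact B" unfolding B_def using \<open>compact C\<close> by (intro compact_Times) auto
  then have "bounded (g ` B)"
    using compact_continuous_image[of B g] continuous_on_subset[OF cont] by (auto intro: compact_imp_bounded)
  then obtain K where K: "K > 0" "\<And>w. w \<in> B \<Longrightarrow> norm (g w) \<le> K"
    unfolding bounded_pos by auto
  show thesis
  proof
    fix x y :: "real^'n" and v assume *: "norm (y - x) \<le> R" "v \<in> C"
    obtain r where r: "r \<in> int_lattice" "x - r \<in> cbox 0 1" by (rule exists_lattice_near)
    have "norm (y - r) \<le> norm (y - x) + norm (x - r)"
      using norm_triangle_ineq[of "y - x" "x - r"] by simp
    then have "((x - r, y - r), v) \<in> B"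
      using * r norm_cube_le[OF r(2)] by (auto simp: B_def)
    then have "norm (g ((x - r, y - r), v)) \<le> K" by (rule K)
    moreover have "g ((x - r, y - r), v) = g ((x, y), v)"
      using per[OF r(1), of "x - r" "y - r" v] by simp
    ultimately show "norm (g ((x, y), v)) \<le> K" by simp
  qed (rule K)
qed

lemma has_derivative_slice_fst:
  assumes "(g has_derivative g') (at (x, y))"
  shows "((\<lambda>x. g (x, y)) has_derivative (\<lambda>h. g' (h, 0))) (at x)"
  by (rule has_derivative_compose[where f = "\<lambda>x. (x, y)" and f' = "\<lambda>h. (h, 0)" and g = g, OF _ assms])
    (auto intro!: derivative_eq_intros)

lemma has_derivative_slice_snd:
  assumes "(g has_derivative g') (at (x, y))"
  shows "((\<lambda>y. g (x, y)) has_derivative (\<lambda>h. g' (0, h))) (at y)"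
  by (rule has_derivative_compose[where f = "\<lambda>y. (x, y)" and f' = "\<lambda>h. (0, h)" and g = g, OF _ assms])
    (auto intro!: derivative_eq_intros)

text \<open>\<open>D1 z\<close> and \<open>D2 z\<close> are the two rows of the Hessian of
  \<open>S\<close> at \<open>z\<close>, applied to a pair of vectors. As \<open>D2 z (h, 0)\<close>
  is the mixed block, \<open>twist\<close> is the definiteness condition on a generating function
  without coordinates.\<close>

locale twist_system =
  fixes S :: "real^'n::finite \<Rightarrow> real^'n \<Rightarrow> real"
    and S1 S2 :: "real^'n \<Rightarrow> real^'n \<Rightarrow> real^'n"
    and D1 D2 :: "(real^'n) \<times> (real^'n) \<Rightarrow> (real^'n) \<times> (real^'n) \<Rightarrow> real^'n"
    and A :: real
    and Fb :: "(real^'n) \<times> (real^'n) \<Rightarrow> (real^'n) \<times> (real^'n)"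
  assumes S_deriv: "\<And>z. ((\<lambda>z. S (fst z) (snd z)) has_derivative
        (\<lambda>v. S1 (fst z) (snd z) \<bullet> fst v + S2 (fst z) (snd z) \<bullet> snd v)) (at z)"
    and S1_deriv: "\<And>z. ((\<lambda>z. S1 (fst z) (snd z)) has_derivative D1 z) (at z)"
    and S2_deriv: "\<And>z. ((\<lambda>z. S2 (fst z) (snd z)) has_derivative D2 z) (at z)"
    and D1_cont: "continuous_on UNIV (\<lambda>w. D1 (fst w) (snd w))"
    and D2_cont: "continuous_on UNIV (\<lambda>w. D2 (fst w) (snd w))"
    and A_pos: "A > 0"
    and twist: "\<And>z h. D2 z (h, 0) \<bullet> h \<le> - A * (norm h)\<^sup>2"
    and S_per: "\<And>x y r. r \<in> int_lattice \<Longrightarrow> S (x + r) (y + r) = S x y"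
    and gen: "\<And>x p x' p'. Fb (x, p) = (x', p') \<longleftrightarrow> p = - S1 x x' \<and> p' = S2 x x'"

lemma generating_function_twist_system:
  fixes S :: "real^'n::finite \<Rightarrow> real^'n \<Rightarrow> real"
  assumes "generating_function S" "generates S Fb"
  shows "\<exists>D1 D2 A. twist_system S (partial1 S) (partial2 S) D1 D2 A Fb"
proof -
  obtain f' f'' where f': "\<And>z. ((\<lambda>(x, y). S x y) has_derivative blinfun_apply (f' z)) (at z)"
    and f'': "\<And>z. (f' has_derivative blinfun_apply (f'' z)) (at z)"
    and cont: "continuous_on UNIV f''"
    using assms(1) unfolding generating_function_def C2_def by blast
  obtain A where A: "A > 0" "\<And>x y \<xi>. (\<Sum>i\<in>UNIV. \<Sum>j\<in>UNIV. mixed_partial S x y i j * \<xi> $ i * \<xi> $ j) \<le> - A * (norm \<xi>)\<^sup>2"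
    using assms(1) unfolding generating_function_def by blast
  have d1: "((\<lambda>x. S x y) has_derivative (\<lambda>h. f' (x, y) (h, 0))) (at x)" for x y
    using has_derivative_slice_fst[OF f'[of "(x, y)"]] by simp
  have d2: "((\<lambda>y. S x y) has_derivative (\<lambda>h. f' (x, y) (0, h))) (at y)" for x y
    using has_derivative_slice_snd[OF f'[of "(x, y)"]] by simp
  have p1: "partial1 S x y \<bullet> h = f' (x, y) (h, 0)" for x y h
    unfolding partial1_def by (rule gradient_inner[OF d1])
  have p2: "partial2 S x y \<bullet> h = f' (x, y) (0, h)" for x y h
    unfolding partial2_def by (rule gradient_inner[OF d2])
  \<comment> \<open>\<open>D1 z v\<close> is the vector that represents the functional sending
    \<open>h\<close> to \<open>f'' z v (h, 0)\<close>; differentiability of the gradients can then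
    be checked componentwise.\<close>
  define D1 where "D1 z v = (\<chi> i. f'' z v (axis i 1, 0))" for z v
  define D2 where "D2 z v = (\<chi> i. f'' z v (0, axis i 1))" for z v
  have lin: "linear (\<lambda>h. f'' z v (h, 0))" "linear (\<lambda>h. f'' z v (0, h))" for z v
  proof -
    show "linear (\<lambda>h. f'' z v (h, 0))"
    proof (rule linearI)
      fix a b :: "real^'n" and k :: real
      show "f'' z v (a + b, 0) = f'' z v (a, 0) + f'' z v (b, 0)"
        using blinfun.add_right[of "f'' z v" "(a, 0)" "(b, 0)"] by simp
      show "f'' z v (k *\<^sub>R a, 0) = k *\<^sub>R f'' z v (a, 0)"
        using blinfun.scaleR_right[of "f'' z v" k "(a, 0)"] by simp
    qed
    show "linear (\<lambda>h. f'' z v (0, h))"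
    proof (rule linearI)
      fix a b :: "real^'n" and k :: real
      show "f'' z v (0, a + b) = f'' z v (0, a) + f'' z v (0, b)"
        using blinfun.add_right[of "f'' z v" "(0, a)" "(0, b)"] by simp
      show "f'' z v (0, k *\<^sub>R a) = k *\<^sub>R f'' z v (0, a)"
        using blinfun.scaleR_right[of "f'' z v" k "(0, a)"] by simp
    qed
  qed
  have D1i: "D1 z v \<bullet> h = f'' z v (h, 0)" for z v h
    unfolding D1_def by (rule linear_gradient_inner[OF lin(1)])
  have D2i: "D2 z v \<bullet> h = f'' z v (0, h)" for z v h
    unfolding D2_def by (rule linear_gradient_inner[OF lin(2)])
  have f'd: "((\<lambda>z. f' z e) has_derivative (\<lambda>v. f'' z v e)) (at z)" for z e
    by (rule bounded_linear.has_derivative[OF blinfun.bounded_linear_left f''])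
  have D1d: "((\<lambda>z. partial1 S (fst z) (snd z)) has_derivative D1 z) (at z)" for z
  proof (rule has_derivative_componentwise_within[THEN iffD2], rule ballI)
    fix i :: "real^'n"
    show "((\<lambda>z. partial1 S (fst z) (snd z) \<bullet> i) has_derivative (\<lambda>v. D1 z v \<bullet> i)) (at z)"
      using f'd[of "(i, 0)" z] unfolding p1 D1i prod.collapse .
  qed
  have D2d: "((\<lambda>z. partial2 S (fst z) (snd z)) has_derivative D2 z) (at z)" for z
  proof (rule has_derivative_componentwise_within[THEN iffD2], rule ballI)
    fix i :: "real^'n"
    show "((\<lambda>z. partial2 S (fst z) (snd z) \<bullet> i) has_derivative (\<lambda>v. D2 z v \<bullet> i)) (at z)"
      using f'd[of "(0, i)" z] unfolding p2 D2i prod.collapse .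
  qed
  have cont2: "continuous_on UNIV (\<lambda>w. f'' (fst w) (snd w) e)" for e
  proof -
    have "continuous_on UNIV (\<lambda>w :: ((real^'n) \<times> (real^'n)) \<times> ((real^'n) \<times> (real^'n)). f'' (fst w))"
      by (rule continuous_on_compose2[OF cont]) (auto intro!: continuous_intros)
    then show ?thesis by (auto intro!: continuous_intros)
  qed
  have "twist_system S (partial1 S) (partial2 S) D1 D2 A Fb"
  proof
    show "((\<lambda>z. S (fst z) (snd z)) has_derivative
        (\<lambda>v. partial1 S (fst z) (snd z) \<bullet> fst v + partial2 S (fst z) (snd z) \<bullet> snd v)) (at z)" for z
    proof -
      have "partial1 S (fst z) (snd z) \<bullet> fst v + partial2 S (fst z) (snd z) \<bullet> snd v = f' z v" for v
        by (simp add: p1 p2 blinfun.add_right[symmetric])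
      then show ?thesis using f'[of z] by (simp add: case_prod_unfold)
    qed
    show "continuous_on UNIV (\<lambda>w. D1 (fst w) (snd w))" "continuous_on UNIV (\<lambda>w. D2 (fst w) (snd w))"
      unfolding D1_def D2_def by (auto intro!: continuous_on_vec_lambda cont2)
    show "D2 z (h, 0) \<bullet> h \<le> - A * (norm h)\<^sup>2" for z h
    proof -
      obtain x y where z: "z = (x, y)" by force
      have "((\<lambda>x. partial2 S x y $ j) has_derivative (\<lambda>h. D2 (x, y) (h, 0) $ j)) (at x)" for j
      proof -
        have "((\<lambda>x. partial2 S x y) has_derivative (\<lambda>h. D2 (x, y) (h, 0))) (at x)"
          using has_derivative_slice_fst[OF D2d[of "(x, y)"]] by simp
        then show ?thesis
          by (auto intro: bounded_linear.has_derivative[OF bounded_linear_vec_nth])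
      qed
      note gi = gradient_inner[OF this]
      have "mixed_partial S x y i j = D2 (x, y) (axis i 1, 0) $ j" for i j
        unfolding mixed_partial_def using gi[of j "axis i 1"] by (simp add: inner_axis)
      then have "(\<Sum>i\<in>UNIV. \<Sum>j\<in>UNIV. mixed_partial S x y i j * h $ i * h $ j)
          = (\<Sum>i\<in>UNIV. h $ i * (D2 (x, y) (axis i 1, 0) \<bullet> h))"
        by (simp add: inner_vec_def sum_distrib_left mult_ac)
      also have "\<dots> = (\<chi> i. D2 (x, y) (axis i 1, 0) \<bullet> h) \<bullet> h"
        by (simp add: inner_vec_def mult_ac)
      also have "\<dots> = D2 (x, y) (h, 0) \<bullet> h"
      proof (rule linear_gradient_inner)
        have "linear (\<lambda>v. D2 (x, y) (v, 0))"
          by (rule has_derivative_linear[OF has_derivative_slice_fst[OF D2d]])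
        then show "linear (\<lambda>v. D2 (x, y) (v, 0) \<bullet> h)"
          using linear_compose[OF _ bounded_linear.linear[OF bounded_linear_inner_left], of _ h]
          by (fastforce simp: o_def)
      qed
      finally show ?thesis using A(2)[of x y h] z by simp
    qed
    show "S (x + r) (y + r) = S x y" if "r \<in> int_lattice" for x y r
      using assms(1) that unfolding generating_function_def by blast
    show "Fb (x, p) = (x', p') \<longleftrightarrow> p = - partial1 S x x' \<and> p' = partial2 S x x'" for x p x' p'
      using assms(2) unfolding generates_def by blast
  qed (use A D1d D2d in auto)
  then show ?thesis by blast
qed

context twist_system
begin

section \<open>Partial derivatives, their symmetry and periodicity\<close>

lemma S_deriv_fst: "((\<lambda>x. S x y) has_derivative (\<lambda>h. S1 x y \<bullet> h)) (at x)"
  using has_derivative_slice_fst[OF S_deriv[of "(x, y)"]] by simp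

lemma S_deriv_snd: "((\<lambda>y. S x y) has_derivative (\<lambda>h. S2 x y \<bullet> h)) (at y)"
  using has_derivative_slice_snd[OF S_deriv[of "(x, y)"]] by simp

lemma S1_deriv_fst: "((\<lambda>x. S1 x y) has_derivative (\<lambda>h. D1 (x, y) (h, 0))) (at x)"
  using has_derivative_slice_fst[OF S1_deriv[of "(x, y)"]] by simp

lemma S1_deriv_snd: "((\<lambda>y. S1 x y) has_derivative (\<lambda>h. D1 (x, y) (0, h))) (at y)"
  using has_derivative_slice_snd[OF S1_deriv[of "(x, y)"]] by simp

lemma S2_deriv_fst: "((\<lambda>x. S2 x y) has_derivative (\<lambda>h. D2 (x, y) (h, 0))) (at x)"
  using has_derivative_slice_fst[OF S2_deriv[of "(x, y)"]] by simp

lemma S2_deriv_snd: "((\<lambda>y. S2 x y) has_derivative (\<lambda>h. D2 (x, y) (0, h))) (at y)"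
  using has_derivative_slice_snd[OF S2_deriv[of "(x, y)"]] by simp

lemma S_cont': "continuous_on UNIV (\<lambda>z. S (fst z) (snd z))"
  and S1_cont': "continuous_on UNIV (\<lambda>z. S1 (fst z) (snd z))"
  and S2_cont': "continuous_on UNIV (\<lambda>z. S2 (fst z) (snd z))"
  by (rule continuous_at_imp_continuous_on, rule ballI,
      rule has_derivative_continuous, rule S_deriv S1_deriv S2_deriv)+

lemma S_cont [continuous_intros]:
  "continuous_on T f \<Longrightarrow> continuous_on T g \<Longrightarrow> continuous_on T (\<lambda>x. S (f x) (g x))"
  using continuous_on_compose2[OF S_cont' continuous_on_Pair, of T f g] by simp

lemma S1_cont [continuous_intros]:
  "continuous_on T f \<Longrightarrow> continuous_on T g \<Longrightarrow> continuous_on T (\<lambda>x. S1 (f x) (g x))"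
  using continuous_on_compose2[OF S1_cont' continuous_on_Pair, of T f g] by simp

lemma S2_cont [continuous_intros]:
  "continuous_on T f \<Longrightarrow> continuous_on T g \<Longrightarrow> continuous_on T (\<lambda>x. S2 (f x) (g x))"
  using continuous_on_compose2[OF S2_cont' continuous_on_Pair, of T f g] by simp

lemma D1_cont_comp [continuous_intros]:
  "continuous_on T f \<Longrightarrow> continuous_on T g \<Longrightarrow> continuous_on T (\<lambda>x. D1 (f x) (g x))"
  using continuous_on_compose2[OF D1_cont continuous_on_Pair, of T f g] by simp

lemma D2_cont_comp [continuous_intros]:
  "continuous_on T f \<Longrightarrow> continuous_on T g \<Longrightarrow> continuous_on T (\<lambda>x. D2 (f x) (g x))"
  using continuous_on_compose2[OF D2_cont continuous_on_Pair, of T f g] by simp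

lemma S_tendsto [tendsto_intros]:
  "(f \<longlongrightarrow> x) G \<Longrightarrow> (g \<longlongrightarrow> y) G \<Longrightarrow> ((\<lambda>t. S (f t) (g t)) \<longlongrightarrow> S x y) G"
  using continuous_on_tendsto_compose[OF S_cont' tendsto_Pair, of f x G g y] by simp

lemma S1_tendsto [tendsto_intros]:
  "(f \<longlongrightarrow> x) G \<Longrightarrow> (g \<longlongrightarrow> y) G \<Longrightarrow> ((\<lambda>t. S1 (f t) (g t)) \<longlongrightarrow> S1 x y) G"
  using continuous_on_tendsto_compose[OF S1_cont' tendsto_Pair, of f x G g y] by simp

lemma D1_lin: "linear (D1 z)" and D2_lin: "linear (D2 z)"
  using S1_deriv S2_deriv has_derivative_linear by blast+

lemma second_derivative_symmetric:
  "D1 z v \<bullet> fst w + D2 z v \<bullet> snd w = D1 z w \<bullet> fst v + D2 z w \<bullet> snd v"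
proof -
  have "((\<lambda>z. (S1 (fst z) (snd z), S2 (fst z) (snd z))) has_derivative (\<lambda>v. (D1 z v, D2 z v))) (at z)"
    by (intro has_derivative_Pair S1_deriv S2_deriv)
  from symmetric_second_derivative[OF _ this, of "\<lambda>z. S (fst z) (snd z)" v w]
  show ?thesis using S_deriv by (simp add: inner_prod_def)
qed

lemma D1_fst_sym: "D1 z (h, 0) \<bullet> h' = D1 z (h', 0) \<bullet> h"
  using second_derivative_symmetric[of z "(h, 0)" "(h', 0)"] by simp

lemma D2_snd_sym: "D2 z (0, k) \<bullet> k' = D2 z (0, k') \<bullet> k"
  using second_derivative_symmetric[of z "(0, k)" "(0, k')"] by simp

lemma D1_snd_D2_fst: "D1 z (0, k) \<bullet> h = D2 z (h, 0) \<bullet> k"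
  using second_derivative_symmetric[of z "(0, k)" "(h, 0)"] by simp

lemma twist1: "D1 z (0, k) \<bullet> k \<le> - A * (norm k)\<^sup>2"
  using twist[of z k] D1_snd_D2_fst[of z k k] by simp

text \<open>The twist condition integrated along a segment. Symmetry of the Hessian rewrites the
  derivative in \<open>x\<close> of \<open>S2 x y \<bullet> v\<close> as an inner product with
  \<open>D1 (x, y) (0, v)\<close>, the gradient form that the mean value theorem expects.\<close>

lemma S2_monotone: "(S2 (x + v) y - S2 x y) \<bullet> v \<le> - A * (norm v)\<^sup>2"
proof -
  have "((\<lambda>x. S2 x y \<bullet> v) has_derivative (\<lambda>h. D2 (x, y) (h, 0) \<bullet> v)) (at x)" for x
    by (intro has_derivative_inner_left S2_deriv_fst)
  moreover have "D2 (x, y) (h, 0) \<bullet> v = D1 (x, y) (0, v) \<bullet> h" for x h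
    using D1_snd_D2_fst by simp
  ultimately have "((\<lambda>x. S2 x y \<bullet> v) has_derivative (\<lambda>h. D1 (x, y) (0, v) \<bullet> h)) (at x)" for x by simp
  from gradient_mvt[OF this, of x v] obtain t
    where "S2 (x + v) y \<bullet> v - S2 x y \<bullet> v = D1 (x + t *\<^sub>R v, y) (0, v) \<bullet> v" by blast
  then show ?thesis using twist1 by (metis inner_diff_left)
qed

lemma S1_monotone: "(S1 x (y + v) - S1 x y) \<bullet> v \<le> - A * (norm v)\<^sup>2"
proof -
  have "((\<lambda>y. S1 x y \<bullet> v) has_derivative (\<lambda>h. D1 (x, y) (0, h) \<bullet> v)) (at y)" for y
    by (intro has_derivative_inner_left S1_deriv_snd)
  moreover have "D1 (x, y) (0, h) \<bullet> v = D2 (x, y) (v, 0) \<bullet> h" for y h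
    using D1_snd_D2_fst by simp
  ultimately have "((\<lambda>y. S1 x y \<bullet> v) has_derivative (\<lambda>h. D2 (x, y) (v, 0) \<bullet> h)) (at y)" for y by simp
  from gradient_mvt[OF this, of y v] obtain t
    where "S1 x (y + v) \<bullet> v - S1 x y \<bullet> v = D2 (x, y + t *\<^sub>R v) (v, 0) \<bullet> v" by blast
  then show ?thesis using twist by (metis inner_diff_left)
qed

lemma S2_inj: "S2 x y = S2 x' y \<Longrightarrow> x = x'"
  using S2_monotone[of x "x' - x" y] A_pos by (simp add: mult_le_0_iff)

lemma S1_per: "r \<in> int_lattice \<Longrightarrow> S1 (x + r) (y + r) = S1 x y"
proof -
  assume r: "r \<in> int_lattice"
  have "((\<lambda>x. S (x + r) (y + r)) has_derivative (\<lambda>h. S1 (x + r) (y + r) \<bullet> h)) (at x)"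
    by (rule has_derivative_compose[OF _ S_deriv_fst]) (auto intro!: derivative_eq_intros)
  then have "(\<lambda>h. S1 (x + r) (y + r) \<bullet> h) = (\<lambda>h. S1 x y \<bullet> h)"
    using has_derivative_unique[OF _ S_deriv_fst] S_per[OF r] by simp
  then show ?thesis by (metis vector_eq_rdot)
qed

lemma S2_per: "r \<in> int_lattice \<Longrightarrow> S2 (x + r) (y + r) = S2 x y"
proof -
  assume r: "r \<in> int_lattice"
  have "((\<lambda>y. S (x + r) (y + r)) has_derivative (\<lambda>h. S2 (x + r) (y + r) \<bullet> h)) (at y)"
    by (rule has_derivative_compose[OF _ S_deriv_snd]) (auto intro!: derivative_eq_intros)
  then have "(\<lambda>h. S2 (x + r) (y + r) \<bullet> h) = (\<lambda>h. S2 x y \<bullet> h)"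
    using has_derivative_unique[OF _ S_deriv_snd] S_per[OF r] by simp
  then show ?thesis by (metis vector_eq_rdot)
qed

lemma D1_per: "r \<in> int_lattice \<Longrightarrow> D1 (x + r, y + r) v = D1 (x, y) v"
proof -
  assume r: "r \<in> int_lattice"
  have "((\<lambda>z. S1 (fst (z + (r, r))) (snd (z + (r, r)))) has_derivative D1 ((x, y) + (r, r))) (at (x, y))"
    by (rule has_derivative_compose[OF _ S1_deriv]) (auto intro!: derivative_eq_intros)
  then have "((\<lambda>z. S1 (fst z) (snd z)) has_derivative D1 (x + r, y + r)) (at (x, y))"
    using S1_per[OF r] by simp
  then show ?thesis using has_derivative_unique[OF _ S1_deriv] by metis
qed

lemma D2_per: "r \<in> int_lattice \<Longrightarrow> D2 (x + r, y + r) v = D2 (x, y) v"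
proof -
  assume r: "r \<in> int_lattice"
  have "((\<lambda>z. S2 (fst (z + (r, r))) (snd (z + (r, r)))) has_derivative D2 ((x, y) + (r, r))) (at (x, y))"
    by (rule has_derivative_compose[OF _ S2_deriv]) (auto intro!: derivative_eq_intros)
  then have "((\<lambda>z. S2 (fst z) (snd z)) has_derivative D2 (x + r, y + r)) (at (x, y))"
    using S2_per[OF r] by simp
  then show ?thesis using has_derivative_unique[OF _ S2_deriv] by metis
qed

lemma diagonal_bounded:
  fixes g :: "real^'n \<Rightarrow> real^'n \<Rightarrow> 'c::real_normed_vector"
  assumes "continuous_on UNIV (\<lambda>z. g (fst z) (snd z))"
    and "\<And>x y r. r \<in> int_lattice \<Longrightarrow> g (x + r) (y + r) = g x y"
  obtains K where "K > 0" "\<And>x y. norm (y - x) \<le> R \<Longrightarrow> norm (g x y) \<le> K"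
proof -
  have "continuous_on UNIV (\<lambda>w :: ((real^'n) \<times> (real^'n)) \<times> real. g (fst (fst w)) (snd (fst w)))"
  proof -
    have "continuous_on UNIV ((\<lambda>z. g (fst z) (snd z)) \<circ> (fst :: ((real^'n) \<times> (real^'n)) \<times> real \<Rightarrow> _))"
      by (rule continuous_on_compose) (auto intro: continuous_on_subset[OF assms(1)] continuous_on_fst continuous_on_id)
    then show ?thesis by (simp add: o_def)
  qed
  from diagonal_periodic_bounded[OF this, of "{0}" R] assms(2) obtain K
    where "K > 0" "\<And>x y v. norm (y - x) \<le> R \<Longrightarrow> v \<in> {0 :: real} \<Longrightarrow> norm (g x y) \<le> K"
    by auto
  then show thesis using that by blast
qed

text \<open>Periodicity bounds \<open>S\<close> and its derivatives only in bands around the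
  diagonal. One constant covers values, gradients and second-order errors in the band of width
  \<open>R\<close>; displacements have length at most 1, so that intermediate points stay in the
  band of width \<open>R + 1\<close>.\<close>

definition local_bound :: "real \<Rightarrow> real \<Rightarrow> bool" where
  "local_bound R K \<longleftrightarrow> K \<ge> 1 \<and>
     (\<forall>x y. norm (y - x) \<le> R \<longrightarrow> \<bar>S x y\<bar> \<le> K \<and> norm (S1 x y) \<le> K \<and> norm (S2 x y) \<le> K \<and>
     (\<forall>h. norm h \<le> 1 \<longrightarrow> \<bar>S (x + h) y - S x y - S1 x y \<bullet> h\<bar> \<le> K * (norm h)\<^sup>2 \<and>
       \<bar>S x (y + h) - S x y - S2 x y \<bullet> h\<bar> \<le> K * (norm h)\<^sup>2 \<and>
       \<bar>S x (y + h) - S x y\<bar> \<le> K * norm h))"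

lemma local_bound_exists: "\<exists>K. local_bound R K"
proof -
  obtain K1 where K1: "K1 > 0" "\<And>x y. norm (y - x) \<le> R \<Longrightarrow> norm (S x y) \<le> K1"
    using diagonal_bounded[OF S_cont' S_per] by blast
  obtain K2 where K2: "K2 > 0" "\<And>x y. norm (y - x) \<le> R \<Longrightarrow> norm (S1 x y) \<le> K2"
    using diagonal_bounded[OF S1_cont' S1_per] by blast
  obtain K3 where K3: "K3 > 0" "\<And>x y. norm (y - x) \<le> R \<Longrightarrow> norm (S2 x y) \<le> K3"
    using diagonal_bounded[OF S2_cont' S2_per] by blast
  obtain K4 where K4: "K4 > 0" "\<And>x y v. norm (y - x) \<le> R + 1 \<Longrightarrow> v \<in> cball 0 1 \<Longrightarrow> norm (D1 (x, y) v) \<le> K4"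
    using diagonal_periodic_bounded[of "\<lambda>w. D1 (fst w) (snd w)" "cball 0 1" "R + 1"] D1_per
      D1_cont by auto
  obtain K5 where K5: "K5 > 0" "\<And>x y v. norm (y - x) \<le> R + 1 \<Longrightarrow> v \<in> cball 0 1 \<Longrightarrow> norm (D2 (x, y) v) \<le> K5"
    using diagonal_periodic_bounded[of "\<lambda>w. D2 (fst w) (snd w)" "cball 0 1" "R + 1"] D2_per
      D2_cont by auto
  have D1n: "norm (D1 (x, y) v) \<le> K4 * norm v" if "norm (y - x) \<le> R + 1" for x y v
    using linear_unit_ball_bound[OF D1_lin K4(2)[OF that]] .
  have D2n: "norm (D2 (x, y) v) \<le> K5 * norm v" if "norm (y - x) \<le> R + 1" for x y v
    using linear_unit_ball_bound[OF D2_lin K5(2)[OF that]] .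
  have sh: "norm (s *\<^sub>R h) \<le> 1" if "norm h \<le> 1" "0 < s" "s < 1" for h :: "real^'n" and s
    using that mult_mono[of s 1 "norm h" 1] by simp
  have T1: "\<bar>S (x + h) y - S x y - S1 x y \<bullet> h\<bar> \<le> K4 * (norm h)\<^sup>2"
    if xy: "norm (y - x) \<le> R" and h: "norm h \<le> 1" for x y h
  proof (rule hessian_bound_taylor[OF S_deriv_fst S1_deriv_fst])
    fix s :: real assume s: "0 < s" "s < 1"
    have "norm (y - (x + s *\<^sub>R h)) \<le> R + 1"
      using norm_triangle_ineq4[of "y - x" "s *\<^sub>R h"] xy sh[OF h s] by (simp add: algebra_simps)
    then show "norm (D1 (x + s *\<^sub>R h, y) (h, 0)) \<le> K4 * norm h" using D1n[of y _ "(h, 0)"] by simp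
  qed
  have T2: "\<bar>S x (y + h) - S x y - S2 x y \<bullet> h\<bar> \<le> K5 * (norm h)\<^sup>2"
    if xy: "norm (y - x) \<le> R" and h: "norm h \<le> 1" for x y h
  proof (rule hessian_bound_taylor[OF S_deriv_snd S2_deriv_snd])
    fix s :: real assume s: "0 < s" "s < 1"
    have "norm ((y + s *\<^sub>R h) - x) \<le> R + 1"
      using norm_triangle_ineq[of "y - x" "s *\<^sub>R h"] xy sh[OF h s] by (simp add: algebra_simps)
    then show "norm (D2 (x, y + s *\<^sub>R h) (0, h)) \<le> K5 * norm h" using D2n[of _ x "(0, h)"] by simp
  qed
  define K where "K = 1 + K1 + K2 + K3 + K4 + K5"
  have Ks: "1 \<le> K" "K1 \<le> K" "K2 \<le> K" "K3 \<le> K" "K4 \<le> K" "K5 \<le> K" "K5 + K3 \<le> K"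
    using K1(1) K2(1) K3(1) K4(1) K5(1) by (auto simp: K_def)
  have "local_bound R K"
    unfolding local_bound_def
  proof (intro conjI allI impI)
    show "1 \<le> K" by (rule Ks)
    fix x y :: "real^'n" assume xy: "norm (y - x) \<le> R"
    show "\<bar>S x y\<bar> \<le> K" "norm (S1 x y) \<le> K" "norm (S2 x y) \<le> K"
      using K1(2)[OF xy] K2(2)[OF xy] K3(2)[OF xy] Ks by auto
    fix h :: "real^'n" assume h: "norm h \<le> 1"
    have sq: "(norm h)\<^sup>2 \<le> norm h" using h by (simp add: power2_eq_square mult_left_le)
    have le: "c * (norm h)\<^sup>2 \<le> K * (norm h)\<^sup>2" if "c \<le> K" for c
      using that by (auto intro: mult_right_mono)
    show "\<bar>S (x + h) y - S x y - S1 x y \<bullet> h\<bar> \<le> K * (norm h)\<^sup>2"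
      using T1[OF xy h] le[OF Ks(5)] by linarith
    show "\<bar>S x (y + h) - S x y - S2 x y \<bullet> h\<bar> \<le> K * (norm h)\<^sup>2"
      using T2[OF xy h] le[OF Ks(6)] by linarith
    have "\<bar>S2 x y \<bullet> h\<bar> \<le> K3 * norm h"
      using Cauchy_Schwarz_ineq2[of "S2 x y" h] K3(2)[OF xy] mult_right_mono[of "norm (S2 x y)" K3 "norm h"] by simp
    moreover have "K5 * (norm h)\<^sup>2 \<le> K5 * norm h" using sq K5(1) by (intro mult_left_mono) auto
    moreover have "K5 * norm h + K3 * norm h \<le> K * norm h"
      using mult_right_mono[OF Ks(7), of "norm h"] by (simp add: distrib_right)
    ultimately show "\<bar>S x (y + h) - S x y\<bar> \<le> K * norm h" using T2[OF xy h] by linarith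
  qed
  then show ?thesis ..
qed

definition bnd :: "real \<Rightarrow> real" where
  "bnd R = (SOME K. local_bound R K)"

lemma bnd_local_bound: "local_bound R (bnd R)"
  unfolding bnd_def by (rule someI_ex[OF local_bound_exists])

lemma bnd_ge1: "bnd R \<ge> 1"
  using bnd_local_bound unfolding local_bound_def by (rule conjunct1)

lemma
  assumes "norm (y - x) \<le> R"
  shows bnd_S: "\<bar>S x y\<bar> \<le> bnd R"
    and bnd_S1: "norm (S1 x y) \<le> bnd R"
    and bnd_S2: "norm (S2 x y) \<le> bnd R"
    and taylor1: "norm h \<le> 1 \<Longrightarrow> \<bar>S (x + h) y - S x y - S1 x y \<bullet> h\<bar> \<le> bnd R * (norm h)\<^sup>2"
    and taylor2: "norm h \<le> 1 \<Longrightarrow> \<bar>S x (y + h) - S x y - S2 x y \<bullet> h\<bar> \<le> bnd R * (norm h)\<^sup>2"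
    and S_lipschitz2: "norm h \<le> 1 \<Longrightarrow> \<bar>S x (y + h) - S x y\<bar> \<le> bnd R * norm h"
  using conjunct2[OF bnd_local_bound[of R, unfolded local_bound_def], rule_format, OF assms] by simp_all

lemma norm_le_of_quadratic:
  assumes "A * (norm v)\<^sup>2 \<le> k * norm v" "0 \<le> k"
  shows "norm v \<le> k / A"
proof (cases "v = 0")
  case False
  have "norm v * (A * norm v) \<le> norm v * k" using assms(1) by (simp add: power2_eq_square mult_ac)
  then have "A * norm v \<le> k" using False by (auto intro: mult_left_le_imp_le[of "norm v"])
  then show ?thesis using A_pos by (simp add: field_simps)
qed (use assms(2) A_pos in simp)

text \<open>On the ray from \<open>x\<close> to \<open>y\<close>, \<open>S2_monotone\<close>
  compares the directional derivative of \<open>S x\<close> at parameter \<open>t\<close> with its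
  value at a diagonal point and gains \<open>A * t * (norm v)\<^sup>2\<close>. The function
  \<open>k\<close> subtracts the integrated gain, so its derivative is nonnegative; the diagonal
  terms are bounded by \<open>bnd 0\<close>.\<close>

lemma S_quadratic_lower_bound:
  "S x y \<ge> A / 2 * (norm (y - x))\<^sup>2 - bnd 0 * norm (y - x) - bnd 0"
proof -
  define v where "v = y - x"
  define k where "k t = S x (x + t *\<^sub>R v) - A / 2 * t\<^sup>2 * (norm v)\<^sup>2 + bnd 0 * norm v * t" for t :: real
  have der: "DERIV k t :> S2 x (x + t *\<^sub>R v) \<bullet> v - A * t * (norm v)\<^sup>2 + bnd 0 * norm v" for t
  proof -
    have "((\<lambda>t. S x (x + t *\<^sub>R v)) has_derivative (\<lambda>s. S2 x (x + t *\<^sub>R v) \<bullet> (s *\<^sub>R v))) (at t)"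
      by (rule has_derivative_compose[OF _ S_deriv_snd]) (auto intro!: derivative_eq_intros)
    then have "DERIV (\<lambda>t. S x (x + t *\<^sub>R v)) t :> S2 x (x + t *\<^sub>R v) \<bullet> v"
      by (simp add: has_field_derivative_def mult.commute[of _ "S2 x (x + t *\<^sub>R v) \<bullet> v"])
    then show ?thesis unfolding k_def by (auto intro!: derivative_eq_intros)
  qed
  obtain t :: real where t: "0 < t" "t < 1"
    "k 1 - k 0 = (1 - 0) * (S2 x (x + t *\<^sub>R v) \<bullet> v - A * t * (norm v)\<^sup>2 + bnd 0 * norm v)"
    using MVT2[of 0 1 k, OF _ der] by auto
  have "(S2 (x + t *\<^sub>R v) (x + t *\<^sub>R v) - S2 x (x + t *\<^sub>R v)) \<bullet> (t *\<^sub>R v) \<le> - A * (norm (t *\<^sub>R v))\<^sup>2"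
    by (rule S2_monotone)
  then have "t * ((S2 (x + t *\<^sub>R v) (x + t *\<^sub>R v) - S2 x (x + t *\<^sub>R v)) \<bullet> v) \<le> t * (- A * t * (norm v)\<^sup>2)"
    using t by (simp add: power2_eq_square mult_ac)
  then have "(S2 (x + t *\<^sub>R v) (x + t *\<^sub>R v) - S2 x (x + t *\<^sub>R v)) \<bullet> v \<le> - A * t * (norm v)\<^sup>2"
    using t(1) by (rule mult_left_le_imp_le)
  moreover have "- (bnd 0 * norm v) \<le> S2 (x + t *\<^sub>R v) (x + t *\<^sub>R v) \<bullet> v"
    using Cauchy_Schwarz_ineq2[of "S2 (x + t *\<^sub>R v) (x + t *\<^sub>R v)" v]
      mult_right_mono[OF bnd_S2[of "x + t *\<^sub>R v" "x + t *\<^sub>R v" 0], of "norm v"] by simp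
  ultimately have "k 1 \<ge> k 0" using t by (simp add: inner_diff_left)
  moreover have "k 0 \<ge> - bnd 0" using bnd_S[of x x 0] by (simp add: k_def)
  ultimately have "S x (x + v) \<ge> A / 2 * (norm v)\<^sup>2 - bnd 0 * norm v - bnd 0" by (simp add: k_def)
  then show ?thesis by (simp add: v_def)
qed

text \<open>Beyond this length the quadratic term of \<open>S_quadratic_lower_bound\<close> beats
  \<alpha> plus \<beta> times the length together with the lower-order terms. The summand 1 allows
  constants to be absorbed into multiples of the length.\<close>

definition step_bound :: "real \<Rightarrow> real \<Rightarrow> real" where
  "step_bound \<alpha> \<beta> = 1 + 2 / A * (\<bar>\<alpha>\<bar> + \<bar>\<beta>\<bar> + 2 * bnd 0)"

lemma step_bound:
  assumes "S x y \<le> \<alpha> + \<beta> * norm (y - x)"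
  shows "norm (y - x) \<le> step_bound \<alpha> \<beta>"
proof (rule ccontr)
  define w where "w = norm (y - x)"
  define q where "q = \<bar>\<alpha>\<bar> + \<bar>\<beta>\<bar> + 2 * bnd 0"
  assume "\<not> ?thesis"
  then have w: "w > 1 + 2 / A * q" by (simp add: step_bound_def w_def q_def)
  have q: "q \<ge> 0" using bnd_ge1[of 0] by (simp add: q_def)
  then have "2 / A * q \<ge> 0" using A_pos by simp
  then have w1: "w \<ge> 1" using w by simp
  have "A / 2 * w > q" using w A_pos by (simp add: field_simps)
  then have "A / 2 * w * w > q * w" using w1 by (intro mult_strict_right_mono) auto
  moreover have "A / 2 * w\<^sup>2 \<le> \<alpha> + \<beta> * w + bnd 0 * w + bnd 0"
    using S_quadratic_lower_bound[of y x] assms by (simp add: w_def)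
  moreover have "\<alpha> + \<beta> * w + bnd 0 * w + bnd 0 \<le> q * w"
  proof -
    have "\<alpha> \<le> \<bar>\<alpha>\<bar> * w" using w1 mult_left_mono[of 1 w "\<bar>\<alpha>\<bar>"] by simp
    moreover have "\<beta> * w \<le> \<bar>\<beta>\<bar> * w" using w1 by (intro mult_right_mono) auto
    moreover have "bnd 0 \<le> bnd 0 * w" using w1 mult_left_mono[of 1 w "bnd 0"] bnd_ge1[of 0] by simp
    ultimately show ?thesis by (simp add: q_def algebra_simps)
  qed
  ultimately show False by (simp add: power2_eq_square mult.assoc)
qed

lemma S_lower_bound: obtains m where "\<And>x y. S x y \<ge> m"
proof
  fix x y :: "real^'n"
  define w where "w = norm (y - x)"
  have "0 \<le> A / 2 * (w - bnd 0 / A)\<^sup>2" using A_pos by simp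
  also have "\<dots> = A / 2 * w\<^sup>2 - bnd 0 * w + (bnd 0)\<^sup>2 / (2 * A)"
    using A_pos by (simp add: power2_diff field_simps power2_eq_square)
  finally show "S x y \<ge> - (bnd 0)\<^sup>2 / (2 * A) - bnd 0"
    using S_quadratic_lower_bound[of y x] by (simp add: w_def)
qed

section \<open>The lifted twist map is a bijection\<close>

lemma Fb_eqI: "Fb (x, - S1 x y) = (y, S2 x y)"
  using gen by blast

lemma Fb_eqs: "snd z = - S1 (fst z) (fst (Fb z))" "snd (Fb z) = S2 (fst z) (fst (Fb z))"
  using gen[of "fst z" "snd z" "fst (Fb z)" "snd (Fb z)"] by auto

lemma Fb_per: "r \<in> int_lattice \<Longrightarrow> Fb (z + (r, 0)) = Fb z + (r, 0)"
proof -
  assume r: "r \<in> int_lattice"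
  obtain x p where z: "z = (x, p)" by force
  obtain x' p' where z': "Fb z = (x', p')" by force
  have "Fb (x + r, p) = (x' + r, p')"
    using z' z gen[of x p x' p'] gen[of "x + r" p "x' + r" p'] S1_per[OF r] S2_per[OF r] by simp
  then show ?thesis using z z' by simp
qed

lemma S2_bij: "bij (\<lambda>x. S2 x y)"
proof (rule inj_coercive_bij)
  show "continuous_on UNIV (\<lambda>x. S2 x y)" by (intro continuous_intros)
  show "inj (\<lambda>x. S2 x y)" using S2_inj by (auto simp: inj_def)
  fix c
  show "bounded {x. norm (S2 x y) \<le> c}"
    unfolding bounded_iff
  proof (intro exI ballI)
    fix x assume x: "x \<in> {x. norm (S2 x y) \<le> c}"
    define v where "v = x - y"
    have "A * (norm v)\<^sup>2 \<le> (S2 y y - S2 (y + v) y) \<bullet> v"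
      using S2_monotone[of y v y] by (simp add: inner_diff_left)
    also have "\<dots> \<le> norm (S2 y y - S2 x y) * norm v" using norm_cauchy_schwarz by (simp add: v_def)
    also have "\<dots> \<le> (norm (S2 y y) + c) * norm v"
      using x norm_triangle_ineq4[of "S2 y y" "S2 x y"] by (intro mult_right_mono) auto
    finally have "norm v \<le> (norm (S2 y y) + c) / A"
      using x order.trans[OF norm_ge_zero, of "S2 x y" c] by (intro norm_le_of_quadratic) auto
    then show "norm x \<le> norm y + (norm (S2 y y) + c) / A"
      using norm_triangle_ineq[of y v] by (simp add: v_def)
  qed
qed

lemma Fb_bij: "bij Fb"
proof (rule bijI)
  show "inj Fb"
  proof (rule injI)
    fix z w assume eq: "Fb z = Fb w"
    have "S2 (fst z) (fst (Fb z)) = S2 (fst w) (fst (Fb z))" using Fb_eqs(2) eq by metis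
    then have "fst z = fst w" by (rule S2_inj)
    moreover have "snd z = snd w" using Fb_eqs(1) eq \<open>fst z = fst w\<close> by metis
    ultimately show "z = w" by (simp add: prod_eq_iff)
  qed
  show "surj Fb"
  proof (unfold surj_def, intro allI)
    fix w :: "(real^'n) \<times> (real^'n)"
    obtain x where "S2 x (fst w) = snd w" by (metis S2_bij bij_is_surj surjD)
    then show "\<exists>z. w = Fb z" using Fb_eqI[of x "fst w"] by (metis prod.collapse)
  qed
qed

section \<open>Orbits of the lift, their action and their differentials\<close>

definition px :: "nat \<Rightarrow> (real^'n) \<times> (real^'n) \<Rightarrow> real^'n" where
  "px n z = fst ((Fb ^^ n) z)"

definition pp :: "nat \<Rightarrow> (real^'n) \<times> (real^'n) \<Rightarrow> real^'n" where
  "pp n z = snd ((Fb ^^ n) z)"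

definition act :: "nat \<Rightarrow> (real^'n) \<times> (real^'n) \<Rightarrow> real" where
  "act n z = (\<Sum>i<n. S (px i z) (px (Suc i) z))"

lemma px_pp: "(Fb ^^ n) z = (px n z, pp n z)" by (simp add: px_def pp_def)

lemma px_0 [simp]: "px 0 z = fst z" and pp_0 [simp]: "pp 0 z = snd z" and act_0 [simp]: "act 0 z = 0"
  by (auto simp: px_def pp_def act_def)

lemma act_Suc: "act (Suc n) z = act n z + S (px n z) (px (Suc n) z)"
  by (simp add: act_def)

lemma px_Suc_eqs: "pp n z = - S1 (px n z) (px (Suc n) z)" "pp (Suc n) z = S2 (px n z) (px (Suc n) z)"
  using Fb_eqs[of "(Fb ^^ n) z"] by (auto simp: px_def pp_def)

lemma px_Suc: "px (Suc n) z = fst (Fb (px n z, pp n z))"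
  by (simp add: px_def pp_def)

lemma px_add: "px (m + n) z = px n ((Fb ^^ m) z)"
  by (simp add: px_def funpow_add add.commute[of m n])

lemma act_add: "act (m + n) z = act m z + act n ((Fb ^^ m) z)"
  by (induction n) (auto simp: act_Suc px_add[symmetric])

lemma Fbn_per: "r \<in> int_lattice \<Longrightarrow> (Fb ^^ n) (z + (r, 0)) = (Fb ^^ n) z + (r, 0)"
  by (induction n) (auto simp: Fb_per)

lemma px_per: "r \<in> int_lattice \<Longrightarrow> px n (x + r, p) = px n (x, p) + r"
  using Fbn_per[of r n "(x, p)"] by (simp add: px_def)

lemma act_per: "r \<in> int_lattice \<Longrightarrow> act n (x + r, p) = act n (x, p)"
  by (simp add: act_def px_per S_per)

text \<open>Implicit differentiation of the generating equations: if \<open>(h, q)\<close> is the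
  variation of the phase point, the variation \<open>k\<close> of the next position solves
  \<open>D1 w (h, k) = - q\<close>. The twist makes the block \<open>D1 w (0, k)\<close> invertible
  in \<open>k\<close>.\<close>

definition DF :: "(real^'n) \<times> (real^'n) \<Rightarrow> (real^'n) \<times> (real^'n) \<Rightarrow> (real^'n) \<times> (real^'n)" where
  "DF z v = (let w = (fst z, fst (Fb z)); k = inv (\<lambda>k. D1 w (0, k)) (- snd v - D1 w (fst v, 0))
     in (k, D2 w (fst v, k)))"

lemma D1_snd_bij: "bij (\<lambda>k. D1 w (0, k))"
proof -
  have lin: "linear (\<lambda>k. D1 w (0, k))"
    using has_derivative_linear[OF has_derivative_slice_snd[OF S1_deriv[of "(fst w, snd w)"]]] by simp
  have "k = 0" if "D1 w (0, k) = 0" for k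
    using twist1[of w k] that A_pos by (simp add: mult_le_0_iff)
  then have "inj (\<lambda>k. D1 w (0, k))" using linear_injective_0[OF lin] by blast
  then show ?thesis using linear_injective_imp_surjective[OF lin] by (simp add: bij_def)
qed

lemma D1_split: "D1 w (h, k) = D1 w (h, 0) + D1 w (0, k)"
  using linear_add[OF D1_lin, of w "(h, 0)" "(0, k)"] by simp

lemma D2_split: "D2 w (h, k) = D2 w (h, 0) + D2 w (0, k)"
  using linear_add[OF D2_lin, of w "(h, 0)" "(0, k)"] by simp

lemma DF_eqs:
  "D1 (fst z, fst (Fb z)) (fst v, fst (DF z v)) = - snd v"
  "snd (DF z v) = D2 (fst z, fst (Fb z)) (fst v, fst (DF z v))"
proof -
  show "snd (DF z v) = D2 (fst z, fst (Fb z)) (fst v, fst (DF z v))" by (simp add: DF_def Let_def)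
  define w where "w = (fst z, fst (Fb z))"
  have "D1 w (0, fst (DF z v)) = - snd v - D1 w (fst v, 0)"
    unfolding DF_def Let_def w_def[symmetric] using surj_f_inv_f[OF bij_is_surj[OF D1_snd_bij]] by simp
  then show "D1 (fst z, fst (Fb z)) (fst v, fst (DF z v)) = - snd v"
    using D1_split[of w "fst v" "fst (DF z v)"] by (simp add: w_def)
qed

text \<open>The map \<open>\<Theta>\<close> from two consecutive positions to the phase point is
  easy to differentiate and has the inverse \<open>g\<close>. The inverse function theorem for a map
  with a given inverse differentiates \<open>g\<close>, and \<open>Fb\<close> is \<open>g\<close>
  followed by \<open>S2\<close>.\<close>

lemma Fb_has_derivative: "(Fb has_derivative DF z) (at z)"
proof -
  define \<Theta> where "\<Theta> w = (fst w, - S1 (fst w) (snd w))" for w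
  define g where "g w = (fst w, fst (Fb w))" for w
  have "(g has_derivative (\<lambda>v. (fst v, fst (DF z v)))) (at (\<Theta> (g z)))"
  proof (rule has_derivative_inverse_strong[where S = UNIV and f = \<Theta> and f' = "\<lambda>v. (fst v, - D1 (g z) v)"])
    show "open (UNIV :: ((real^'n) \<times> (real^'n)) set)" "g z \<in> UNIV" by auto
    show "continuous_on UNIV \<Theta>" unfolding \<Theta>_def by (intro continuous_intros)
    show "g (\<Theta> w) = w" for w by (simp add: g_def \<Theta>_def Fb_eqI)
    show "(\<Theta> has_derivative (\<lambda>v. (fst v, - D1 (g z) v))) (at (g z))"
      unfolding \<Theta>_def[abs_def] by (auto intro!: derivative_eq_intros S1_deriv)
    show "(\<lambda>v. (fst v, - D1 (g z) v)) \<circ> (\<lambda>v. (fst v, fst (DF z v))) = id"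
      using DF_eqs(1)[of z] by (auto simp: fun_eq_iff g_def)
  qed
  moreover have "\<Theta> (g z) = z" using Fb_eqs(1)[of z] by (simp add: \<Theta>_def g_def prod_eq_iff)
  ultimately have g: "(g has_derivative (\<lambda>v. (fst v, fst (DF z v)))) (at z)" by simp
  have "((\<lambda>w. (snd (g w), S2 (fst (g w)) (snd (g w)))) has_derivative
      (\<lambda>v. (fst (DF z v), D2 (g z) (fst v, fst (DF z v))))) (at z)"
    using has_derivative_snd[OF g] has_derivative_compose[OF g S2_deriv[of "g z"]]
    by (auto intro!: has_derivative_Pair)
  moreover have "(\<lambda>w. (snd (g w), S2 (fst (g w)) (snd (g w)))) = Fb"
    using Fb_eqs(2) by (auto simp: fun_eq_iff g_def prod_eq_iff)
  moreover have "(\<lambda>v. (fst (DF z v), D2 (g z) (fst v, fst (DF z v)))) = DF z"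
    using DF_eqs(2) by (auto simp: fun_eq_iff g_def prod_eq_iff)
  ultimately show ?thesis by simp
qed

lemma Fb_cont: "continuous_on UNIV Fb"
  by (rule continuous_at_imp_continuous_on, rule ballI, rule has_derivative_continuous, rule Fb_has_derivative)

lemma DF_inj: "DF z v = 0 \<Longrightarrow> v = 0"
proof -
  assume 0: "DF z v = 0"
  have "D2 (fst z, fst (Fb z)) (fst v, 0) = 0" using DF_eqs(2)[of z v] 0 by simp
  then have "fst v = 0" using twist[of "(fst z, fst (Fb z))" "fst v"] A_pos by (simp add: mult_le_0_iff)
  moreover have "snd v = 0" using DF_eqs(1)[of z v] 0 \<open>fst v = 0\<close> linear_0[OF D1_lin] by (simp add: zero_prod_def)
  ultimately show ?thesis by (simp add: prod_eq_iff)
qed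

text \<open>\<open>k\<close> comes from inverting a linear map that varies with the point. If
  \<open>k w0\<close> is inserted into the equation at \<open>w\<close>, the residual
  \<open>e w\<close> is continuous and vanishes at \<open>w0\<close>, and the twist bounds the
  distance of \<open>k w\<close> and \<open>k w0\<close> by \<open>e w / A\<close>.\<close>

lemma DF_cont: "continuous_on UNIV (\<lambda>w. DF (fst w) (snd w))"
proof -
  define k where "k w = fst (DF (fst w) (snd w))" for w
  define g where "g w = (fst (fst w), fst (Fb (fst w)))" for w :: "((real^'n) \<times> (real^'n)) \<times> ((real^'n) \<times> (real^'n))"
  have contg: "continuous_on UNIV g"
    unfolding g_def by (auto intro!: continuous_intros continuous_on_compose2[OF Fb_cont])
  have "isCont k w0" for w0
  proof -
    define e where "e w = norm (- snd (snd w) - D1 (g w) (fst (snd w), k w0))" for w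
    have "continuous_on UNIV e" unfolding e_def by (intro continuous_intros contg)
    then have "(e \<longlongrightarrow> e w0) (at w0)" unfolding continuous_on_def by blast
    moreover have "e w0 = 0" using DF_eqs(1)[of "fst w0" "snd w0"] by (simp add: e_def g_def k_def)
    ultimately have lim: "((\<lambda>w. e w / A) \<longlongrightarrow> 0) (at w0)" by (auto intro: tendsto_divide_zero)
    have "norm (k w - k w0) \<le> e w / A" for w
    proof -
      define d where "d = k w - k w0"
      have "D1 (g w) (0, d) = D1 (g w) ((fst (snd w), k w) - (fst (snd w), k w0))" by (simp add: d_def)
      also have "\<dots> = - snd (snd w) - D1 (g w) (fst (snd w), k w0)"
        using DF_eqs(1)[of "fst w" "snd w"] by (simp only: linear_diff[OF D1_lin] g_def k_def)
      finally have *: "norm (D1 (g w) (0, d)) = e w" by (simp add: e_def)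
      have "A * (norm d)\<^sup>2 \<le> - (D1 (g w) (0, d) \<bullet> d)" using twist1[of "g w" d] by simp
      also have "\<dots> \<le> e w * norm d" using Cauchy_Schwarz_ineq2[of "D1 (g w) (0, d)" d] * by simp
      finally show ?thesis unfolding d_def by (rule norm_le_of_quadratic) (simp add: e_def)
    qed
    then have "\<forall>\<^sub>F w in at w0. norm (k w - k w0) \<le> e w / A" by (intro always_eventually allI)
    from Lim_null_comparison[OF this lim] have "((\<lambda>w. k w - k w0) \<longlongrightarrow> 0) (at w0)" .
    then show ?thesis by (simp add: isCont_def LIM_zero_iff)
  qed
  then have contk: "continuous_on UNIV k" by (simp add: continuous_at_imp_continuous_on)
  have "(\<lambda>w. DF (fst w) (snd w)) = (\<lambda>w. (k w, D2 (g w) (fst (snd w), k w)))"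
    using DF_eqs(2) by (auto simp: fun_eq_iff k_def g_def prod_eq_iff)
  then show ?thesis
    by (rule ssubst) (intro continuous_intros contk contg)
qed

text \<open>All entries of \<open>DF\<close> come from the symmetric Hessian of \<open>S\<close>: on
  expanding, the diagonal blocks cancel and the mixed blocks on both sides agree.\<close>

lemma symplectic:
  "fst (DF z v) \<bullet> snd (DF z w) - fst (DF z w) \<bullet> snd (DF z v) = fst v \<bullet> snd w - fst w \<bullet> snd v"
proof -
  define u where "u = (fst z, fst (Fb z))"
  define h h' k k' where "h = fst v" and "h' = fst w" and "k = fst (DF z v)" and "k' = fst (DF z w)"
  have v: "snd v = - (D1 u (h, 0) + D1 u (0, k))" "snd w = - (D1 u (h', 0) + D1 u (0, k'))"
    using DF_eqs(1)[of z v, folded u_def h_def k_def] DF_eqs(1)[of z w, folded u_def h'_def k'_def]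
      D1_split[of u] by (metis minus_minus)+
  have d: "snd (DF z v) = D2 u (h, 0) + D2 u (0, k)" "snd (DF z w) = D2 u (h', 0) + D2 u (0, k')"
    using DF_eqs(2)[of z v, folded u_def h_def k_def] DF_eqs(2)[of z w, folded u_def h'_def k'_def]
      D2_split[of u] by metis+
  have "h \<bullet> D1 u (h', 0) = h' \<bullet> D1 u (h, 0)" using D1_fst_sym[of u h' h] by (simp add: inner_commute)
  moreover have "k \<bullet> D2 u (0, k') = k' \<bullet> D2 u (0, k)" using D2_snd_sym[of u k' k] by (simp add: inner_commute)
  moreover have "k \<bullet> D2 u (h', 0) = h' \<bullet> D1 u (0, k)" using D1_snd_D2_fst[of u k h'] by (simp add: inner_commute)
  moreover have "k' \<bullet> D2 u (h, 0) = h \<bullet> D1 u (0, k')" using D1_snd_D2_fst[of u k' h] by (simp add: inner_commute)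
  ultimately show ?thesis
    unfolding v d h_def[symmetric] h'_def[symmetric] k_def[symmetric] k'_def[symmetric]
    by (simp add: inner_add_right inner_diff_right)
qed

primrec DFn :: "nat \<Rightarrow> (real^'n) \<times> (real^'n) \<Rightarrow> (real^'n) \<times> (real^'n) \<Rightarrow> (real^'n) \<times> (real^'n)" where
  "DFn 0 z v = v"
| "DFn (Suc n) z v = DF ((Fb ^^ n) z) (DFn n z v)"

lemma Fbn_has_derivative: "((Fb ^^ n) has_derivative DFn n z) (at z)"
proof (induction n)
  case (Suc n)
  show ?case
    using has_derivative_compose[OF Suc Fb_has_derivative] by (simp add: o_def)
qed (simp add: id_def)

lemma Fbn_cont: "continuous_on UNIV (Fb ^^ n)"
  by (rule continuous_at_imp_continuous_on, rule ballI, rule has_derivative_continuous, rule Fbn_has_derivative)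

lemma DFn_lin: "linear (DFn n z)"
  using Fbn_has_derivative by (rule has_derivative_linear)

lemma DFn_cont: "continuous_on UNIV (\<lambda>w. DFn n (fst w) (snd w))"
proof (induction n)
  case (Suc n)
  have "continuous_on UNIV (\<lambda>w. ((Fb ^^ n) (fst w), DFn n (fst w) (snd w)))"
    by (intro continuous_on_Pair Suc continuous_on_compose2[OF Fbn_cont continuous_on_fst[OF continuous_on_id]]) auto
  from continuous_on_compose2[OF DF_cont this] show ?case by simp
qed (simp add: continuous_on_snd)

lemma DFn_inj: "DFn n z v = 0 \<Longrightarrow> v = 0"
  by (induction n) (auto dest: DF_inj)

lemma DFn_symplectic:
  "fst (DFn n z v) \<bullet> snd (DFn n z w) - fst (DFn n z w) \<bullet> snd (DFn n z v) = fst v \<bullet> snd w - fst w \<bullet> snd v"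
  by (induction n) (auto simp: symplectic)

lemma px_has_derivative: "(px n has_derivative (\<lambda>v. fst (DFn n z v))) (at z)"
  and pp_has_derivative: "(pp n has_derivative (\<lambda>v. snd (DFn n z v))) (at z)"
  unfolding px_def[abs_def] pp_def[abs_def]
  by (intro has_derivative_fst has_derivative_snd Fbn_has_derivative)+

lemma px_cont: "continuous_on UNIV (px n)"
  unfolding px_def[abs_def] by (intro continuous_intros Fbn_cont)

lemma act_cont: "continuous_on UNIV (act n)"
  unfolding act_def[abs_def] by (intro continuous_intros px_cont)

text \<open>First variation: at each interior position the two adjacent steps contribute opposite
  momenta, so only the end points survive.\<close>

lemma act_has_derivative:
  "(act n has_derivative (\<lambda>v. pp n z \<bullet> fst (DFn n z v) - snd z \<bullet> fst v)) (at z)"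
proof (induction n)
  case 0
  have "act 0 = (\<lambda>z. 0)" by (simp add: fun_eq_iff)
  then show ?case by simp
next
  case (Suc n)
  have "((\<lambda>z. S (fst (px n z, px (Suc n) z)) (snd (px n z, px (Suc n) z))) has_derivative
      (\<lambda>v. S1 (px n z) (px (Suc n) z) \<bullet> fst (DFn n z v) + S2 (px n z) (px (Suc n) z) \<bullet> fst (DFn (Suc n) z v))) (at z)"
    using has_derivative_compose[OF has_derivative_Pair[OF px_has_derivative px_has_derivative] S_deriv[of "(px n z, px (Suc n) z)"]]
    by simp
  then have "((\<lambda>z. S (px n z) (px (Suc n) z)) has_derivative
      (\<lambda>v. - pp n z \<bullet> fst (DFn n z v) + pp (Suc n) z \<bullet> fst (DFn (Suc n) z v))) (at z)"
    using px_Suc_eqs[of n z] by simp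
  from has_derivative_add[OF Suc this] show ?case
    unfolding act_Suc[abs_def] by (simp add: algebra_simps)
qed

end

section \<open>Invariant graphs exclude conjugate points\<close>

lemma coercive_attains_inf:
  fixes f :: "'a::euclidean_space \<Rightarrow> real"
  assumes cont: "continuous_on UNIV f" and coer: "\<And>c. bounded {x. f x \<le> c}"
  shows "\<exists>x. \<forall>y. f x \<le> f y"
proof -
  have "closed {x. f x \<le> f 0}" using continuous_on_closed_Collect_le[OF cont, of "\<lambda>_. f 0"] by simp
  then have "compact {x. f x \<le> f 0}" using coer by (simp add: compact_eq_bounded_closed)
  from continuous_attains_inf[OF this _ continuous_on_subset[OF cont]]
  obtain x where x: "f x \<le> f 0" "\<And>y. f y \<le> f 0 \<Longrightarrow> f x \<le> f y" by blast
  then have "f x \<le> f y" for y using x(2)[of y] by linarith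
  then show ?thesis by blast
qed

lemma gradient_zero_at_min:
  fixes f :: "'a::euclidean_space \<Rightarrow> real"
  assumes "(f has_derivative (\<lambda>h. g \<bullet> h)) (at x)" "\<And>y. f x \<le> f y"
  shows "g = 0"
  using has_derivative_local_min[OF assms(1)] assms(2) by (metis inner_eq_zero_iff always_eventually)

lemma has_derivative_quadratic:
  fixes f :: "'a::euclidean_space \<Rightarrow> real"
  assumes "\<And>h. norm h \<le> 1 \<Longrightarrow> \<bar>f (x + h) - f x - g \<bullet> h\<bar> \<le> K * (norm h)\<^sup>2"
  shows "(f has_derivative (\<lambda>h. g \<bullet> h)) (at x)"
  unfolding has_derivative_at_alt
proof (intro conjI allI impI)
  show "bounded_linear ((\<bullet>) g)" by (rule bounded_linear_inner_right)
  fix e :: real assume "e > 0"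
  define d where "d = min 1 (e / (\<bar>K\<bar> + 1))"
  have "d > 0" using \<open>e > 0\<close> by (simp add: d_def add_nonneg_pos)
  moreover have "norm (f y - f x - g \<bullet> (y - x)) \<le> e * norm (y - x)" if "norm (y - x) < d" for y
  proof -
    define w where "w = norm (y - x)"
    have w: "w \<ge> 0" "w \<le> 1" "w * (\<bar>K\<bar> + 1) \<le> e"
      using that by (auto simp: d_def w_def field_simps add_nonneg_pos)
    have "\<bar>f y - f x - g \<bullet> (y - x)\<bar> \<le> K * w\<^sup>2" using assms[of "y - x"] w by (simp add: w_def)
    also have "\<dots> \<le> (\<bar>K\<bar> + 1) * w\<^sup>2" by (intro mult_right_mono) auto
    also have "\<dots> = (w * (\<bar>K\<bar> + 1)) * w" by (simp add: power2_eq_square)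
    also have "\<dots> \<le> e * w" using w by (intro mult_right_mono) auto
    finally show ?thesis by (simp add: w_def)
  qed
  ultimately show "\<exists>d>0. \<forall>y. norm (y - x) < d \<longrightarrow> norm (f y - f x - g \<bullet> (y - x)) \<le> e * norm (y - x)" by blast
qed

text \<open>Using the hypothesis at \<open>x + h\<close> with \<open>- h\<close> makes it two-sided,
  so the derivative vanishes. A one-sided bound is what one gets by keeping an old minimizer as a
  competitor.\<close>

lemma quadratic_variation_constant:
  fixes f :: "'a::euclidean_space \<Rightarrow> real"
  assumes "\<And>x h. norm h \<le> 1 \<Longrightarrow> f (x + h) \<le> f x + K * (norm h)\<^sup>2"
  obtains c where "\<And>x. f x = c"
proof -
  have "(f has_derivative (\<lambda>h. 0 \<bullet> h)) (at x)" for x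
  proof (rule has_derivative_quadratic[of f x 0 K])
    fix h :: 'a assume "norm h \<le> 1"
    then show "\<bar>f (x + h) - f x - 0 \<bullet> h\<bar> \<le> K * (norm h)\<^sup>2"
      using assms[of h x] assms[of "- h" "x + h"] by simp
  qed
  then show thesis using has_derivative_zero_constant[of UNIV f] that by auto
qed

lemma lipschitz_gradient_taylor:
  fixes f :: "'a::euclidean_space \<Rightarrow> real"
  assumes der: "\<And>x. (f has_derivative (\<lambda>h. V x \<bullet> h)) (at x)" and lip: "L-lipschitz_on UNIV V"
  shows "\<bar>f (x + h) - f x - V x \<bullet> h\<bar> \<le> L * (norm h)\<^sup>2"
proof -
  obtain t where t: "0 < t" "t < 1" "f (x + h) - f x = V (x + t *\<^sub>R h) \<bullet> h"
    using gradient_mvt[OF der] by blast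
  have "norm (V (x + t *\<^sub>R h) - V x) \<le> L * norm (t *\<^sub>R h)"
    using lipschitz_onD[OF lip, of "x + t *\<^sub>R h" x] by (simp add: dist_norm)
  also have "\<dots> \<le> L * norm h"
    using t lipschitz_on_nonneg[OF lip] by (intro mult_left_mono) (auto intro: mult_left_le_one_le)
  finally have "norm (V (x + t *\<^sub>R h) - V x) * norm h \<le> (L * norm h) * norm h"
    by (rule mult_right_mono) simp
  then show ?thesis
    using Cauchy_Schwarz_ineq2[of "V (x + t *\<^sub>R h) - V x" h] t
    by (simp add: inner_diff_left power2_eq_square)
qed

context twist_system
begin

lemma S1_Fb: "S1 (fst z) (fst (Fb z)) = - snd z"
  by (subst Fb_eqs(1)) simp

lemma Fb_step_le: "norm (fst (Fb (x, q)) - x) \<le> (norm q + bnd 0) / A"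
proof -
  define v where "v = fst (Fb (x, q)) - x"
  have q: "S1 x (x + v) = - q" using S1_Fb[of "(x, q)"] by (simp add: v_def)
  have "A * (norm v)\<^sup>2 \<le> (S1 x x - S1 x (x + v)) \<bullet> v"
    using S1_monotone[of x x v] by (simp add: inner_diff_left)
  also have "\<dots> \<le> norm (S1 x x - S1 x (x + v)) * norm v" by (rule norm_cauchy_schwarz)
  also have "\<dots> \<le> (norm q + bnd 0) * norm v"
    using q bnd_S1[of x x 0] norm_triangle_ineq[of "S1 x x" q] by (intro mult_right_mono) auto
  finally show ?thesis unfolding v_def by (rule norm_le_of_quadratic) (use bnd_ge1[of 0] in simp)
qed

definition dominated :: "(real^'n \<Rightarrow> real) \<Rightarrow> real \<Rightarrow> bool" where
  "dominated U a \<longleftrightarrow> (\<forall>x y. U y - U x + a \<le> S x y)"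

text \<open>The equivalence in the last clause expresses both inclusions in the invariance of the
  graph of \<open>p\<close>, because \<open>Fb\<close> is a bijection. The backward direction is
  what identifies minimizers in \<open>invariant_leaf_dominated\<close>.\<close>

definition invariant_leaf :: "(real^'n \<Rightarrow> real) \<Rightarrow> (real^'n \<Rightarrow> real^'n) \<Rightarrow> bool" where
  "invariant_leaf U p \<longleftrightarrow> (\<forall>x. (U has_derivative (\<lambda>h. p x \<bullet> h)) (at x)) \<and>
     (\<exists>K. K-lipschitz_on UNIV p) \<and> bounded (range p) \<and>
     (\<forall>x q. q = p x \<longleftrightarrow> snd (Fb (x, q)) = p (fst (Fb (x, q))))"

lemma dominated_act:
  assumes "dominated U a"
  shows "U (px n z) - U (fst z) + real n * a \<le> act n z"
proof (induction n)
  case (Suc n)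
  have "U (px (Suc n) z) - U (px n z) + a \<le> S (px n z) (px (Suc n) z)"
    using assms by (simp add: dominated_def)
  then show ?case using Suc by (simp add: act_Suc algebra_simps)
qed simp

lemma invariant_leaf_orbit:
  assumes "invariant_leaf U p" "snd z = p (fst z)"
  shows "pp n z = p (px n z)"
proof (induction n)
  case (Suc n)
  then show ?case
    using assms(1) unfolding invariant_leaf_def px_def pp_def by (metis funpow.simps(2) o_apply prod.collapse)
qed (simp add: assms)

text \<open>For fixed \<open>x\<close>, a minimizer \<open>y0\<close> of \<open>S x y - U y\<close>
  satisfies \<open>S2 x y0 = p y0\<close>, so by backward invariance it is the image
  \<open>g x\<close> on the leaf. Let \<open>\<phi> x\<close> be the minimal value plus
  \<open>U x\<close>. With \<open>g x\<close> kept as competitor at \<open>x + h\<close> the linear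
  terms cancel, because \<open>S1 x (g x) = - p x\<close>. Hence \<open>\<phi>\<close> is constant,
  although \<open>g\<close> is never differentiated.\<close>

lemma invariant_leaf_dominated:
  assumes leaf: "invariant_leaf U p"
  obtains a where "dominated U a"
    and "\<And>z. snd z = p (fst z) \<Longrightarrow> S (fst z) (fst (Fb z)) = U (fst (Fb z)) - U (fst z) + a"
proof -
  obtain L where U': "\<And>x. (U has_derivative (\<lambda>h. p x \<bullet> h)) (at x)" and L: "L-lipschitz_on UNIV p"
    and bd: "bounded (range p)" and inv: "\<And>x q. q = p x \<longleftrightarrow> snd (Fb (x, q)) = p (fst (Fb (x, q)))"
    using leaf unfolding invariant_leaf_def by blast
  obtain B where B: "\<And>x. norm (p x) \<le> B" using bd by (auto simp: bounded_iff)
  define g where "g x = fst (Fb (x, p x))" for x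
  have gS: "S1 x (g x) = - p x" for x using S1_Fb[of "(x, p x)"] by (simp add: g_def)
  have Ulip: "\<bar>U y - U x\<bar> \<le> B * norm (y - x)" for x y
    by (rule gradient_bounded_lipschitz[OF U' B])
  have min: "S x (g x) - U (g x) \<le> S x y - U y" for x y
  proof -
    have "\<exists>y. \<forall>y'. S x y - U y \<le> S x y' - U y'"
    proof (rule coercive_attains_inf)
      show "continuous_on UNIV (\<lambda>y. S x y - U y)"
        by (intro continuous_intros gradient_continuous[OF U'])
      fix c
      have "norm y \<le> norm x + step_bound (c + U x) B" if "S x y - U y \<le> c" for y
      proof -
        have "S x y \<le> (c + U x) + B * norm (y - x)" using that Ulip[of y x] by simp
        then have "norm (y - x) \<le> step_bound (c + U x) B" by (rule step_bound)
        then show ?thesis using norm_triangle_ineq[of "y - x" x] by simp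
      qed
      then show "bounded {y. S x y - U y \<le> c}" unfolding bounded_iff by blast
    qed
    then obtain y0 where y0: "\<And>y'. S x y0 - U y0 \<le> S x y' - U y'" by blast
    have "((\<lambda>y. S x y - U y) has_derivative (\<lambda>h. (S2 x y0 - p y0) \<bullet> h)) (at y0)"
      unfolding inner_diff_left by (intro has_derivative_diff S_deriv_snd U')
    from gradient_zero_at_min[OF this y0] have "S2 x y0 = p y0" by simp
    then have "- S1 x y0 = p x" using inv[of "- S1 x y0" x] Fb_eqI[of x y0] by simp
    then have "g x = y0" using Fb_eqI[of x y0] by (simp add: g_def)
    then show ?thesis using y0 by simp
  qed
  define \<phi> where "\<phi> x = S x (g x) - U (g x) + U x" for x
  define R where "R = (B + bnd 0) / A"
  have gR: "norm (g x - x) \<le> R" for x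
  proof -
    have "norm (g x - x) \<le> (norm (p x) + bnd 0) / A" unfolding g_def by (rule Fb_step_le)
    also have "\<dots> \<le> R" using B[of x] A_pos by (simp add: R_def divide_right_mono)
    finally show ?thesis .
  qed
  have "\<phi> (x + h) \<le> \<phi> x + (bnd R + L) * (norm h)\<^sup>2" if h: "norm h \<le> 1" for x h
  proof -
    have "\<phi> (x + h) \<le> S (x + h) (g x) - U (g x) + U (x + h)" using min[of "x + h" "g x"] by (simp add: \<phi>_def)
    moreover have "\<bar>S (x + h) (g x) - S x (g x) - S1 x (g x) \<bullet> h\<bar> \<le> bnd R * (norm h)\<^sup>2"
      by (rule taylor1[OF gR h])
    moreover have "\<bar>U (x + h) - U x - p x \<bullet> h\<bar> \<le> L * (norm h)\<^sup>2"
      by (rule lipschitz_gradient_taylor[OF U' L])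
    ultimately show ?thesis using gS by (simp add: \<phi>_def distrib_right)
  qed
  from quadratic_variation_constant[OF this] obtain a where a: "\<And>x. \<phi> x = a" by blast
  show thesis
  proof (rule that)
    show "dominated U a" unfolding dominated_def
    proof (intro allI)
      fix x y show "U y - U x + a \<le> S x y" using min[of x y] a[of x] by (simp add: \<phi>_def)
    qed
    fix z :: "(real^'n) \<times> (real^'n)" assume "snd z = p (fst z)"
    then have "z = (fst z, p (fst z))" by (simp add: prod_eq_iff)
    then show "S (fst z) (fst (Fb z)) = U (fst (Fb z)) - U (fst z) + a"
      using a[of "fst z"] by (metis \<phi>_def g_def add_diff_cancel_left' diff_add_eq diff_diff_eq2 add.commute)
  qed
qed

lemma leaf_act:
  assumes leaf: "invariant_leaf U p" and z: "snd z = p (fst z)"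
    and eq: "\<And>z. snd z = p (fst z) \<Longrightarrow> S (fst z) (fst (Fb z)) = U (fst (Fb z)) - U (fst z) + a"
  shows "act n z = U (px n z) - U (fst z) + real n * a"
proof (induction n)
  case (Suc n)
  have "S (px n z) (px (Suc n) z) = U (px (Suc n) z) - U (px n z) + a"
    using eq[of "(Fb ^^ n) z"] invariant_leaf_orbit[OF leaf z, of n] by (simp add: px_def pp_def)
  then show ?case using Suc by (simp add: act_Suc algebra_simps)
qed simp

text \<open>The competitor is any orbit segment of \<open>n\<close> steps followed by a free jump to
  the same end point. Domination bounds its action from below by that of the leaf orbit, which is
  calibrated.\<close>

lemma leaf_minimal:
  assumes leaf: "invariant_leaf U p" and z: "snd z = p (fst z)" and w: "fst w = fst z"
  shows "act (Suc n) z \<le> act n w + S (px n w) (px (Suc n) z)"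
proof -
  obtain a where dom: "dominated U a"
    and eq: "\<And>z. snd z = p (fst z) \<Longrightarrow> S (fst z) (fst (Fb z)) = U (fst (Fb z)) - U (fst z) + a"
    using invariant_leaf_dominated[OF leaf] by blast
  have "act (Suc n) z = U (px (Suc n) z) - U (fst z) + real (Suc n) * a"
    by (rule leaf_act[OF leaf z eq])
  moreover have "U (px n w) - U (fst w) + real n * a \<le> act n w" by (rule dominated_act[OF dom])
  moreover have "U (px (Suc n) z) - U (px n w) + a \<le> S (px n w) (px (Suc n) z)"
    using dom by (simp add: dominated_def)
  ultimately show ?thesis using w by (simp add: algebra_simps)
qed

text \<open>The first step of the orbit of \<open>(x, q)\<close> already has an excess of action over the leaf of order
  \<open>(norm (q - p x))\<^sup>2\<close>, whereas the total excess of this minimizing orbit segment is at most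
  quadratic in the distance of the end points.\<close>

lemma leaf_expansion:
  assumes leaf: "invariant_leaf U p"
    and min: "\<And>z w n. fst w = fst z \<Longrightarrow> act (Suc n) z \<le> act n w + S (px n w) (px (Suc n) z)"
  obtains K where "K > 0" "\<And>q. norm (q - p x) \<le> 1 \<Longrightarrow>
    norm (px (Suc n) (x, q) - px (Suc n) (x, p x)) \<le> 1 \<Longrightarrow>
    norm (q - p x) \<le> K * norm (px (Suc n) (x, q) - px (Suc n) (x, p x))"
proof -
  obtain L where U': "\<And>x. (U has_derivative (\<lambda>h. p x \<bullet> h)) (at x)" and L: "L-lipschitz_on UNIV p"
    and bd: "bounded (range p)"
    using leaf unfolding invariant_leaf_def by blast
  obtain B where B: "\<And>x. norm (p x) \<le> B" using bd by (auto simp: bounded_iff)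
  obtain a where dom: "dominated U a"
    and eq: "\<And>z. snd z = p (fst z) \<Longrightarrow> S (fst z) (fst (Fb z)) = U (fst (Fb z)) - U (fst z) + a"
    using invariant_leaf_dominated[OF leaf] by blast
  define ex where "ex x y = S x y - a - U y + U x" for x y
  have ex0: "ex x y \<ge> 0" for x y using dom by (simp add: dominated_def ex_def algebra_simps)
  define R where "R = (B + 1 + bnd 0) / A"
  have step: "norm (fst (Fb (y, q)) - y) \<le> R" if "norm q \<le> B + 1" for y q
    using Fb_step_le[of y q] that A_pos divide_right_mono[of "norm q + bnd 0" "B + 1 + bnd 0" A]
    by (simp add: R_def)
  define K where "K = bnd R + L"
  have K1: "K \<ge> 1" using bnd_ge1[of R] lipschitz_on_nonneg[OF L] by (simp add: K_def)
  show thesis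
  proof (rule that[of "2 * K"])
    show "2 * K > 0" using K1 by simp
    fix q assume q: "norm (q - p x) \<le> 1"
      and end1: "norm (px (Suc n) (x, q) - px (Suc n) (x, p x)) \<le> 1"
    define z where "z = (x, p x)"
    define z' where "z' = (x, q)"
    define y1 where "y1 = fst (Fb z')"
    define xn where "xn = px n z"
    define k where "k = px (Suc n) z' - px (Suc n) z"
    have z: "snd z = p (fst z)" by (simp add: z_def)
    have orb: "pp m z = p (px m z)" for m by (rule invariant_leaf_orbit[OF leaf z])
    have xnR: "norm (px (Suc n) z - xn) \<le> R"
      using step[of "pp n z" "px n z"] B[of "px n z"] orb[of n] by (simp add: px_Suc xn_def)
    have qB: "norm q \<le> B + 1" using q B[of x] norm_triangle_ineq[of "p x" "q - p x"] by simp
    have y1R: "norm (y1 - x) \<le> R" using step[OF qB] by (simp add: y1_def z'_def)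
    have "ex xn (px (Suc n) z) = 0"
      using eq[of "(Fb ^^ n) z"] orb[of n] by (simp add: ex_def xn_def px_def pp_def)
    moreover have "\<bar>S xn (px (Suc n) z + k) - S xn (px (Suc n) z) - S2 xn (px (Suc n) z) \<bullet> k\<bar> \<le> bnd R * (norm k)\<^sup>2"
      using end1 by (intro taylor2[OF xnR]) (simp add: k_def z_def z'_def)
    moreover have "S2 xn (px (Suc n) z) = p (px (Suc n) z)"
      using px_Suc_eqs(2)[of n z] orb[of "Suc n"] by (simp add: xn_def)
    moreover have "\<bar>U (px (Suc n) z + k) - U (px (Suc n) z) - p (px (Suc n) z) \<bullet> k\<bar> \<le> L * (norm k)\<^sup>2"
      by (rule lipschitz_gradient_taylor[OF U' L])
    \<comment> \<open>The last step on the leaf has excess 0 and ends with momentum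
      \<open>p\<close>, so moving its end by \<open>k\<close> costs only second order.\<close>
    ultimately have up: "ex xn (px (Suc n) z') \<le> K * (norm k)\<^sup>2"
      by (simp add: ex_def K_def k_def distrib_right)
    have "act (Suc n) z' = S x y1 + act n (Fb z')"
      using act_add[of 1 n z'] act_Suc[of 0 z'] by (simp add: y1_def px_Suc z'_def)
    moreover have "U (px n (Fb z')) - U (fst (Fb z')) + real n * a \<le> act n (Fb z')"
      by (rule dominated_act[OF dom])
    moreover have "px n (Fb z') = px (Suc n) z'" using px_add[of 1 n z'] by simp
    moreover have "act (Suc n) z' \<le> act n z + S xn (px (Suc n) z')"
      unfolding xn_def by (rule min) (simp add: z_def z'_def)
    moreover have "act n z = U (px n z) - U (fst z) + real n * a"
      by (rule leaf_act[OF leaf z eq])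
    ultimately have "ex x y1 \<le> ex xn (px (Suc n) z')"
      by (simp add: ex_def y1_def xn_def z_def z'_def algebra_simps)
    then have ex1: "ex x y1 \<le> K * (norm k)\<^sup>2" using up by simp
    \<comment> \<open>This \<open>h\<close> maximizes the linear gain
      \<open>(q - p x) \<bullet> h\<close> minus the error
      \<open>K * (norm h)\<^sup>2\<close>.\<close>
    define h where "h = (1 / (2 * K)) *\<^sub>R (q - p x)"
    have nh: "norm h = norm (q - p x) / (2 * K)" using K1 by (simp add: h_def)
    have h1: "norm h \<le> 1" unfolding nh using q K1 by (simp add: divide_le_eq)
    have "\<bar>S (x + h) y1 - S x y1 - S1 x y1 \<bullet> h\<bar> \<le> bnd R * (norm h)\<^sup>2"
      by (rule taylor1[OF y1R h1])
    moreover have "S1 x y1 = - q" using S1_Fb[of z'] by (simp add: z'_def y1_def)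
    moreover have "\<bar>U (x + h) - U x - p x \<bullet> h\<bar> \<le> L * (norm h)\<^sup>2"
      by (rule lipschitz_gradient_taylor[OF U' L])
    moreover have "ex (x + h) y1 \<ge> 0" by (rule ex0)
    ultimately have "(q - p x) \<bullet> h \<le> ex x y1 + K * (norm h)\<^sup>2"
      by (simp add: ex_def K_def distrib_right inner_diff_left)
    moreover have "(q - p x) \<bullet> h = 2 * K * (norm h)\<^sup>2"
    proof -
      have "q - p x = (2 * K) *\<^sub>R h" using K1 by (simp add: h_def)
      then show ?thesis by (simp add: power2_norm_eq_inner)
    qed
    ultimately have "K * (norm h)\<^sup>2 \<le> K * (norm k)\<^sup>2" using ex1 by simp
    then have "(norm h)\<^sup>2 \<le> (norm k)\<^sup>2" using K1 by simp
    then have "norm h \<le> norm k" by (rule power2_le_imp_le) simp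
    then show "norm (q - p x) \<le> 2 * K * norm (px (Suc n) (x, q) - px (Suc n) (x, p x))"
      using nh K1 by (simp add: k_def z_def z'_def field_simps)
  qed
qed

text \<open>\<open>Suc n\<close> leaves out the trivial iterate. Negative iterates are reduced to
  positive ones in \<open>without_conjugate_points_iff\<close>.\<close>

definition no_conjugate :: bool where
  "no_conjugate \<longleftrightarrow> (\<forall>n z w. fst (DFn (Suc n) z (0, w)) = 0 \<longrightarrow> w = 0)"

text \<open>Along a vertical vector killed by the horizontal part of \<open>DFn\<close>, the end
  point moves by less than any given fraction of the displacement, once this is small. The fraction
  \<open>e\<close> is chosen with \<open>K * e < 1\<close>, which contradicts
  \<open>leaf_expansion\<close>.\<close>

theorem leaves_no_conjugate:
  assumes leaves: "\<And>z. \<exists>U p. invariant_leaf U p \<and> snd z = p (fst z)"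
  shows no_conjugate
  unfolding no_conjugate_def
proof (intro allI impI)
  fix n z w assume 0: "fst (DFn (Suc n) z (0, w)) = 0"
  have min: "act (Suc n) z \<le> act n w + S (px n w) (px (Suc n) z)" if "fst w = fst z" for z w n
    using leaves[of z] leaf_minimal that by blast
  obtain U p where leaf: "invariant_leaf U p" and z: "snd z = p (fst z)" using leaves by blast
  obtain x where zx: "z = (x, p x)" using z by (metis prod.collapse)
  obtain K where K: "K > 0" "\<And>q. norm (q - p x) \<le> 1 \<Longrightarrow>
    norm (px (Suc n) (x, q) - px (Suc n) (x, p x)) \<le> 1 \<Longrightarrow>
    norm (q - p x) \<le> K * norm (px (Suc n) (x, q) - px (Suc n) (x, p x))"
    using leaf_expansion[OF leaf min] by metis
  define e where "e = 1 / (2 * K + 1)"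
  have e: "e > 0" "e \<le> 1" "K * e < 1" using K(1) by (auto simp: e_def field_simps)
  obtain d where d: "d > 0" "\<And>y. norm (y - z) < d \<Longrightarrow>
      norm (px (Suc n) y - px (Suc n) z - fst (DFn (Suc n) z (y - z))) \<le> e * norm (y - z)"
    using px_has_derivative[of "Suc n" z] e(1) unfolding has_derivative_at_alt by blast
  show "w = 0"
  proof (rule ccontr)
    assume w: "w \<noteq> 0"
    define t where "t = min 1 (d / 2) / norm w"
    have t: "t > 0" using w d by (simp add: t_def)
    define q where "q = p x + t *\<^sub>R w"
    have nq: "norm (q - p x) = min 1 (d / 2)" using w d by (simp add: q_def t_def)
    have yz: "(x, q) - z = t *\<^sub>R (0, w)" by (simp add: zx q_def)
    have "norm ((x, q) - z) = norm (q - p x)" by (simp add: zx norm_Pair)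
    moreover have "fst (DFn (Suc n) z ((x, q) - z)) = 0"
      unfolding yz using 0 by (simp only: linear_cmul[OF DFn_lin] fst_scaleR scaleR_zero_right)
    ultimately have *: "norm (px (Suc n) (x, q) - px (Suc n) (x, p x)) \<le> e * norm (q - p x)"
      using d(2)[of "(x, q)"] nq d(1) by (simp add: zx)
    also have "\<dots> \<le> 1 * 1" using e nq d(1) by (intro mult_mono) auto
    finally have "norm (q - p x) \<le> K * norm (px (Suc n) (x, q) - px (Suc n) (x, p x))"
      using nq by (intro K(2)) auto
    also have "\<dots> \<le> K * (e * norm (q - p x))" using * K(1) by (intro mult_left_mono) auto
    also have "\<dots> = (K * e) * norm (q - p x)" by simp
    also have "\<dots> < 1 * norm (q - p x)" using e nq d(1) by (intro mult_strict_right_mono) auto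
    finally show False by simp
  qed
qed

end

section \<open>Minimality of all orbits in the absence of conjugate points\<close>

lemma hessian_psd_at_min:
  fixes f :: "'a::euclidean_space \<Rightarrow> real"
  assumes der: "\<And>x. (f has_derivative (\<lambda>h. V x \<bullet> h)) (at x)"
    and der2: "(V has_derivative H) (at z)" and min: "\<And>y. f z \<le> f y"
  shows "0 \<le> H h \<bullet> h"
proof (rule ccontr)
  assume neg: "\<not> 0 \<le> H h \<bullet> h"
  have V0: "V z = 0" by (rule gradient_zero_at_min[OF der min])
  interpret H: bounded_linear H using der2 by (rule has_derivative_bounded_linear)
  have h0: "norm h > 0" using neg by (auto simp: H.zero)
  define e where "e = - (H h \<bullet> h) / (2 * (norm h)\<^sup>2)"
  have e: "e > 0" unfolding e_def using neg h0 by (intro divide_pos_pos) auto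
  obtain d where d: "d > 0" "\<And>y. norm (y - z) < d \<Longrightarrow> norm (V y - V z - H (y - z)) \<le> e * norm (y - z)"
    using der2 e unfolding has_derivative_at_alt by blast
  define s where "s = d / (2 * norm h)"
  have s: "s > 0" using d h0 by (simp add: s_def)
  obtain t where t: "0 < t" "t < 1" "f (z + s *\<^sub>R h) - f z = V (z + t *\<^sub>R s *\<^sub>R h) \<bullet> (s *\<^sub>R h)"
    using gradient_mvt[OF der] by blast
  define r where "r = t * s"
  have r: "r > 0" "r < s" using t s by (auto simp: r_def)
  have "norm (r *\<^sub>R h) < s * norm h" using r h0 by simp
  also have "\<dots> < d" using d h0 by (simp add: s_def)
  finally have "norm (V (z + r *\<^sub>R h) - H (r *\<^sub>R h)) \<le> e * norm (r *\<^sub>R h)"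
    using d(2)[of "z + r *\<^sub>R h"] V0 by simp
  then have "(V (z + r *\<^sub>R h) - H (r *\<^sub>R h)) \<bullet> h \<le> (e * norm (r *\<^sub>R h)) * norm h"
    using norm_cauchy_schwarz[of "V (z + r *\<^sub>R h) - H (r *\<^sub>R h)" h] mult_right_mono norm_ge_zero order.trans by metis
  moreover have "(e * norm (r *\<^sub>R h)) * norm h = r * (- (H h \<bullet> h) / 2)"
    using r h0 by (simp add: e_def power2_eq_square field_simps)
  ultimately have "V (z + r *\<^sub>R h) \<bullet> h \<le> r * (H h \<bullet> h) / 2"
    by (simp add: inner_diff_left H.scaleR)
  also have "\<dots> < 0" using r neg by (simp add: mult_pos_neg)
  finally have "V (z + t *\<^sub>R s *\<^sub>R h) \<bullet> (s *\<^sub>R h) < 0" using s by (simp add: r_def mult_pos_neg)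
  then show False using t(3) min[of "z + s *\<^sub>R h"] by simp
qed

text \<open>The expansion of \<open>V\<close> at \<open>z\<close> shows that the gradient points
  outward near \<open>z\<close>; the mean value theorem along the segment from \<open>z\<close> then
  makes \<open>f\<close> larger at its other end.\<close>

lemma strict_min_of_hessian:
  fixes f :: "'a::euclidean_space \<Rightarrow> real"
  assumes der: "\<And>x. (f has_derivative (\<lambda>h. V x \<bullet> h)) (at x)"
    and der2: "(V has_derivative H) (at z)" and V0: "V z = 0"
    and pos: "\<And>h. h \<noteq> 0 \<Longrightarrow> 0 < H h \<bullet> h"
  shows "\<exists>e>0. \<forall>y. y \<noteq> z \<and> dist y z < e \<longrightarrow> f z < f y"
proof -
  interpret H: bounded_linear H using der2 by (rule has_derivative_bounded_linear)
  have "\<exists>l>0. \<forall>h. l * (norm h)\<^sup>2 \<le> H h \<bullet> h"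
  proof (cases "sphere 0 1 = ({} :: 'a set)")
    case True
    then have "h = 0" for h :: 'a
    proof (rule contrapos_pp)
      assume "h \<noteq> 0"
      then have "h /\<^sub>R norm h \<in> sphere 0 1" by simp
      then show "sphere 0 1 \<noteq> ({} :: 'a set)" by blast
    qed
    then have "1 * (norm h)\<^sup>2 \<le> H h \<bullet> h" for h by (metis H.zero inner_zero_left mult_1 norm_zero order_refl power2_eq_square mult_zero_left)
    then show ?thesis by (metis zero_less_one)
  next
    case False
    have "continuous_on (sphere 0 1) (\<lambda>h. H h \<bullet> h)"
      by (intro continuous_intros H.continuous_on)
    from continuous_attains_inf[OF compact_sphere False this]
    obtain u where u: "norm u = 1" "\<And>h. norm h = 1 \<Longrightarrow> H u \<bullet> u \<le> H h \<bullet> h" by auto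
    have "H u \<bullet> u * (norm h)\<^sup>2 \<le> H h \<bullet> h" for h
    proof (cases "h = 0")
      case False
      then have "H u \<bullet> u \<le> H (h /\<^sub>R norm h) \<bullet> (h /\<^sub>R norm h)" by (intro u(2)) simp
      also have "\<dots> = (H h \<bullet> h) / (norm h)\<^sup>2" by (simp add: H.scaleR power2_eq_square divide_inverse)
      finally show ?thesis using False by (simp add: field_simps)
    qed (simp add: H.zero)
    moreover have "H u \<bullet> u > 0" using pos[of u] u(1) by force
    ultimately show ?thesis by blast
  qed
  then obtain l where l: "l > 0" "\<And>h. l * (norm h)\<^sup>2 \<le> H h \<bullet> h" by blast
  obtain d where d: "d > 0" "\<And>y. norm (y - z) < d \<Longrightarrow> norm (V y - V z - H (y - z)) \<le> l / 2 * norm (y - z)"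
    using der2 l(1) unfolding has_derivative_at_alt by (metis half_gt_zero)
  have Vpos: "V y \<bullet> (y - z) > 0" if y: "y \<noteq> z" "norm (y - z) < d" for y
  proof -
    define h where "h = y - z"
    have "norm (V y - H h) \<le> l / 2 * norm h" using d(2)[OF y(2)] V0 by (simp add: h_def)
    then have "norm (V y - H h) * norm h \<le> (l / 2 * norm h) * norm h" by (rule mult_right_mono) simp
    then have "- ((V y - H h) \<bullet> h) \<le> l / 2 * (norm h)\<^sup>2"
      using Cauchy_Schwarz_ineq2[of "V y - H h" h] by (simp add: power2_eq_square)
    then have "V y \<bullet> h \<ge> l / 2 * (norm h)\<^sup>2" using l(2)[of h] by (simp add: inner_diff_left)
    moreover have "l / 2 * (norm h)\<^sup>2 > 0" using l(1) y(1) by (simp add: h_def)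
    ultimately show ?thesis by (simp add: h_def)
  qed
  show ?thesis
  proof (intro exI[of _ d] conjI allI impI)
    fix y assume y: "y \<noteq> z \<and> dist y z < d"
    obtain t where t: "0 < t" "t < 1" "f (z + (y - z)) - f z = V (z + t *\<^sub>R (y - z)) \<bullet> (y - z)"
      using gradient_mvt[OF der] by blast
    have "norm (t *\<^sub>R (y - z)) \<le> norm (y - z)" using t by (simp add: mult_left_le_one_le)
    then have "V (z + t *\<^sub>R (y - z)) \<bullet> (z + t *\<^sub>R (y - z) - z) > 0"
      using y t by (intro Vpos) (auto simp: dist_norm simp del: norm_scaleR)
    then have "V (z + t *\<^sub>R (y - z)) \<bullet> (y - z) > 0" using t by (simp add: zero_less_mult_iff)
    then show "f z < f y" using t(3) by simp
  qed (rule d)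
qed

text \<open>A null vector minimizes a semidefinite form, so the term linear in \<open>s\<close> in
  the value at \<open>v + s *\<^sub>R w\<close> must vanish. The constant \<open>c\<close> exceeds
  \<open>B w w\<close> by 1 so that the optimal \<open>s\<close> exists even if
  \<open>B w w = 0\<close>.\<close>

lemma psd_form_null:
  fixes B :: "'a::real_vector \<Rightarrow> 'a \<Rightarrow> real"
  assumes lin1: "\<And>u v w. B (u + v) w = B u w + B v w" "\<And>c v w. B (c *\<^sub>R v) w = c * B v w"
    and sym: "\<And>v w. B v w = B w v"
    and psd: "\<And>v. 0 \<le> B v v" and null: "B v v = 0"
  shows "B v w = 0"
proof (rule ccontr)
  assume nz: "B v w \<noteq> 0"
  define c where "c = B w w + 1"
  define s where "s = - B v w / c"
  have c: "c > 0" "B w w < c" using psd[of w] by (auto simp: c_def)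
  have lin2: "B w (u + v) = B w u + B w v" "B w (c *\<^sub>R v) = c * B w v" for u v w c
    using lin1 sym by metis+
  have "B (v + s *\<^sub>R w) (v + s *\<^sub>R w) = 2 * s * B v w + s\<^sup>2 * B w w"
    by (simp add: lin1 lin2 null sym[of w v] power2_eq_square algebra_simps)
  also have "\<dots> \<le> 2 * s * B v w + s\<^sup>2 * c" using c by (intro add_left_mono mult_left_mono) auto
  also have "\<dots> = - (B v w)\<^sup>2 / c" using c by (simp add: s_def field_simps power2_eq_square)
  also have "\<dots> < 0" using nz c by (simp add: divide_neg_pos)
  finally show False using psd[of "v + s *\<^sub>R w"] by simp
qed

locale twist_system_nc = twist_system S S1 S2 D1 D2 A Fb
  for S :: "real^'n::finite \<Rightarrow> real^'n \<Rightarrow> real" and S1 S2 D1 D2 A Fb +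
  assumes nc: no_conjugate
begin

lemma ncD: "n \<ge> 1 \<Longrightarrow> fst (DFn n z (0, w)) = 0 \<Longrightarrow> w = 0"
  using nc unfolding no_conjugate_def by (metis Suc_le_D One_nat_def)

lemma act_lower_bound: obtains m where "\<And>n z. act n z \<ge> real n * m"
proof -
  obtain m where "\<And>x y. S x y \<ge> m" by (rule S_lower_bound) blast
  then have "act n z \<ge> real n * m" for n z
    unfolding act_def using sum_bounded_below[of "{..<n}" m] by simp
  then show thesis by (rule that)
qed

text \<open>The form \<open>Bf\<close> below is the Hessian of \<open>z \<mapsto> act n + S z y\<close> pulled back by \<open>b\<close>. It is symmetric
  because the map is symplectic and nondegenerate because there are no conjugate points, so by
  connectedness it is positive definite as soon as it is so at one minimum.\<close>

lemma vertical_map_step: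
  assumes n: "n \<ge> 1" and bijP: "bij (\<lambda>p. px n (x, p))"
  shows "bij (\<lambda>p. px (Suc n) (x, p))"
    and "act (Suc n) (x, inv (\<lambda>p. px (Suc n) (x, p)) y) \<le> act n (x, inv (\<lambda>p. px n (x, p)) z) + S z y"
proof -
  define P where "P p = px n (x, p)" for p
  define Q where "Q p = pp n (x, p)" for p
  define Y where "Y p = px (Suc n) (x, p)" for p
  define R where "R = inv P"
  define b where "b p \<xi> = fst (DFn n (x, p) (0, \<xi>))" for p \<xi>
  define d where "d p \<xi> = snd (DFn n (x, p) (0, \<xi>))" for p \<xi>
  define b' where "b' p \<xi> = fst (DFn (Suc n) (x, p) (0, \<xi>))" for p \<xi>
  have bij: "bij P" using bijP unfolding P_def .
  have RP: "R (P p) = p" and PR: "P (R z) = z" for p z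
    using bij by (auto simp: R_def bij_is_inj bij_is_surj surj_f_inv_f)
  have Pd: "(P has_derivative b p) (at p)" for p
    unfolding P_def[abs_def] b_def[abs_def] by (rule has_derivative_slice_snd[OF px_has_derivative])
  have Qd: "(Q has_derivative d p) (at p)" for p
    unfolding Q_def[abs_def] d_def[abs_def] by (rule has_derivative_slice_snd[OF pp_has_derivative])
  have Pc: "continuous_on UNIV P" using Pd by (meson continuous_at_imp_continuous_on has_derivative_continuous)
  have Qc: "continuous_on UNIV Q" using Qd by (meson continuous_at_imp_continuous_on has_derivative_continuous)
  have Yc: "continuous_on UNIV Y"
    unfolding Y_def by (rule continuous_on_compose2[OF px_cont]) (auto intro!: continuous_intros)
  have linb: "linear (b p)" for p
    using Pd has_derivative_linear by blast
  have "\<xi> = 0" if "b p \<xi> = 0" for p \<xi> using ncD[OF n] that by (simp add: b_def)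
  then have injb: "inj (b p)" for p using linear_injective_0[OF linb] by blast
  then have surjb: "surj (b p)" for p using linear_injective_imp_surjective[OF linb] by blast
  have b'0: "\<xi> = 0" if "b' p \<xi> = 0" for p \<xi> using ncD[of "Suc n"] that by (simp add: b'_def)
  have Rd: "(R has_derivative inv (b p)) (at (P p))" for p
    by (rule has_derivative_inverse_strong[OF open_UNIV UNIV_I Pc RP Pd])
      (simp add: fun_eq_iff surj_f_inv_f[OF surjb])
  have Rd': "(R has_derivative inv (b (R z))) (at z)" for z using Rd[of "R z"] by (simp add: PR)
  have Rc: "continuous_on UNIV R" using Rd' by (meson continuous_at_imp_continuous_on has_derivative_continuous)
  \<comment> \<open>\<open>f y z\<close> is the action of the orbit of \<open>n\<close> steps from
    \<open>x\<close> to \<open>z\<close> followed by a jump to \<open>y\<close>. By the first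
    variation formula its gradient \<open>V y z\<close> is the mismatch of momenta at
    \<open>z\<close>.\<close>
  define f where "f y z = act n (x, R z) + S z y" for y z
  define V where "V y z = Q (R z) + S1 z y" for y z
  have fd: "(f y has_derivative (\<lambda>h. V y z \<bullet> h)) (at z)" for y z
  proof -
    have "((\<lambda>z. act n (x, R z)) has_derivative
        (\<lambda>h. pp n (x, R z) \<bullet> fst (DFn n (x, R z) (0, inv (b (R z)) h)))) (at z)"
      using has_derivative_compose[OF has_derivative_Pair[OF has_derivative_const Rd'] act_has_derivative[of n "(x, R z)"]]
      by simp
    moreover have "fst (DFn n (x, R z) (0, inv (b (R z)) h)) = h" for h
      using surj_f_inv_f[OF surjb] by (simp add: b_def)
    ultimately have "((\<lambda>z. act n (x, R z)) has_derivative (\<lambda>h. Q (R z) \<bullet> h)) (at z)" by (simp add: Q_def)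
    from has_derivative_add[OF this S_deriv_fst[of y z]] show ?thesis
      unfolding f_def[abs_def] V_def by (simp add: inner_add_left)
  qed
  have Vc: "continuous_on UNIV (V y)" for y
    unfolding V_def by (intro continuous_intros continuous_on_compose2[OF Qc Rc]) auto
  obtain m where m: "\<And>n z. act n z \<ge> real n * m" using act_lower_bound by blast
  have coer: "bounded {z. f y z \<le> c}" for y c
  proof -
    have "norm z \<le> norm y + step_bound (c - real n * m) 0" if "f y z \<le> c" for z
    proof -
      have "S z y \<le> (c - real n * m) + 0 * norm (y - z)" using that m[of n "(x, R z)"] by (simp add: f_def)
      then have "norm (y - z) \<le> step_bound (c - real n * m) 0" by (rule step_bound)
      then show ?thesis using norm_triangle_ineq4[of y "y - z"] by simp
    qed
    then show ?thesis unfolding bounded_iff by blast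
  qed
  \<comment> \<open>No mismatch means that the jump continues the orbit: critical points are the
    penultimate positions of orbits from \<open>x\<close> to \<open>y\<close>.\<close>
  have crit: "V y z = 0 \<longleftrightarrow> Y (R z) = y" for y z
  proof -
    have zQ: "(Fb ^^ n) (x, R z) = (z, Q (R z))" using PR[of z] by (simp add: px_pp P_def Q_def)
    have "V y z = 0 \<longleftrightarrow> Q (R z) = - S1 z y" by (simp add: V_def eq_neg_iff_add_eq_0)
    also have "\<dots> \<longleftrightarrow> fst (Fb (z, Q (R z))) = y"
      using gen[of z "Q (R z)" y "S2 z y"] Fb_eqI[of z y] S1_Fb[of "(z, Q (R z))"] by auto
    also have "fst (Fb (z, Q (R z))) = Y (R z)" using zQ by (simp add: Y_def px_def)
    finally show ?thesis .
  qed
  define Bf where "Bf p \<xi> \<eta> = b p \<xi> \<bullet> (d p \<eta> + D1 (P p, Y p) (b p \<eta>, 0))" for p \<xi> \<eta>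
  have Bf_b': "Bf p \<xi> \<eta> = - (b p \<xi> \<bullet> D1 (P p, Y p) (0, b' p \<eta>))" for p \<xi> \<eta>
  proof -
    have "D1 (P p, Y p) (b p \<eta>, b' p \<eta>) = - d p \<eta>"
      using DF_eqs(1)[of "(Fb ^^ n) (x, p)" "DFn n (x, p) (0, \<eta>)"]
      by (simp add: P_def Y_def b_def b'_def d_def px_def)
    then have "D1 (P p, Y p) (b p \<eta>, 0) + D1 (P p, Y p) (0, b' p \<eta>) = - d p \<eta>"
      using D1_split[of "(P p, Y p)" "b p \<eta>" "b' p \<eta>"] by simp
    then have "d p \<eta> + D1 (P p, Y p) (b p \<eta>, 0) = - D1 (P p, Y p) (0, b' p \<eta>)"
      by (simp add: eq_neg_iff_add_eq_0 add_ac)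
    then show ?thesis by (simp add: Bf_def)
  qed
  have Bf_sym: "Bf p \<xi> \<eta> = Bf p \<eta> \<xi>" for p \<xi> \<eta>
    using DFn_symplectic[of n "(x, p)" "(0, \<xi>)" "(0, \<eta>)"] D1_fst_sym[of "(P p, Y p)" "b p \<eta>" "b p \<xi>"]
    by (simp add: Bf_def inner_add_right b_def d_def inner_commute)
  have Bf_add: "Bf p (u + v) w = Bf p u w + Bf p v w" and Bf_scale: "Bf p (c *\<^sub>R v) w = c * Bf p v w" for p u v w c
    by (auto simp: Bf_def linear_add[OF linb] linear_cmul[OF linb] inner_add_left)
  \<comment> \<open>A null vector of a semidefinite form lies in its radical. As \<open>b p\<close>
    is onto, the twist forces \<open>b' p \<xi> = 0\<close>, and there are no conjugate points at
    time \<open>Suc n\<close>.\<close>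
  have null: "\<xi> = 0" if psd: "\<And>\<eta>. 0 \<le> Bf p \<eta> \<eta>" and "Bf p \<xi> \<xi> = 0" for p \<xi>
  proof -
    have "Bf p \<eta> \<xi> = 0" for \<eta>
      using psd_form_null[of "Bf p", OF Bf_add Bf_scale Bf_sym psd that(2)] Bf_sym by metis
    then have "b p \<eta> \<bullet> D1 (P p, Y p) (0, b' p \<xi>) = 0" for \<eta> using Bf_b'[of p \<eta> \<xi>] by simp
    then have "D1 (P p, Y p) (0, b' p \<xi>) = 0" using surjb by (metis surjD inner_eq_zero_iff)
    then have "b' p \<xi> = 0" using twist1[of "(P p, Y p)" "b' p \<xi>"] A_pos by (simp add: mult_le_0_iff)
    then show ?thesis by (rule b'0)
  qed
  have cont_DFn: "continuous_on UNIV (\<lambda>w. DFn n (x, fst w) (0, snd w))"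
  proof -
    have "continuous_on UNIV (\<lambda>w. (\<lambda>w. DFn n (fst w) (snd w)) ((x, fst w), (0, snd w)))"
      by (rule continuous_on_compose2[OF DFn_cont]) (auto intro!: continuous_intros)
    then show ?thesis by simp
  qed
  have Bf_cont: "continuous_on UNIV (\<lambda>w. Bf (fst w) (snd w) (snd w))"
    unfolding Bf_def b_def d_def
    by (intro continuous_intros cont_DFn continuous_on_compose2[OF Pc] continuous_on_compose2[OF Yc]) auto
  define K where "K = {p. \<forall>\<xi>. 0 \<le> Bf p \<xi> \<xi>}"
  have "closed K"
  proof -
    have "K = (\<Inter>\<xi>. {p. 0 \<le> Bf p \<xi> \<xi>})" by (auto simp: K_def)
    moreover have "continuous_on UNIV (\<lambda>p. Bf p \<xi> \<xi>)" for \<xi>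
    proof -
      have "continuous_on UNIV (\<lambda>p. (\<lambda>w. Bf (fst w) (snd w) (snd w)) (p, \<xi>))"
        by (rule continuous_on_compose2[OF Bf_cont]) (auto intro!: continuous_intros)
      then show ?thesis by simp
    qed
    ultimately show ?thesis using continuous_on_closed_Collect_le[of UNIV "\<lambda>_. 0"] by (auto intro!: closed_INT)
  qed
  \<comment> \<open>Unit vectors on which the form is nonpositive converge along a subsequence. If
    the limit form were semidefinite, it would have a unit null vector, which \<open>null\<close>
    forbids; so \<open>K\<close> is also open.\<close>
  have "closed (- K)"
    unfolding closed_sequential_limits
  proof (intro allI impI, elim conjE)
    fix s p assume s: "\<forall>k. s k \<in> - K" and lim: "s \<longlonglongrightarrow> p"
    have "\<exists>\<xi>. norm \<xi> = 1 \<and> Bf (s k) \<xi> \<xi> \<le> 0" for k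
    proof -
      obtain \<xi> where \<xi>: "Bf (s k) \<xi> \<xi> < 0" using s by (auto simp: K_def not_le)
      then have "\<xi> \<noteq> 0" using Bf_scale[of "s k" 0 \<xi> \<xi>] by auto
      moreover have "Bf (s k) (\<xi> /\<^sub>R norm \<xi>) (\<xi> /\<^sub>R norm \<xi>) = inverse (norm \<xi>) * (inverse (norm \<xi>) * Bf (s k) \<xi> \<xi>)"
        using Bf_scale Bf_sym by metis
      ultimately show ?thesis using \<xi> by (intro exI[of _ "\<xi> /\<^sub>R norm \<xi>"]) (auto simp: mult_le_0_iff)
    qed
    then obtain \<xi> where \<xi>: "\<And>k. norm (\<xi> k) = 1" "\<And>k. Bf (s k) (\<xi> k) (\<xi> k) \<le> 0" by metis
    have "\<xi> k \<in> sphere 0 1" for k using \<xi> by simp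
    then obtain \<zeta> r where r: "\<zeta> \<in> sphere 0 1" "strict_mono r" "(\<xi> \<circ> r) \<longlonglongrightarrow> \<zeta>"
      using compact_sphere[of 0 1] unfolding compact_def by metis
    have "(\<lambda>k. (s (r k), \<xi> (r k))) \<longlonglongrightarrow> (p, \<zeta>)"
      using LIMSEQ_subseq_LIMSEQ[OF lim r(2)] r(3) by (auto intro!: tendsto_Pair simp: o_def)
    from continuous_on_tendsto_compose[OF Bf_cont this]
    have "(\<lambda>k. Bf (s (r k)) (\<xi> (r k)) (\<xi> (r k))) \<longlonglongrightarrow> Bf p \<zeta> \<zeta>" by simp
    then have le: "Bf p \<zeta> \<zeta> \<le> 0" using \<xi>(2) by (intro LIMSEQ_le_const2[of _ _ 0]) auto
    show "p \<in> - K"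
    proof
      assume "p \<in> K"
      then have "\<zeta> = 0" using le by (intro null[of p]) (auto simp: K_def intro: antisym)
      then show False using r(1) by simp
    qed
  qed
  have Vd: "(V y has_derivative (\<lambda>h. d (R z) (inv (b (R z)) h) + D1 (z, y) (h, 0))) (at z)" for y z
    unfolding V_def[abs_def]
    by (intro has_derivative_add S1_deriv_fst has_derivative_compose[OF Rd' Qd])
  have Hess: "(d p (inv (b p) h) + D1 (P p, Y p) (h, 0)) \<bullet> h = Bf p (inv (b p) h) (inv (b p) h)" for p h
    using surj_f_inv_f[OF surjb] by (simp add: Bf_def inner_commute)
  have fc: "continuous_on UNIV (f y)" for y by (rule gradient_continuous[OF fd])
  have minY: "\<exists>p. Y p = y \<and> (\<forall>z. f y (P p) \<le> f y z)" for y
  proof -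
    obtain z where z: "\<And>z'. f y z \<le> f y z'" using coercive_attains_inf[OF fc coer] by blast
    from gradient_zero_at_min[OF fd z] have "Y (R z) = y" using crit by blast
    then show ?thesis using z PR by metis
  qed
  have "K \<noteq> {}"
  proof -
    obtain p where p: "Y p = Y 0" "\<And>z. f (Y 0) (P p) \<le> f (Y 0) z" using minY by blast
    have "0 \<le> Bf p \<xi> \<xi>" for \<xi>
      using hessian_psd_at_min[OF fd Vd p(2), of "b p \<xi>"] Hess[of p "b p \<xi>"] injb[of p] p(1)
      by (simp add: RP inv_f_f)
    then show ?thesis by (auto simp: K_def)
  qed
  then have K: "K = UNIV" using clopen[of K] \<open>closed K\<close> \<open>closed (- K)\<close> by (auto simp: open_closed)
  have injY: "p = p'" if "Y p = Y p'" for p p'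
  proof -
    have "P p = P p'"
    proof (rule unique_critical_point[OF fd Vc coer])
      show "V (Y p) (P p) = 0" "V (Y p) (P p') = 0" using crit RP that by auto
      fix z assume Vz: "V (Y p) z = 0"
      then have y: "Y (R z) = Y p" using crit by simp
      have "0 < Bf (R z) (inv (b (R z)) h) (inv (b (R z)) h)" if "h \<noteq> 0" for h
      proof -
        have "inv (b (R z)) h \<noteq> 0"
          using that surj_f_inv_f[OF surjb, of "R z" h] linear_0[OF linb] by metis
        then show ?thesis using null[of "R z"] K by (force simp: K_def order_less_le)
      qed
      then show "\<exists>e>0. \<forall>y. y \<noteq> z \<and> dist y z < e \<longrightarrow> f (Y p) z < f (Y p) y"
        using Hess[of "R z"] y PR by (intro strict_min_of_hessian[OF fd Vd Vz]) simp
    qed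
    then show ?thesis using RP by metis
  qed
  have "surj Y" using minY by (metis surjI)
  then show bijY: "bij (\<lambda>p. px (Suc n) (x, p))"
    using injY unfolding Y_def[symmetric] by (auto simp: bij_def inj_def)
  obtain p where p: "Y p = y" "\<And>z. f y (P p) \<le> f y z" using minY by blast
  have "inv (\<lambda>p. px (Suc n) (x, p)) y = p"
    using p(1) bijY unfolding Y_def by (metis (no_types, lifting) bij_inv_eq_iff)
  moreover have "act (Suc n) (x, p) = f y (P p)"
    using p(1) by (simp add: act_Suc f_def RP) (simp add: P_def Y_def)
  ultimately show "act (Suc n) (x, inv (\<lambda>p. px (Suc n) (x, p)) y) \<le> act n (x, inv (\<lambda>p. px n (x, p)) z) + S z y"
    using p(2)[of z] unfolding f_def R_def P_def by simp
qed

lemma bij_vertical_map: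
  assumes "n \<ge> 1"
  shows "bij (\<lambda>p. px n (x, p))"
  using assms
proof (induction n rule: nat_induct_at_least)
  case base
  have eq: "(\<lambda>p. px 1 (x, p)) = (\<lambda>p. fst (Fb (x, p)))" by (simp add: px_def)
  have "fst (Fb (x, - S1 x y)) = y" for y by (simp add: Fb_eqI)
  moreover have "- S1 x (fst (Fb (x, p))) = p" for p using S1_Fb[of "(x, p)"] by simp
  ultimately show ?case unfolding eq by (metis (no_types, lifting) bijI' )
next
  case (Suc n)
  then show ?case by (intro vertical_map_step(1)) auto
qed

text \<open>The action of the only orbit of \<open>n\<close> steps from \<open>x\<close> to
  \<open>y\<close>. The inverse is meaningful for \<open>n \<ge> 1\<close>, since
  \<open>px 0\<close> ignores the momentum; minimality is expressed by \<open>min_act_Suc_le\<close>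
  and \<open>min_act_triangle\<close>.\<close>

definition min_act :: "nat \<Rightarrow> real^'n \<Rightarrow> real^'n \<Rightarrow> real" where
  "min_act n x y = act n (x, inv (\<lambda>p. px n (x, p)) y)"

lemma min_act_px:
  assumes "n \<ge> 1"
  shows "min_act n (fst z) (px n z) = act n z"
proof -
  have "inv (\<lambda>p. px n (fst z, p)) (px n (fst z, snd z)) = snd z"
    using bij_is_inj[OF bij_vertical_map[OF assms, of "fst z"]] by (simp add: inv_f_eq)
  then show ?thesis by (simp add: min_act_def)
qed

lemma orbit_exists:
  assumes "n \<ge> 1"
  obtains z where "fst z = x" "px n z = y" "act n z = min_act n x y"
proof -
  define z where "z = (x, inv (\<lambda>p. px n (x, p)) y)"
  have "px n z = y"
    unfolding z_def using surj_f_inv_f[OF bij_is_surj[OF bij_vertical_map[OF assms, of x]], of y] by simp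
  then show thesis using that[of z] by (simp add: z_def min_act_def)
qed

lemma min_act_1: "min_act 1 x y = S x y"
proof -
  obtain z where z: "fst z = x" "px 1 z = y" "act 1 z = min_act 1 x y" using orbit_exists[of 1 x y] by auto
  have "act 1 z = S (px 0 z) (px (Suc 0) z)" by (simp add: act_def)
  then show ?thesis using z by simp
qed

lemma min_act_Suc_le: "n \<ge> 1 \<Longrightarrow> min_act (Suc n) x y \<le> min_act n x z + S z y"
  unfolding min_act_def by (rule vertical_map_step(2)[OF _ bij_vertical_map])

lemma min_act_le: "min_act (Suc n) (fst z) y \<le> act n z + S (px n z) y"
proof (cases "n \<ge> 1")
  case True
  then show ?thesis using min_act_Suc_le[OF True, of "fst z" y "px n z"] min_act_px[OF True] by simp
next
  case False
  then have "n = 0" by simp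
  then show ?thesis using min_act_1[of "fst z" y] by simp
qed

text \<open>Cut off the last step of the orbit from \<open>y\<close> to \<open>z\<close>: it is a
  jump to which \<open>min_act_Suc_le\<close> applies, and the shortened orbit falls under the
  induction hypothesis.\<close>

lemma min_act_triangle:
  assumes "M \<ge> 1" "N \<ge> 1"
  shows "min_act (M + N) x z \<le> min_act M x y + min_act N y z"
  using assms(2)
proof (induction N arbitrary: z rule: nat_induct_at_least)
  case base
  show ?case using min_act_Suc_le[OF assms(1), of x z y] min_act_1[of y z] by simp
next
  case (Suc N)
  obtain w where w: "fst w = y" "px (Suc N) w = z" "act (Suc N) w = min_act (Suc N) y z"
    by (rule orbit_exists[of "Suc N" y z]) auto
  have "min_act (M + Suc N) x z \<le> min_act (M + N) x (px N w) + S (px N w) z"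
    using min_act_Suc_le[of "M + N" x z "px N w"] assms(1) by simp
  also have "\<dots> \<le> min_act M x y + min_act N y (px N w) + S (px N w) z" using Suc.IH[of "px N w"] by simp
  also have "min_act N y (px N w) + S (px N w) z = act (Suc N) w"
    using min_act_px[OF Suc.hyps(1), of w] w by (simp add: act_Suc)
  then have "min_act M x y + min_act N y (px N w) + S (px N w) z = min_act M x y + min_act (Suc N) y z" using w by simp
  finally show ?case .
qed

lemma min_act_per:
  assumes "n \<ge> 1" "r \<in> int_lattice"
  shows "min_act n (x + r) (y + r) = min_act n x y"
proof -
  obtain z where z: "fst z = x" "px n z = y" "act n z = min_act n x y" using orbit_exists[OF assms(1)] by blast
  have "px n (x + r, snd z) = y + r" using px_per[OF assms(2), of n x "snd z"] z by auto
  moreover have "act n (x + r, snd z) = act n z" using act_per[OF assms(2), of n x "snd z"] z by auto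
  ultimately show ?thesis using min_act_px[OF assms(1), of "(x + r, snd z)"] z by simp
qed

text \<open>Initial phase points correspond bijectively and continuously to pairs of end points; by
  invariance of domain the inverse correspondence is continuous too.\<close>

lemma min_act_cont:
  assumes "n \<ge> 1"
  shows "continuous_on UNIV (\<lambda>w. min_act n (fst w) (snd w))"
proof -
  define G where "G z = (fst z, px n z)" for z
  define H where "H w = (fst w, inv (\<lambda>p. px n (fst w, p)) (snd w))" for w
  have contG: "continuous_on UNIV G" unfolding G_def by (intro continuous_intros px_cont)
  have HG: "H (G z) = z" for z
    unfolding H_def G_def fst_conv snd_conv
    using inv_f_f[OF bij_is_inj[OF bij_vertical_map[OF assms, of "fst z"]], of "snd z"] by simp
  have GH: "G (H w) = w" for w
    unfolding H_def G_def fst_conv snd_conv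
    using surj_f_inv_f[OF bij_is_surj[OF bij_vertical_map[OF assms, of "fst w"]], of "snd w"] by simp
  have "range G = UNIV" using GH by (metis surjI)
  then have "continuous_on UNIV H"
    using continuous_on_inverse_open[OF open_UNIV contG _ HG] by simp
  then have "continuous_on UNIV (\<lambda>w. act n (H w))"
    by (intro continuous_on_compose2[OF act_cont]) auto
  then show ?thesis by (simp add: H_def min_act_def)
qed

lemma min_act_cont_comp:
  "n \<ge> 1 \<Longrightarrow> continuous_on T f \<Longrightarrow> continuous_on T g \<Longrightarrow> continuous_on T (\<lambda>x. min_act n (f x) (g x))"
  using continuous_on_compose2[OF min_act_cont continuous_on_Pair, of n T f g] by simp

text \<open>A maximum of \<open>x \<mapsto> min_act N x (x + r)\<close> is a periodic point: extending its orbit by one step at both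
  ends gives a differentiable function touching from below. Iterating the periodic orbit and
  comparing with detours through \<open>y\<close> shows that the maximal value is attained at \<open>y\<close> too.\<close>

lemma min_act_translation_const:
  assumes N: "N \<ge> 1" and r: "r \<in> int_lattice"
  shows "min_act N x (x + r) = min_act N y (y + r)"
proof -
  define f where "f x = min_act N x (x + r)" for x
  have fc: "continuous_on UNIV f" unfolding f_def by (intro min_act_cont_comp[OF N] continuous_intros)
  have fper: "f (x + s) = f x" if "s \<in> int_lattice" for x s
    using min_act_per[OF N that, of x "x + r"] by (simp add: f_def algebra_simps)
  have ne: "cbox 0 1 \<noteq> ({} :: (real^'n) set)" by (simp add: interval_ne_empty_cart)
  obtain x1 where x1: "\<And>x. x \<in> cbox 0 1 \<Longrightarrow> f x \<le> f x1"
    using continuous_attains_sup[OF compact_cbox ne continuous_on_subset[OF fc]] by blast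
  have max: "f x \<le> f x1" for x
  proof -
    obtain s where "s \<in> int_lattice" "x - s \<in> cbox 0 1" by (rule exists_lattice_near)
    then show ?thesis using x1[of "x - s"] fper[of s "x - s"] by simp
  qed
  obtain z where z: "fst z = x1" "px N z = x1 + r" "act N z = f x1"
    using orbit_exists[OF N, of x1 "x1 + r"] by (auto simp: f_def)
  obtain w where w: "Fb w = z" by (metis Fb_bij bij_is_surj surjD)
  define a where "a = fst w"
  define b where "b = px (Suc N) z"
  have low: "act (N + 2) w \<le> S a x + f x + S (x + r) b" for x
  proof -
    have "(Fb ^^ (N + 2)) w = (Fb ^^ Suc N) z" by (simp only: w[symmetric] funpow_swap1 funpow.simps(2) o_apply add_2_eq_Suc')
    then have "px (N + 2) w = b" by (simp only: px_def b_def)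
    then have "act (N + 2) w = min_act (1 + Suc N) a b" using min_act_px[of "N + 2" w] by (simp add: a_def)
    also have "\<dots> \<le> min_act 1 a x + min_act (Suc N) x b" by (rule min_act_triangle) auto
    also have "\<dots> \<le> S a x + (f x + S (x + r) b)"
      using min_act_1[of a x] min_act_Suc_le[OF N, of x b "x + r"] by (simp add: f_def)
    finally show ?thesis by simp
  qed
  have "act (N + 2) w = S a x1 + f x1 + S (x1 + r) b"
  proof -
    have "act (1 + Suc N) w = act 1 w + act (Suc N) z" unfolding act_add by (simp add: w)
    also have "act 1 w = S a x1" using w z by (simp add: act_def px_def a_def)
    also have "act (Suc N) z = f x1 + S (x1 + r) b" using z by (simp add: act_Suc b_def)
    finally show ?thesis by simp
  qed
  \<comment> \<open>Both sides of \<open>low\<close> agree at \<open>x1\<close>, where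
    \<open>f\<close> is maximal; dropping \<open>f\<close> leaves a differentiable function of
    \<open>x\<close> that is minimal at \<open>x1\<close>. Its vanishing gradient says that the
    momenta at \<open>x1\<close> and at \<open>x1 + r\<close> coincide.\<close>
  then have min: "S a x1 + S (x1 + r) b \<le> S a x + S (x + r) b" for x
    using low[of x] max[of x] by simp
  have "((\<lambda>x. S (x + r) b) has_derivative (\<lambda>h. S1 (x1 + r) b \<bullet> h)) (at x1)"
    by (rule has_derivative_compose[OF _ S_deriv_fst]) (auto intro!: derivative_eq_intros)
  then have "((\<lambda>x. S a x + S (x + r) b) has_derivative (\<lambda>h. (S2 a x1 + S1 (x1 + r) b) \<bullet> h)) (at x1)"
    unfolding inner_add_left by (intro has_derivative_add S_deriv_snd)
  from gradient_zero_at_min[OF this min] have "S2 a x1 + S1 (x1 + r) b = 0" .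
  moreover have "S2 a x1 = snd z" using Fb_eqs(2)[of w] w z by (simp add: a_def)
  moreover have "S1 (x1 + r) b = - pp N z" using px_Suc_eqs(1)[of N z] z by (simp add: b_def)
  ultimately have "pp N z = snd z" by simp
  then have zN: "(Fb ^^ N) z = z + (r, 0)" using z by (simp add: px_pp prod_eq_iff)
  have iter: "(Fb ^^ (k * N)) z = z + (real k *\<^sub>R r, 0) \<and> act (k * N) z = real k * f x1" for k
  proof (induction k)
    case (Suc k)
    have kr: "real k *\<^sub>R r \<in> int_lattice" by (rule int_lattice_scaleR_of_nat[OF r])
    have "(Fb ^^ (Suc k * N)) z = (Fb ^^ N) (z + (real k *\<^sub>R r, 0))" using Suc by (simp add: funpow_add)
    also have "\<dots> = z + (real (Suc k) *\<^sub>R r, 0)"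
      using Fbn_per[OF kr] zN by (simp add: algebra_simps)
    moreover have "act (Suc k * N) z = act (k * N + N) z" by (simp add: add.commute)
    then have "act (Suc k * N) z = real k * f x1 + act N (z + (real k *\<^sub>R r, 0))"
      unfolding act_add using Suc by simp
    moreover have "act N (z + (real k *\<^sub>R r, 0)) = act N z"
      using act_per[OF kr, of N "fst z" "snd z"] by (cases z) simp
    ultimately show ?case using z by (simp add: algebra_simps)
  qed (simp add: zero_prod_def)
  have up: "min_act (j * N) y (y + real j *\<^sub>R r) \<le> real j * f y" if "j \<ge> 1" for j y
    using that
  proof (induction j rule: nat_induct_at_least)
    case (Suc j)
    have jr: "real j *\<^sub>R r \<in> int_lattice" by (rule int_lattice_scaleR_of_nat[OF r])
    have "min_act (j * N + N) y (y + real (Suc j) *\<^sub>R r)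
        \<le> min_act (j * N) y (y + real j *\<^sub>R r) + min_act N (y + real j *\<^sub>R r) (y + real (Suc j) *\<^sub>R r)"
      using Suc.hyps N by (intro min_act_triangle) auto
    moreover have "min_act N (y + real j *\<^sub>R r) (y + real (Suc j) *\<^sub>R r) = f y"
      using min_act_per[OF N jr, of y "y + r"] by (simp add: f_def algebra_simps)
    ultimately show ?case using Suc.IH by (simp add: algebra_simps)
  qed (simp add: f_def)
  have "f y = f x1" for y
  proof (rule antisym[OF max])
    define C where "C = min_act N x1 (y + r) + min_act N y (x1 + r)"
    \<comment> \<open>The detour from \<open>x1\<close> to
      \<open>x1 + real (j + 2) *\<^sub>R r\<close> goes through \<open>y + r\<close> and
      \<open>y + r + real j *\<^sub>R r\<close>. The two connecting pieces take \<open>N\<close>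
      steps each, whence \<open>j + 2\<close>, and their cost \<open>C\<close> does not depend on
      \<open>j\<close>.\<close>
    have *: "real j * (f x1 - f y) \<le> C - 2 * f x1" if j: "j \<ge> 1" for j
    proof -
      have jr: "real (j + 1) *\<^sub>R r \<in> int_lattice" by (rule int_lattice_scaleR_of_nat[OF r])
      have px: "px ((j + 2) * N) z = x1 + real (j + 2) *\<^sub>R r"
        using iter[of "j + 2"] z by (simp add: px_def)
      have "(j + 2) * N \<ge> 1" using N by simp
      from min_act_px[OF this, of z] have "real (j + 2) * f x1 = min_act ((j + 2) * N) x1 (x1 + real (j + 2) *\<^sub>R r)"
        using iter[of "j + 2"] z px by simp
      also have "\<dots> = min_act (N + (j * N + N)) x1 (x1 + real (j + 2) *\<^sub>R r)" by (simp add: algebra_simps)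
      also have "\<dots> \<le> min_act N x1 (y + r) + min_act (j * N + N) (y + r) (x1 + real (j + 2) *\<^sub>R r)"
        using N by (intro min_act_triangle) auto
      also have "min_act (j * N + N) (y + r) (x1 + real (j + 2) *\<^sub>R r)
          \<le> min_act (j * N) (y + r) (y + r + real j *\<^sub>R r) + min_act N (y + r + real j *\<^sub>R r) (x1 + real (j + 2) *\<^sub>R r)"
        using N j by (intro min_act_triangle) auto
      also have "min_act (j * N) (y + r) (y + r + real j *\<^sub>R r) \<le> real j * f (y + r)" by (rule up[OF j])
      also have "f (y + r) = f y" by (rule fper[OF r])
      also have "min_act N (y + r + real j *\<^sub>R r) (x1 + real (j + 2) *\<^sub>R r) = min_act N y (x1 + r)"
      proof -
        have "real (j + 2) = 1 + real (j + 1)" "real (j + 1) = 1 + real j" by simp_all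
        then have "x1 + real (j + 2) *\<^sub>R r = x1 + r + real (j + 1) *\<^sub>R r"
          "y + r + real j *\<^sub>R r = y + real (j + 1) *\<^sub>R r"
          by (simp_all only: scaleR_add_left scaleR_one add.assoc)
        then show ?thesis using min_act_per[OF N jr, of y "x1 + r"] by (simp only:)
      qed
      finally show ?thesis by (simp add: C_def algebra_simps)
    qed
    show "f x1 \<le> f y"
    proof (rule ccontr)
      assume "\<not> f x1 \<le> f y"
      then have pos: "f x1 - f y > 0" by simp
      obtain j :: nat where "C - 2 * f x1 < real j * (f x1 - f y)"
        using ex_less_of_nat_mult[OF pos] by blast
      also have "\<dots> \<le> real (Suc j) * (f x1 - f y)" using pos by (intro mult_right_mono) auto
      finally show False using *[of "Suc j"] by simp
    qed
  qed
  then show ?thesis unfolding f_def by metis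
qed

text \<open>By \<open>min_act_translation_const\<close> the base point 0 stands for any
  other.\<close>

definition loop_act :: "nat \<Rightarrow> real^'n \<Rightarrow> real" where
  "loop_act N r = min_act N 0 r"

lemma min_act_translation: "N \<ge> 1 \<Longrightarrow> r \<in> int_lattice \<Longrightarrow> min_act N x (x + r) = loop_act N r"
  using min_act_translation_const[of N r x 0] by (simp add: loop_act_def)

end

section \<open>Invariant leaves of every cohomology class\<close>

text \<open>\<open>M\<close> is the size of an \<open>e / 2\<close>-net of the unit cube, so two of
  any \<open>M + 1\<close> points lie near the same net point modulo the lattice. As
  \<open>M\<close> does not depend on the sequence, one window length will serve all orbits.\<close>

lemma torus_pigeonhole:
  fixes e :: real
  assumes "e > 0"
  obtains M :: nat where "\<And>y :: nat \<Rightarrow> real^'n::finite.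
    \<exists>i j s. i < j \<and> j \<le> M \<and> s \<in> int_lattice \<and> norm (y j - y i - s) < e"
proof -
  have "compact (cbox 0 1 :: (real^'n) set)" by simp
  then obtain T :: "(real^'n) set" where T: "finite T" "cbox 0 1 \<subseteq> (\<Union>t\<in>T. ball t (e / 2))"
    using assms unfolding compact_eq_totally_bounded by (meson half_gt_zero)
  show thesis
  proof (rule that[of "card T"])
    fix y :: "nat \<Rightarrow> real^'n"
    have "\<exists>r t. r \<in> int_lattice \<and> t \<in> T \<and> norm (y l - r - t) < e / 2" for l
    proof -
      obtain r where r: "r \<in> int_lattice" "y l - r \<in> cbox 0 1" by (rule exists_lattice_near)
      then obtain t where "t \<in> T" "y l - r \<in> ball t (e / 2)" using T(2) by blast
      then show ?thesis using r(1) by (auto simp: dist_norm norm_minus_commute)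
    qed
    then obtain r t where rt: "\<And>l. r l \<in> int_lattice" "\<And>l. t l \<in> T" "\<And>l. norm (y l - r l - t l) < e / 2"
      by metis
    have "\<not> inj_on t {..card T}"
      using card_inj_on_le[of t "{..card T}" T] T(1) rt(2) by auto
    then obtain i j where ij: "i \<le> card T" "j \<le> card T" "i < j" "t i = t j"
      unfolding inj_on_def by (metis atMost_iff linorder_neqE_nat)
    have "norm (y j - y i - (r j - r i)) = norm ((y j - r j - t j) - (y i - r i - t i))"
      using ij(4) by (simp add: algebra_simps)
    also have "\<dots> < e" using norm_triangle_ineq4[of "y j - r j - t j" "y i - r i - t i"] rt(3)[of i] rt(3)[of j] by simp
    finally show "\<exists>i j s. i < j \<and> j \<le> card T \<and> s \<in> int_lattice \<and> norm (y j - y i - s) < e"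
      using ij rt(1) int_lattice_diff by blast
  qed
qed

text \<open>Compare the expansions at \<open>x\<close> of the steps \<open>h + k\<close> and
  \<open>h\<close> with that at \<open>x + h\<close> of the step \<open>k\<close>, where
  \<open>k\<close> has the length of \<open>h\<close> and the direction of the gradient difference.
  The errors are 4, 1 and 1 times \<open>K * (norm h)\<^sup>2\<close>, whence the factor 6. Steps
  longer than 1/2 are covered by the bound on \<open>g\<close>.\<close>

lemma taylor_gradient_lipschitz:
  fixes f :: "'a::euclidean_space \<Rightarrow> real"
  assumes taylor: "\<And>x h. norm h \<le> 1 \<Longrightarrow> \<bar>f (x + h) - f x - g x \<bullet> h\<bar> \<le> K * (norm h)\<^sup>2"
    and bound: "\<And>x. norm (g x) \<le> K"
  shows "(6 * K)-lipschitz_on UNIV g"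
proof -
  have K: "K \<ge> 0" using bound[of undefined] norm_ge_zero[of "g undefined"] by linarith
  have "norm (g (x + h) - g x) \<le> 6 * K * norm h" for x h
  proof (cases "norm h \<le> 1 / 2")
    case True
    define d where "d = g (x + h) - g x"
    define k where "k = (norm h / norm d) *\<^sub>R d"
    show ?thesis
    proof (cases "d = 0 \<or> h = 0")
      case False
      have nk: "norm k = norm h" using False by (simp add: k_def)
      have "norm (h + k) \<le> 2 * norm h" using norm_triangle_ineq[of h k] nk by simp
      then have hk: "norm (h + k) \<le> 1" "(norm (h + k))\<^sup>2 \<le> (2 * norm h)\<^sup>2"
        using True power_mono[of "norm (h + k)" "2 * norm h" 2] by auto
      have e1: "\<bar>f (x + (h + k)) - f x - g x \<bullet> (h + k)\<bar> \<le> K * (4 * (norm h)\<^sup>2)"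
        using taylor[OF hk(1), of x] mult_left_mono[OF hk(2) K] by (simp add: power_mult_distrib)
      have e2: "\<bar>f (x + h) - f x - g x \<bullet> h\<bar> \<le> K * (norm h)\<^sup>2" using True by (intro taylor) simp
      have e3: "\<bar>f (x + h + k) - f (x + h) - g (x + h) \<bullet> k\<bar> \<le> K * (norm h)\<^sup>2"
        using taylor[of k "x + h"] nk True by simp
      have "d \<bullet> k = g (x + h) \<bullet> k - g x \<bullet> k" by (simp add: d_def inner_diff_left)
      then have "d \<bullet> k \<le> 6 * K * (norm h)\<^sup>2"
        using e1 e2 e3 by (simp add: inner_add_right add.assoc)
      moreover have "d \<bullet> k = norm h * norm d"
        using False by (simp add: k_def power2_norm_eq_inner[symmetric] power2_eq_square)
      ultimately have "norm h * norm d \<le> norm h * (6 * K * norm h)" by (simp add: power2_eq_square mult_ac)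
      then show ?thesis using False by (simp add: d_def)
    qed (auto simp: d_def K)
  next
    case False
    have "norm (g (x + h) - g x) \<le> 2 * K"
      using norm_triangle_ineq4[of "g (x + h)" "g x"] bound[of x] bound[of "x + h"] by simp
    also have "\<dots> = 4 * K * (1 / 2)" by simp
    also have "\<dots> \<le> 4 * K * norm h" using False K by (intro mult_left_mono) auto
    also have "\<dots> \<le> 6 * K * norm h" using K by (intro mult_right_mono) auto
    finally show ?thesis .
  qed
  from this[of _ "_ - _"] show ?thesis
    using K by (auto intro!: lipschitz_onI simp: dist_norm) (metis add_diff_cancel_left' diff_add_cancel add.commute)
qed

context twist_system_nc
begin

text \<open>The tilt adds to the linear term of the quadratic lower bound of \<open>S\<close>, and
  completing the square gives \<open>m\<close>. This makes the infimum in \<open>mean_act\<close>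
  finite.\<close>

lemma tilted_act_lower_bound:
  obtains m where "\<And>n z. act n z - c \<bullet> (px n z - fst z) \<ge> real n * m"
proof -
  define q where "q = bnd 0 + norm c"
  define m where "m = - q\<^sup>2 / (2 * A) - bnd 0"
  have S: "S x y - c \<bullet> (y - x) \<ge> m" for x y
  proof -
    define w where "w = norm (y - x)"
    have "0 \<le> A / 2 * (w - q / A)\<^sup>2" using A_pos by simp
    also have "\<dots> = A / 2 * w\<^sup>2 - q * w + q\<^sup>2 / (2 * A)"
      using A_pos by (simp add: power2_diff field_simps power2_eq_square)
    finally have "A / 2 * w\<^sup>2 - q * w \<ge> - q\<^sup>2 / (2 * A)" by simp
    moreover have "c \<bullet> (y - x) \<le> norm c * w" using norm_cauchy_schwarz by (simp add: w_def)
    ultimately show ?thesis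
      using S_quadratic_lower_bound[of y x] by (simp add: w_def[symmetric] m_def q_def distrib_right)
  qed
  have "act n z - c \<bullet> (px n z - fst z) \<ge> real n * m" for n z
  proof (induction n)
    case (Suc n)
    then show ?case using S[of "px n z" "px (Suc n) z"] by (simp add: act_Suc inner_diff_right algebra_simps)
  qed simp
  then show thesis by (rule that)
qed

text \<open>The negative of Mather's alpha function.\<close>

definition mean_act :: "real^'n \<Rightarrow> real" where
  "mean_act c = (INF w\<in>{1..} \<times> int_lattice. (loop_act (fst w) (snd w) - c \<bullet> snd w) / real (fst w))"

lemma mean_act_bdd: "bdd_below ((\<lambda>w. (loop_act (fst w) (snd w) - c \<bullet> snd w) / real (fst w)) ` ({1..} \<times> int_lattice))"
proof -
  obtain m where m: "\<And>n z. act n z - c \<bullet> (px n z - fst z) \<ge> real n * m"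
    using tilted_act_lower_bound by blast
  have "m \<le> (loop_act N r - c \<bullet> r) / real N" if N: "N \<ge> 1" and r: "r \<in> int_lattice" for N r
  proof -
    obtain z where z: "fst z = 0" "px N z = r" "act N z = min_act N 0 r" using orbit_exists[OF N] by blast
    have "min_act N 0 r = loop_act N r" by (simp add: loop_act_def)
    then show ?thesis using m[of N z] z N by (simp add: field_simps)
  qed
  then show ?thesis by (auto intro!: bdd_belowI2[where m = m])
qed

lemma mean_act_le: "N \<ge> 1 \<Longrightarrow> r \<in> int_lattice \<Longrightarrow> real N * mean_act c \<le> loop_act N r - c \<bullet> r"
  using cINF_lower[OF mean_act_bdd, of "(N, r)" c] by (simp add: mean_act_def field_simps)

lemma mean_act_greatest:
  assumes "\<And>N r. N \<ge> 1 \<Longrightarrow> r \<in> int_lattice \<Longrightarrow> real N * t \<le> loop_act N r - c \<bullet> r"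
  shows "t \<le> mean_act c"
  unfolding mean_act_def
proof (rule cINF_greatest)
  show "{1..} \<times> int_lattice \<noteq> ({} :: (nat \<times> (real^'n)) set)" using zero_int_lattice by auto
  fix w :: "nat \<times> (real^'n)" assume "w \<in> {1..} \<times> int_lattice"
  then show "t \<le> (loop_act (fst w) (snd w) - c \<bullet> snd w) / real (fst w)"
    using assms[of "fst w" "snd w"] by (auto simp: field_simps)
qed

text \<open>An infimum of functions that are affine in the class is concave; continuity follows from
  this.\<close>

lemma mean_act_concave:
  assumes "0 \<le> t" "t \<le> 1"
  shows "(1 - t) * mean_act c + t * mean_act c' \<le> mean_act ((1 - t) *\<^sub>R c + t *\<^sub>R c')"
proof (rule mean_act_greatest)
  fix N r assume Nr: "N \<ge> (1::nat)" "r \<in> (int_lattice :: (real^'n) set)"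
  have "(1 - t) * (real N * mean_act c) + t * (real N * mean_act c') \<le> (1 - t) * (loop_act N r - c \<bullet> r) + t * (loop_act N r - c' \<bullet> r)"
    using mean_act_le[OF Nr] assms by (intro add_mono mult_left_mono) auto
  then show "real N * ((1 - t) * mean_act c + t * mean_act c') \<le> loop_act N r - ((1 - t) *\<^sub>R c + t *\<^sub>R c') \<bullet> r"
    by (simp add: inner_add_left algebra_simps)
qed

lemma mean_act_cont: "continuous_on UNIV mean_act"
proof -
  have "convex_on UNIV (\<lambda>c. - mean_act c)"
  proof (rule convex_onI)
    fix t :: real and c c' assume "0 < t" "t < 1"
    then show "- mean_act ((1 - t) *\<^sub>R c + t *\<^sub>R c') \<le> (1 - t) * - mean_act c + t * - mean_act c'"
      using mean_act_concave[of t c c'] by simp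
  qed simp
  then have "continuous_on UNIV (\<lambda>c. - (- mean_act c))" by (intro continuous_intros convex_on_continuous) auto
  then show ?thesis by simp
qed

text \<open>A critical subsolution of class \<open>c\<close>. The second clause says that
  \<open>U x - c \<bullet> x\<close> is periodic, so a differential of \<open>U\<close> descends to
  a form on the torus with cohomology class \<open>c\<close>.\<close>

definition subsolution :: "real^'n \<Rightarrow> (real^'n \<Rightarrow> real) \<Rightarrow> bool" where
  "subsolution c U \<longleftrightarrow> dominated U (mean_act c) \<and> (\<forall>x. \<forall>r\<in>int_lattice. U (x + r) = U x + c \<bullet> r)"

text \<open>Calibrated pairs are those of excess 0. Along an orbit the potential terms telescope, as
  stated in \<open>act_excess\<close>.\<close>

definition excess :: "real^'n \<Rightarrow> (real^'n \<Rightarrow> real) \<Rightarrow> real^'n \<Rightarrow> real^'n \<Rightarrow> real" where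
  "excess c U x y = S x y - mean_act c - U y + U x"

lemma excess_nonneg: "subsolution c U \<Longrightarrow> 0 \<le> excess c U x y"
  by (simp add: subsolution_def dominated_def excess_def algebra_simps)

lemma excess_per: "subsolution c U \<Longrightarrow> r \<in> int_lattice \<Longrightarrow> excess c U (x + r) (y + r) = excess c U x y"
  by (simp add: subsolution_def excess_def S_per)

lemma subsolution_per: "subsolution c U \<Longrightarrow> r \<in> int_lattice \<Longrightarrow> U (x + r) = U x + c \<bullet> r"
  by (simp add: subsolution_def)

lemma subsolution_add_const: "subsolution c U \<Longrightarrow> subsolution c (\<lambda>x. U x + k)"
  by (simp add: subsolution_def dominated_def)

text \<open>\<open>U y\<close> is the least cost, in tilted action normalized by the critical value,
  of reaching a translate of \<open>y\<close> from 0. It is bounded below because one further step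
  to a lattice point closes the orbit to a loop, and loops have nonnegative cost by the definition
  of \<open>mean_act\<close>.\<close>

lemma subsolution_exists: obtains U where "subsolution c U"
proof -
  define I where "I = {1::nat..} \<times> (int_lattice :: (real^'n) set)"
  define g where "g y w = min_act (fst w) 0 (y + snd w) - c \<bullet> snd w - real (fst w) * mean_act c" for y :: "real^'n" and w
  define U where "U y = (INF w\<in>I. g y w)" for y
  have I: "I \<noteq> {}" using zero_int_lattice by (auto simp: I_def)
  have bdd: "bdd_below (g y ` I)" for y
  proof (rule bdd_belowI2[where m = "mean_act c - S y 0"])
    fix w assume "w \<in> I"
    then obtain N r where w: "w = (N, r)" and Nr: "N \<ge> 1" "r \<in> int_lattice" by (auto simp: I_def)
    have "real (Suc N) * mean_act c \<le> loop_act (Suc N) r - c \<bullet> r" using Nr by (intro mean_act_le) auto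
    also have "loop_act (Suc N) r \<le> min_act N 0 (y + r) + S (y + r) (0 + r)"
      using min_act_Suc_le[OF Nr(1), of 0 r "y + r"] by (simp add: loop_act_def)
    also have "S (y + r) (0 + r) = S y 0" by (rule S_per[OF Nr(2)])
    finally show "mean_act c - S y 0 \<le> g y w" by (simp add: g_def w algebra_simps)
  qed
  have Ule: "U y \<le> g y w" if "w \<in> I" for y w unfolding U_def using that by (rule cINF_lower[OF bdd])
  have Uge: "t \<le> U y" if "\<And>w. w \<in> I \<Longrightarrow> t \<le> g y w" for t y
    unfolding U_def using I that by (rule cINF_greatest)
  have "dominated U (mean_act c)" unfolding dominated_def
  proof (intro allI)
    fix x y
    have "U y + mean_act c - S x y \<le> U x"
    proof (rule Uge)
      fix w assume "w \<in> I"
      then obtain N r where w: "w = (N, r)" and Nr: "N \<ge> 1" "r \<in> int_lattice" by (auto simp: I_def)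
      have "U y \<le> g y (Suc N, r)" by (rule Ule) (use Nr in \<open>auto simp: I_def\<close>)
      also have "\<dots> \<le> g x w + S (x + r) (y + r) - mean_act c"
        using min_act_Suc_le[OF Nr(1), of 0 "y + r" "x + r"] by (simp add: g_def w algebra_simps)
      finally show "U y + mean_act c - S x y \<le> g x w" using S_per[OF Nr(2)] by simp
    qed
    then show "U y - U x + mean_act c \<le> S x y" by simp
  qed
  moreover have "U (x + s) = U x + c \<bullet> s" if s: "s \<in> int_lattice" for x s
  proof -
    have *: "U (x + s) - c \<bullet> s \<le> U x" if s: "s \<in> int_lattice" for x s
    proof (rule Uge)
      fix w assume "w \<in> I"
      then obtain N r where w: "w = (N, r)" and Nr: "N \<ge> 1" "r \<in> int_lattice" by (auto simp: I_def)
      have "U (x + s) \<le> g (x + s) (N, r - s)" by (rule Ule) (use Nr s in \<open>auto simp: I_def int_lattice_diff\<close>)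
      also have "\<dots> = g x w + c \<bullet> s" by (simp add: g_def w inner_diff_right algebra_simps)
      finally show "U (x + s) - c \<bullet> s \<le> g x w" by simp
    qed
    show ?thesis using *[OF s, of x] *[OF int_lattice_uminus[OF s], of "x + s"] by simp
  qed
  ultimately show thesis using that[of U] by (simp add: subsolution_def)
qed

text \<open>Reduce the step modulo the lattice to a vector \<open>v\<close> of the unit cube. Then 1
  is for the excess, \<open>bnd (CARD('n))\<close> for the growth of \<open>U\<close> along
  \<open>v\<close>, and \<open>M * CARD('n)\<close> for \<open>c \<bullet> v\<close>; the slope
  \<open>M\<close> accounts for the tilt along the whole step.\<close>

definition step_radius :: "real \<Rightarrow> real" where
  "step_radius M = step_bound (1 + bnd (CARD('n)) + M * CARD('n)) M"

lemma excess_step: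
  assumes U: "subsolution c U" and c: "norm c \<le> M" and ex: "excess c U x y \<le> 1"
  shows "norm (y - x) \<le> step_radius M"
proof -
  obtain s where s: "s \<in> int_lattice" "(y - x) - s \<in> cbox 0 1" by (rule exists_lattice_near)
  define v where "v = (y - x) - s"
  have v: "norm v \<le> CARD('n)" using norm_cube_le s(2) by (simp add: v_def)
  have "U (x + v) - U x + mean_act c \<le> S x (x + v)" using U by (simp add: subsolution_def dominated_def)
  also have "\<dots> \<le> bnd (CARD('n))" using bnd_S[of "x + v" x "CARD('n)"] v by simp
  finally have "U (x + v) - U x + mean_act c \<le> bnd (CARD('n))" .
  moreover have "U y = U (x + v) + c \<bullet> s"
    using subsolution_per[OF U s(1), of "x + v"] by (simp add: v_def)
  moreover have "c \<bullet> s = c \<bullet> (y - x) - c \<bullet> v" by (simp add: v_def inner_diff_right)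
  moreover have "c \<bullet> (y - x) \<le> M * norm (y - x)"
    using norm_cauchy_schwarz[of c "y - x"] mult_right_mono[OF c, of "norm (y - x)"] by simp
  moreover have "- (c \<bullet> v) \<le> M * CARD('n)"
    using Cauchy_Schwarz_ineq2[of c v] mult_mono[OF c v order.trans[OF norm_ge_zero c] norm_ge_zero] by simp
  ultimately have "S x y \<le> (1 + bnd (CARD('n)) + M * CARD('n)) + M * norm (y - x)"
    using ex by (simp add: excess_def)
  then show ?thesis unfolding step_radius_def by (rule step_bound)
qed

lemma act_excess:
  "act n z - real n * mean_act c - U (px n z) + U (fst z) = (\<Sum>i<n. excess c U (px i z) (px (Suc i) z))"
  by (induction n) (auto simp: act_Suc excess_def algebra_simps)

lemma loop_act_mult:
  assumes "k \<ge> 1" "N \<ge> 1" "r \<in> int_lattice"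
  shows "loop_act (k * N) (real k *\<^sub>R r) \<le> real k * loop_act N r"
  using assms(1)
proof (induction k rule: nat_induct_at_least)
  case (Suc k)
  have kr: "real k *\<^sub>R r \<in> int_lattice" by (rule int_lattice_scaleR_of_nat[OF assms(3)])
  have "min_act (k * N + N) 0 (real k *\<^sub>R r + r) \<le> min_act (k * N) 0 (real k *\<^sub>R r) + min_act N (real k *\<^sub>R r) (real k *\<^sub>R r + r)"
    using Suc.hyps assms(2) by (intro min_act_triangle) auto
  also have "min_act N (real k *\<^sub>R r) (real k *\<^sub>R r + r) = loop_act N r" by (rule min_act_translation[OF assms(2,3)])
  finally show ?case using Suc.IH by (simp add: loop_act_def algebra_simps)
qed simp

text \<open>If all loops had excess at least \<open>\<kappa>\<close>, every orbit segment of a fixed length \<open>M + 1\<close> would have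
  excess at least \<open>\<delta> > 0\<close>, because some subsegment almost closes up on the torus; then \<open>mean_act c\<close>
  could be increased.\<close>

lemma almost_calibrated_loop:
  assumes "\<kappa> > 0"
  obtains N r where "N \<ge> 1" "r \<in> int_lattice" "loop_act N r - c \<bullet> r - real N * mean_act c < \<kappa>"
proof (rule ccontr)
  note loop = that
  assume "\<not> thesis"
  then have big: "\<kappa> \<le> loop_act N r - c \<bullet> r - real N * mean_act c" if "N \<ge> 1" "r \<in> int_lattice" for N r
    using loop[OF that] by force
  obtain U where U: "subsolution c U" by (rule subsolution_exists)
  define R where "R = step_radius (norm c)"
  \<comment> \<open>Closing the subsegment costs at most \<kappa>/8 twice, and the excess of the
    subsegment and that of the step before it are each below \<delta>, which is at most \<kappa>/4.
    The total stays below \<kappa>.\<close>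
  define e where "e = min 1 (\<kappa> / (8 * bnd R))"
  define \<delta> where "\<delta> = min 1 (\<kappa> / 4)"
  have bR: "bnd R \<ge> 1" by (rule bnd_ge1)
  have e: "e > 0" "e \<le> 1" "bnd R * e \<le> \<kappa> / 8"
  proof -
    show "e > 0" "e \<le> 1" using assms bR by (auto simp: e_def)
    have "bnd R * e \<le> bnd R * (\<kappa> / (8 * bnd R))" using bR by (intro mult_left_mono) (auto simp: e_def)
    then show "bnd R * e \<le> \<kappa> / 8" using bR by simp
  qed
  have \<delta>: "\<delta> > 0" "\<delta> \<le> 1" "\<delta> \<le> \<kappa> / 4" using assms by (auto simp: \<delta>_def)
  obtain M where M: "\<And>y :: nat \<Rightarrow> real^'n. \<exists>i j s. i < j \<and> j \<le> M \<and> s \<in> int_lattice \<and> norm (y j - y i - s) < e"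
    using torus_pigeonhole[OF e(1)] by metis
  let ?ex = "\<lambda>z i. excess c U (px i z) (px (Suc i) z)"
  have ex0: "0 \<le> ?ex z i" for z i by (rule excess_nonneg[OF U])
  have window: "\<delta> \<le> (\<Sum>i<Suc M. ?ex z i)" for z
  proof (rule ccontr)
    assume "\<not> ?thesis"
    then have small: "(\<Sum>i<Suc M. ?ex z i) < \<delta>" by simp
    obtain i j s where ij: "i < j" "j \<le> M" and s: "s \<in> int_lattice"
      and close: "norm (px (Suc j) z - px (Suc i) z - s) < e"
      using M[of "\<lambda>l. px (Suc l) z"] by blast
    have part: "sum (?ex z) T < \<delta>" if "T \<subseteq> {..<Suc M}" for T
      using sum_mono2[OF finite_lessThan that, of "?ex z"] ex0[of _ z] small by (auto intro: le_less_trans)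
    have one: "?ex z l < \<delta>" if "l \<le> M" for l
      using part[of "{l}"] that by simp
    have step: "norm (px (Suc l) z - px l z) \<le> R" if "l \<le> M" for l
      using excess_step[OF U order_refl, of "px l z" "px (Suc l) z"] one[OF that] \<delta> by (simp add: R_def)
    define h where "h = px (Suc i) z + s - px (Suc j) z"
    have h: "norm h < e" using close by (simp add: h_def norm_minus_commute algebra_simps)
    then have h1: "norm h \<le> 1" "norm (- h) \<le> 1" using e by auto
    have bh: "bnd R * norm h \<le> \<kappa> / 8"
    proof -
      have "bnd R * norm h \<le> bnd R * e" using h bR by (intro mult_left_mono) auto
      then show ?thesis using e(3) by linarith
    qed
    define m where "m = j - i"
    define w where "w = (Fb ^^ Suc i) z"
    have m: "m \<ge> 1" "m = Suc (m - 1)" "Suc i + m = Suc j" "Suc i + (m - 1) = j" using ij by (auto simp: m_def)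
    have fw: "fst w = px (Suc i) z" by (simp add: w_def px_def)
    have pw: "px l w = px (Suc i + l) z" for l unfolding w_def by (simp only: px_add)
    have exw: "(\<Sum>l<m. ?ex w l) < \<delta>"
    proof -
      have "(\<Sum>l<m. ?ex w l) = (\<Sum>l<m. ?ex z (Suc i + l))" using pw by simp
      also have "\<dots> = sum (?ex z) ((\<lambda>l. Suc i + l) ` {..<m})"
        by (subst sum.reindex) (auto simp: inj_on_def)
      also have "\<dots> < \<delta>" using ij by (intro part) (auto simp: m_def)
      finally show ?thesis .
    qed
    have "loop_act m s = min_act (Suc (m - 1)) (fst w) (px (Suc i) z + s)"
      using min_act_translation[OF m(1) s, of "px (Suc i) z"] m(2) fw by simp
    also have "\<dots> \<le> act (m - 1) w + S (px (m - 1) w) (px (Suc i) z + s)" by (rule min_act_le)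
    also have "px (m - 1) w = px j z" using pw m(4) by simp
    also have "S (px j z) (px (Suc i) z + s) \<le> S (px j z) (px (Suc j) z) + bnd R * norm h"
      using S_lipschitz2[OF step[of j] h1(1)] ij by (simp add: h_def)
    also have "act (m - 1) w + (S (px j z) (px (Suc j) z) + bnd R * norm h) = act m w + bnd R * norm h"
      using act_Suc[of "m - 1" w] m pw by simp
    also have "act m w = real m * mean_act c + U (px (Suc j) z) - U (px (Suc i) z) + (\<Sum>l<m. ?ex w l)"
      using act_excess[of m w c U] fw pw[of m] m(3) by simp
    finally have b1: "loop_act m s \<le> real m * mean_act c + U (px (Suc j) z) - U (px (Suc i) z) + (\<Sum>l<m. ?ex w l) + bnd R * norm h"
      by simp
    \<comment> \<open>A Lipschitz bound for \<open>U\<close> will only follow from this lemma. The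
      potential at the two nearby end points is therefore compared through the step that precedes
      the subsegment, translated by \<open>s\<close>; this is why the pigeonhole was applied to
      positions shifted by one.\<close>
    have "U (px (Suc j) z) - U (px i z + s) + mean_act c \<le> S (px i z + s) (px (Suc j) z)"
      using U by (simp add: subsolution_def dominated_def)
    also have "\<dots> = S (px i z + s) (px (Suc i) z - h + s)" by (simp add: h_def)
    also have "\<dots> = S (px i z) (px (Suc i) z - h)" by (rule S_per[OF s])
    also have "\<dots> \<le> S (px i z) (px (Suc i) z) + bnd R * norm h"
      using S_lipschitz2[OF step[of i] h1(2)] ij by simp
    finally have b2: "U (px (Suc j) z) \<le> c \<bullet> s + U (px (Suc i) z) + ?ex z i + bnd R * norm h"
      using subsolution_per[OF U s, of "px i z"] by (simp add: excess_def)
    have "loop_act m s - c \<bullet> s - real m * mean_act c < \<kappa>"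
      using b1 b2 exw one[of i] ij bh \<delta> assms by simp
    then show False using big[OF m(1) s] by simp
  qed
  have long: "real (Suc M * k) * mean_act c + U (px (Suc M * k) z) - U (fst z) + real k * \<delta> \<le> act (Suc M * k) z" for k z
  proof (induction k)
    case (Suc k)
    define w where "w = (Fb ^^ (Suc M * k)) z"
    have "Suc M * Suc k = Suc M * k + Suc M" by simp
    then have a: "act (Suc M * Suc k) z = act (Suc M * k) z + act (Suc M) w"
      "px (Suc M * Suc k) z = px (Suc M) w"
      unfolding w_def by (simp_all only: act_add px_add)
    have "fst w = px (Suc M * k) z" by (simp add: w_def px_def)
    then have "act (Suc M) w \<ge> real (Suc M) * mean_act c + U (px (Suc M) w) - U (px (Suc M * k) z) + \<delta>"
      using act_excess[of "Suc M" w c U] window[of w] by simp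
    then have "act (Suc M * Suc k) z \<ge> (real (Suc M * k) * mean_act c + real (Suc M) * mean_act c) + U (px (Suc M * Suc k) z) - U (fst z) + (real k * \<delta> + \<delta>)"
      unfolding a using Suc by linarith
    moreover have "real (Suc M * k) * mean_act c + real (Suc M) * mean_act c = real (Suc M * Suc k) * mean_act c"
      "real k * \<delta> + \<delta> = real (Suc k) * \<delta>" by (simp_all add: algebra_simps)
    ultimately show ?case by simp
  qed simp
  \<comment> \<open>Repeating a loop \<open>Suc M\<close> times makes its length a multiple of the
    window length. The minimizing orbit with the same end points contains \<open>N\<close> windows,
    so the gain per step is \<delta> divided by \<open>Suc M\<close>.\<close>
  have "mean_act c + \<delta> / real (Suc M) \<le> mean_act c"
  proof (rule mean_act_greatest)
    fix N r assume Nr: "N \<ge> (1::nat)" "r \<in> (int_lattice :: (real^'n) set)"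
    define r' where "r' = real (Suc M) *\<^sub>R r"
    have r': "r' \<in> int_lattice" unfolding r'_def by (rule int_lattice_scaleR_of_nat[OF Nr(2)])
    have "Suc M * N \<ge> 1" using Nr by simp
    then obtain z where z: "fst z = 0" "px (Suc M * N) z = r'" "act (Suc M * N) z = min_act (Suc M * N) 0 r'"
      using orbit_exists by blast
    have "real (Suc M * N) * mean_act c + U r' - U 0 + real N * \<delta> \<le> loop_act (Suc M * N) r'"
      using long[of N z] z by (simp add: loop_act_def)
    also have "\<dots> \<le> real (Suc M) * loop_act N r" unfolding r'_def using Nr by (intro loop_act_mult) auto
    finally have "real (Suc M * N) * mean_act c + c \<bullet> r' + real N * \<delta> \<le> real (Suc M) * loop_act N r"
      using subsolution_per[OF U r', of 0] by simp
    moreover have "c \<bullet> r' = real (Suc M) * (c \<bullet> r)" by (simp only: r'_def inner_scaleR_right)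
    moreover have "real (Suc M) * (real N * (mean_act c + \<delta> / real (Suc M)))
        = real (Suc M * N) * mean_act c + real N * \<delta> * (real (Suc M) / real (Suc M))"
      by (simp only: of_nat_mult distrib_left times_divide_eq_right mult_ac)
    ultimately have "real (Suc M) * (real N * (mean_act c + \<delta> / real (Suc M))) \<le> real (Suc M) * (loop_act N r - c \<bullet> r)"
      by (simp only: right_diff_distrib) simp
    then show "real N * (mean_act c + \<delta> / real (Suc M)) \<le> loop_act N r - c \<bullet> r"
      by (rule mult_left_le_imp_le) simp
  qed
  then show False using \<delta> by (simp add: field_simps)
qed

text \<open>Since the loop action is independent of the base point, an almost calibrated loop can be
  placed through \<open>x\<close>; \<open>y\<close> and \<open>w\<close> are its neighbours there.
  The total excess of the loop is the same for every subsolution, so one choice of \<open>y\<close>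
  and \<open>w\<close> serves all \<open>U\<close>.\<close>

lemma almost_calibrated:
  assumes "\<kappa> > 0"
  obtains y w where "\<And>U. subsolution c U \<Longrightarrow> excess c U x y < \<kappa>" "\<And>U. subsolution c U \<Longrightarrow> excess c U w x < \<kappa>"
proof -
  obtain N r where N: "N \<ge> 1" and r: "r \<in> int_lattice" and E: "loop_act N r - c \<bullet> r - real N * mean_act c < \<kappa>"
    using almost_calibrated_loop[OF assms] by metis
  obtain z where z: "fst z = x" "px N z = x + r" "act N z = min_act N x (x + r)" using orbit_exists[OF N] by blast
  have sum: "(\<Sum>i<N. excess c U (px i z) (px (Suc i) z)) < \<kappa>" if U: "subsolution c U" for U
    using act_excess[of N z c U] z E min_act_translation[OF N r, of x] subsolution_per[OF U r, of x] by simp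
  have one: "excess c U (px i z) (px (Suc i) z) < \<kappa>" if U: "subsolution c U" and "i < N" for U i
    using sum_mono2[of "{..<N}" "{i}" "\<lambda>i. excess c U (px i z) (px (Suc i) z)"]
      excess_nonneg[OF U] sum[OF U] that(2) by fastforce
  show thesis
  proof (rule that[of "px 1 z" "px (N - 1) z - r"])
    fix U assume U: "subsolution c U"
    show "excess c U x (px 1 z) < \<kappa>" using one[OF U, of 0] N z by simp
    have "Suc (N - 1) = N" using N by simp
    then have "excess c U (px (N - 1) z) (x + r) < \<kappa>" using one[OF U, of "N - 1"] N z by simp
    then show "excess c U (px (N - 1) z - r) x < \<kappa>"
      using excess_per[OF U r, of "px (N - 1) z - r" x] by simp
  qed
qed

text \<open>An almost calibrated predecessor \<open>w\<close> of \<open>x\<close> bounds the growth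
  of \<open>U\<close> from \<open>x\<close> by that of \<open>S w\<close>; exchanging the end points
  gives the other side.\<close>

lemma subsolution_local_lipschitz:
  assumes U: "subsolution c U" and h: "norm h \<le> 1"
  shows "\<bar>U (x + h) - U x\<bar> \<le> bnd (step_radius (norm c)) * norm h"
proof -
  have *: "U (x + h) - U x \<le> bnd (step_radius (norm c)) * norm h" if h: "norm h \<le> 1" for x h
  proof (rule field_le_epsilon)
    fix e :: real assume "e > 0"
    then have "min e 1 > 0" by simp
    then obtain w where w: "excess c U w x < min e 1" using almost_calibrated[of "min e 1" c x] U by metis
    have "norm (x - w) \<le> step_radius (norm c)" using w by (intro excess_step[OF U order_refl]) simp
    then have "S w (x + h) \<le> S w x + bnd (step_radius (norm c)) * norm h"
      using S_lipschitz2[OF _ h, of x w] by force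
    moreover have "excess c U w (x + h) \<ge> 0" by (rule excess_nonneg[OF U])
    ultimately show "U (x + h) - U x \<le> bnd (step_radius (norm c)) * norm h + e"
      using w by (simp add: excess_def)
  qed
  show ?thesis using *[OF h, of x] *[of "- h" "x + h"] h by simp
qed

lemma subsolution_cont:
  assumes "subsolution c U"
  shows "continuous_on UNIV U"
proof -
  define L where "L = bnd (step_radius (norm c))"
  have L: "L \<ge> 1" unfolding L_def by (rule bnd_ge1)
  have "isCont U x" for x
  proof -
    have "((\<lambda>y. L * norm (y - x)) \<longlongrightarrow> L * norm (x - x)) (at x)" by (intro tendsto_intros)
    then have "((\<lambda>y. L * norm (y - x)) \<longlongrightarrow> 0) (at x)" by simp
    moreover have "\<forall>\<^sub>F y in at x. norm (U y - U x) \<le> L * norm (y - x)"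
      unfolding eventually_at
      using subsolution_local_lipschitz[OF assms, of "_ - x" x]
      by (intro exI[of _ 1]) (auto simp: dist_norm L_def)
    ultimately have "((\<lambda>y. U y - U x) \<longlongrightarrow> 0) (at x)" by (rule Lim_null_comparison[rotated])
    then show ?thesis by (simp add: isCont_def LIM_zero_iff)
  qed
  then show ?thesis by (simp add: continuous_at_imp_continuous_on)
qed

text \<open>Limits of almost calibrated neighbours, which stay bounded by
  \<open>excess_step\<close>. They are chosen before \<open>U\<close> and hence are calibrated for
  all subsolutions of the class.\<close>

lemma calibrated_exists:
  obtains y w where "\<And>U. subsolution c U \<Longrightarrow> excess c U x y = 0" "\<And>U. subsolution c U \<Longrightarrow> excess c U w x = 0"
proof -
  obtain U0 where U0: "subsolution c U0" by (rule subsolution_exists)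
  define R where "R = step_radius (norm c)"
  have "\<exists>q. \<forall>U. subsolution c U \<longrightarrow> excess c U x (fst q) < 1 / real (Suc k) \<and> excess c U (snd q) x < 1 / real (Suc k)" for k
    using almost_calibrated[of "1 / real (Suc k)" c x] by (metis fst_conv snd_conv of_nat_0_less_iff zero_less_Suc zero_less_divide_1_iff)
  then obtain q where q: "\<And>k U. subsolution c U \<Longrightarrow> excess c U x (fst (q k)) < 1 / real (Suc k)"
    "\<And>k U. subsolution c U \<Longrightarrow> excess c U (snd (q k)) x < 1 / real (Suc k)" by metis
  have "norm (fst (q k) - x) \<le> R" "norm (x - snd (q k)) \<le> R" for k
    unfolding R_def using q[OF U0, of k] divide_le_eq_1[of 1 "real (Suc k)"]
    by (auto intro!: excess_step[OF U0 order_refl] elim!: order.trans[OF less_imp_le])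
  then have "q k \<in> cball x R \<times> cball x R" for k
    by (auto simp: dist_norm mem_Times_iff norm_minus_commute)
  moreover have "compact (cball x R \<times> cball x R)" by (intro compact_Times) auto
  ultimately obtain l r where r: "strict_mono r" "(q \<circ> r) \<longlonglongrightarrow> l" unfolding compact_def by metis
  have lim: "(\<lambda>k. fst (q (r k))) \<longlonglongrightarrow> fst l" "(\<lambda>k. snd (q (r k))) \<longlonglongrightarrow> snd l"
    using tendsto_fst[OF r(2)] tendsto_snd[OF r(2)] by (auto simp: o_def)
  have lim0: "(\<lambda>k. 1 / real (Suc (r k))) \<longlonglongrightarrow> 0"
    using LIMSEQ_subseq_LIMSEQ[OF LIMSEQ_inverse_real_of_nat r(1)] by (simp add: o_def inverse_eq_divide)
  show thesis
  proof (rule that[of "fst l" "snd l"])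
    fix U assume U: "subsolution c U"
    note Uc = continuous_on_tendsto_compose[OF subsolution_cont[OF U]]
    have "(\<lambda>k. excess c U x (fst (q (r k)))) \<longlonglongrightarrow> excess c U x (fst l)"
      unfolding excess_def by (intro tendsto_intros lim Uc) auto
    then have "excess c U x (fst l) \<le> 0"
      by (rule LIMSEQ_le[OF _ lim0]) (use q(1)[OF U] less_imp_le in blast)
    then show "excess c U x (fst l) = 0" using excess_nonneg[OF U] by (simp add: antisym)
    have "(\<lambda>k. excess c U (snd (q (r k))) x) \<longlonglongrightarrow> excess c U (snd l) x"
      unfolding excess_def by (intro tendsto_intros lim Uc) auto
    then have "excess c U (snd l) x \<le> 0"
      by (rule LIMSEQ_le[OF _ lim0]) (use q(2)[OF U] less_imp_le in blast)
    then show "excess c U (snd l) x = 0" using excess_nonneg[OF U] by (simp add: antisym)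
  qed
qed

text \<open>A successor calibrated for all subsolutions at once makes the momentum a function of the
  class alone.\<close>

definition leaf_mom :: "real^'n \<Rightarrow> real^'n \<Rightarrow> real^'n" where
  "leaf_mom c x = - S1 x (SOME y. \<forall>U. subsolution c U \<longrightarrow> excess c U x y = 0)"

text \<open>The middle point of a calibrated chain \<open>w\<close>, \<open>x\<close>,
  \<open>y\<close> minimizes the action of the chain with fixed ends, so there is no corner at
  \<open>x\<close>.\<close>

lemma calibrated_momenta:
  assumes U: "subsolution c U" and w: "excess c U w x = 0" and y: "excess c U x y = 0"
  shows "S2 w x = - S1 x y"
proof -
  have "((\<lambda>x. S w x + S x y) has_derivative (\<lambda>h. (S2 w x + S1 x y) \<bullet> h)) (at x)"
    unfolding inner_add_left by (intro has_derivative_add S_deriv_fst S_deriv_snd)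
  moreover have "S w x + S x y \<le> S w x' + S x' y" for x'
    using w y excess_nonneg[OF U, of w x'] excess_nonneg[OF U, of x' y] by (simp add: excess_def)
  ultimately have "S2 w x + S1 x y = 0" by (rule gradient_zero_at_min)
  then show ?thesis by (simp add: eq_neg_iff_add_eq_0)
qed

text \<open>Every calibrated predecessor matches every calibrated successor, so all of them
  determine the same vector; two successors are compared through the predecessor
  \<open>w0\<close>.\<close>

lemma leaf_mom_eqs:
  assumes U: "subsolution c U"
  shows "excess c U x y = 0 \<Longrightarrow> leaf_mom c x = - S1 x y" and "excess c U w x = 0 \<Longrightarrow> leaf_mom c x = S2 w x"
proof -
  obtain y0 w0 where y0: "\<And>U. subsolution c U \<Longrightarrow> excess c U x y0 = 0"
    and w0: "\<And>U. subsolution c U \<Longrightarrow> excess c U w0 x = 0" using calibrated_exists[of c x] by metis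
  define y1 where "y1 = (SOME y. \<forall>U. subsolution c U \<longrightarrow> excess c U x y = 0)"
  have "\<forall>U. subsolution c U \<longrightarrow> excess c U x y1 = 0"
    unfolding y1_def by (rule someI[of _ y0]) (use y0 in blast)
  then have y1: "excess c U x y1 = 0" using U by blast
  have leaf_mom: "leaf_mom c x = - S1 x y1" by (simp add: leaf_mom_def y1_def)
  show "leaf_mom c x = S2 w x" if "excess c U w x = 0"
    using calibrated_momenta[OF U that y1] leaf_mom by simp
  show "leaf_mom c x = - S1 x y" if "excess c U x y = 0"
    using calibrated_momenta[OF U w0[OF U] y1] calibrated_momenta[OF U w0[OF U] that] leaf_mom by simp
qed

text \<open>A calibrated predecessor of \<open>x\<close> bounds \<open>U (x + h)\<close> from above
  and a calibrated successor bounds it from below, both with slope \<open>leaf_mom c x\<close> and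
  quadratic error.\<close>

lemma subsolution_taylor:
  assumes U: "subsolution c U" and c: "norm c \<le> M" and h: "norm h \<le> 1"
  shows "\<bar>U (x + h) - U x - leaf_mom c x \<bullet> h\<bar> \<le> bnd (step_radius M) * (norm h)\<^sup>2"
proof -
  obtain y w where y: "excess c U x y = 0" and w: "excess c U w x = 0"
    using calibrated_exists[of c x] U by metis
  have R: "norm (y - x) \<le> step_radius M" "norm (x - w) \<le> step_radius M"
    using y w by (auto intro!: excess_step[OF U c])
  have "excess c U w (x + h) \<ge> 0" "excess c U (x + h) y \<ge> 0" by (auto intro: excess_nonneg[OF U])
  then show ?thesis
    using taylor1[OF R(1) h] taylor2[OF R(2) h] y w leaf_mom_eqs(1)[OF U y] leaf_mom_eqs(2)[OF U w]
    by (simp add: excess_def)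
qed

lemma subsolution_deriv: "subsolution c U \<Longrightarrow> (U has_derivative (\<lambda>h. leaf_mom c x \<bullet> h)) (at x)"
  by (rule has_derivative_quadratic[OF subsolution_taylor[OF _ order_refl]])

lemma leaf_mom_bounded:
  assumes "norm c \<le> M"
  shows "norm (leaf_mom c x) \<le> bnd (step_radius M)"
proof -
  obtain U where U: "subsolution c U" by (rule subsolution_exists)
  obtain y where y: "excess c U x y = 0" using calibrated_exists[of c x] U by metis
  have "norm (y - x) \<le> step_radius M" using y by (intro excess_step[OF U assms]) simp
  then show ?thesis using leaf_mom_eqs(1)[OF U y] bnd_S1 by simp
qed

lemma leaf_mom_lipschitz: "\<exists>K. K-lipschitz_on UNIV (leaf_mom c)"
proof -
  obtain U where U: "subsolution c U" by (rule subsolution_exists)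
  show ?thesis
    using taylor_gradient_lipschitz[OF subsolution_taylor[OF U order_refl] leaf_mom_bounded[OF order_refl]] by blast
qed

lemma leaf_mom_per: "r \<in> int_lattice \<Longrightarrow> leaf_mom c (x + r) = leaf_mom c x"
proof -
  assume r: "r \<in> int_lattice"
  obtain U where U: "subsolution c U" by (rule subsolution_exists)
  obtain y where y: "excess c U x y = 0" using calibrated_exists[of c x] U by metis
  have "excess c U (x + r) (y + r) = 0" using excess_per[OF U r] y by simp
  then show ?thesis using leaf_mom_eqs(1)[OF U] y S1_per[OF r] by simp
qed

lemma leaf_mom_calibrated:
  assumes U: "subsolution c U"
  shows "excess c U x (fst (Fb (x, leaf_mom c x))) = 0"
proof -
  obtain y where y: "excess c U x y = 0" using calibrated_exists[of c x] U by metis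
  then show ?thesis using leaf_mom_eqs(1)[OF U y] Fb_eqI[of x y] by simp
qed

text \<open>For the converse, the calibrated predecessor of \<open>y\<close> arrives with the same
  momentum as \<open>x\<close> does, and therefore is \<open>x\<close> by
  \<open>S2_inj\<close>.\<close>

lemma leaf_mom_invariant: "q = leaf_mom c x \<longleftrightarrow> snd (Fb (x, q)) = leaf_mom c (fst (Fb (x, q)))"
proof -
  obtain U where U: "subsolution c U" by (rule subsolution_exists)
  define y where "y = fst (Fb (x, q))"
  have q: "q = - S1 x y" "snd (Fb (x, q)) = S2 x y"
    using Fb_eqs[of "(x, q)"] by (simp_all add: y_def)
  show ?thesis
  proof
    assume "q = leaf_mom c x"
    then have "excess c U x y = 0" using leaf_mom_calibrated[OF U] by (simp add: y_def)
    then show "snd (Fb (x, q)) = leaf_mom c (fst (Fb (x, q)))" using leaf_mom_eqs(2)[OF U] q(2) by (simp add: y_def)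
  next
    assume "snd (Fb (x, q)) = leaf_mom c (fst (Fb (x, q)))"
    then have *: "S2 x y = leaf_mom c y" using q(2) by (simp add: y_def)
    obtain w where w: "excess c U w y = 0" using calibrated_exists[of c y] U by metis
    then have "S2 w y = S2 x y" using leaf_mom_eqs(2)[OF U w] * by simp
    then have "w = x" by (rule S2_inj)
    then show "q = leaf_mom c x" using leaf_mom_eqs(1)[OF U] w q by simp
  qed
qed

lemma leaf_mom_leaf:
  assumes "subsolution c U"
  shows "invariant_leaf U (leaf_mom c)"
proof -
  have "bounded (range (leaf_mom c))" unfolding bounded_iff using leaf_mom_bounded[OF order_refl] by blast
  then show ?thesis
    unfolding invariant_leaf_def using subsolution_deriv[OF assms] leaf_mom_lipschitz leaf_mom_invariant by blast
qed

end

text \<open>The nested \<open>SUP\<close> and \<open>INF\<close> form the lower limit as a real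
  number; boundedness keeps them from being default values. Lower limits of potentials inherit
  inequalities without the choice of a convergent subsequence.\<close>

lemma lower_limit_mono:
  fixes f g :: "nat \<Rightarrow> real"
  assumes f: "\<And>k. \<bar>f k\<bar> \<le> B" and g: "\<And>k. \<bar>g k\<bar> \<le> B"
    and le: "\<forall>\<^sub>F k in sequentially. f k \<le> g k + d"
  shows "(SUP n. INF k\<in>{n..}. f k) \<le> (SUP n. INF k\<in>{n..}. g k) + d"
proof -
  obtain K where K: "\<And>k. k \<ge> K \<Longrightarrow> f k \<le> g k + d" using le by (auto simp: eventually_sequentially)
  have bddf: "bdd_below (f ` T)" and bddg: "bdd_below (g ` T)" for T
    using f g by (auto intro!: bdd_belowI2[where m = "- B"] simp: abs_le_iff minus_le_iff)
  have "(INF k\<in>{n..}. g k) \<le> B" for n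
    using cINF_lower[OF bddg, of n "{n..}"] g[of n] by (simp add: abs_le_iff)
  then have bdd: "bdd_above (range (\<lambda>n. INF k\<in>{n..}. g k))" by (auto intro!: bdd_aboveI2)
  show ?thesis
  proof (rule cSUP_least)
    fix n
    have "(INF k\<in>{n..}. f k) - d \<le> (INF k\<in>{max n K..}. g k)"
    proof (rule cINF_greatest)
      fix k assume k: "k \<in> {max n K..}"
      have "(INF k\<in>{n..}. f k) \<le> f k" using k by (intro cINF_lower[OF bddf]) auto
      then show "(INF k\<in>{n..}. f k) - d \<le> g k" using K[of k] k by simp
    qed auto
    also have "\<dots> \<le> (SUP n. INF k\<in>{n..}. g k)" by (rule cSUP_upper[OF UNIV_I bdd])
    finally show "(INF k\<in>{n..}. f k) \<le> (SUP n. INF k\<in>{n..}. g k) + d" by simp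
  qed simp
qed

lemma lower_limit_eq_lim:
  fixes f :: "nat \<Rightarrow> real"
  assumes "f \<longlonglongrightarrow> l"
  shows "(SUP n. INF k\<in>{n..}. f k) = l"
proof -
  have "Bseq f" using assms by (intro convergent_imp_Bseq convergentI)
  then obtain B where B: "\<And>k. \<bar>f k\<bar> \<le> B" unfolding Bseq_def by auto
  have c: "(SUP n::nat. INF k\<in>{n..}. (l :: real)) = l" by simp
  have "(SUP n. INF k\<in>{n..}. f k) \<le> l + e" "l \<le> (SUP n. INF k\<in>{n..}. f k) + e" if "e > 0" for e
  proof -
    have ev: "\<forall>\<^sub>F k in sequentially. dist (f k) l < e" using assms that by (rule tendstoD)
    have "\<forall>\<^sub>F k in sequentially. f k \<le> l + e" "\<forall>\<^sub>F k in sequentially. l \<le> f k + e"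
      using ev by (auto elim!: eventually_mono simp: dist_real_def)
    then show "(SUP n. INF k\<in>{n..}. f k) \<le> l + e" "l \<le> (SUP n. INF k\<in>{n..}. f k) + e"
      using lower_limit_mono[of f "max B \<bar>l\<bar>" "\<lambda>_. l" e] lower_limit_mono[of "\<lambda>_. l" "max B \<bar>l\<bar>" f e] B c
      by (auto simp: le_max_iff_disj)
  qed
  then show ?thesis by (meson antisym field_le_epsilon)
qed

context twist_system_nc
begin

lemma subsolution_deviation:
  assumes U: "subsolution c U"
  obtains C where "\<And>x y. \<bar>U y - U x - c \<bullet> (y - x)\<bar> \<le> C"
proof -
  define u where "u x = U x - c \<bullet> x" for x
  have uc: "continuous_on UNIV u" unfolding u_def by (intro continuous_intros subsolution_cont[OF U])
  have "bounded (u ` cbox 0 1)"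
    by (intro compact_imp_bounded compact_continuous_image continuous_on_subset[OF uc]) auto
  then obtain C where C: "\<And>x. x \<in> cbox 0 1 \<Longrightarrow> \<bar>u x\<bar> \<le> C" unfolding bounded_iff by auto
  have "\<bar>u x\<bar> \<le> C" for x
  proof -
    obtain r where r: "r \<in> int_lattice" "x - r \<in> cbox 0 1" by (rule exists_lattice_near)
    have "u x = u (x - r)"
      using subsolution_per[OF U r(1), of "x - r"] by (simp add: u_def inner_diff_right)
    then show ?thesis using C[OF r(2)] by simp
  qed
  then have "\<bar>U y - U x - c \<bullet> (y - x)\<bar> \<le> C + C" for x y
    using abs_triangle_ineq4[of "u y" "u x"] add_mono[of "\<bar>u y\<bar>" C "\<bar>u x\<bar>" C]
    by (simp add: u_def inner_diff_right algebra_simps)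
  then show thesis by (rule that)
qed

lemma leaf_mom_leaf_act:
  assumes U: "subsolution c U" and z: "snd z = leaf_mom c (fst z)"
  shows "act n z = U (px n z) - U (fst z) + real n * mean_act c"
proof (rule leaf_act[OF leaf_mom_leaf[OF U] z])
  fix w assume "snd w = leaf_mom c (fst w)"
  then have "w = (fst w, leaf_mom c (fst w))" by (simp add: prod_eq_iff)
  then have "excess c U (fst w) (fst (Fb w)) = 0" using leaf_mom_calibrated[OF U, of "fst w"] by simp
  then show "S (fst w) (fst (Fb w)) = U (fst (Fb w)) - U (fst w) + mean_act c" by (simp add: excess_def)
qed

text \<open>A common point of two leaves has a common orbit, which forces \<open>mean_act\<close> to be affine between the
  classes. The mean of the two potentials is then a subsolution of the mean class, and its
  calibrated pairs are calibrated for both leaves.\<close>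

lemma leaf_mom_inj:
  assumes eq: "leaf_mom c x = leaf_mom c' x"
  shows "c = c'"
proof -
  obtain U where U: "subsolution c U" by (rule subsolution_exists)
  obtain U' where U': "subsolution c' U'" by (rule subsolution_exists)
  define h where "h = (1 - 1/2) *\<^sub>R c + (1/2) *\<^sub>R c'"
  obtain W where W: "subsolution h W" by (rule subsolution_exists)
  obtain C where C: "\<And>x y. \<bar>U y - U x - c \<bullet> (y - x)\<bar> \<le> C" using subsolution_deviation[OF U] by blast
  obtain C' where C': "\<And>x y. \<bar>U' y - U' x - c' \<bullet> (y - x)\<bar> \<le> C'" using subsolution_deviation[OF U'] by blast
  obtain C'' where C'': "\<And>x y. \<bar>W y - W x - h \<bullet> (y - x)\<bar> \<le> C''" using subsolution_deviation[OF W] by blast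
  have h: "h \<bullet> v = (c \<bullet> v + c' \<bullet> v) / 2" for v by (simp add: h_def inner_add_left)
  define z where "z = (x, leaf_mom c x)"
  have act: "act n z = U (px n z) - U x + real n * mean_act c" for n
    using leaf_mom_leaf_act[OF U, of z n] by (simp add: z_def)
  have act': "act n z = U' (px n z) - U' x + real n * mean_act c'" for n
    using leaf_mom_leaf_act[OF U', of z n] eq by (simp add: z_def)
  \<comment> \<open>On the common orbit both potentials give the action exactly, while
    \<open>W\<close> only bounds it from below. All potentials deviate boundedly from linear maps
    and the linear parts cancel, so the left side stays bounded in \<open>n\<close>.\<close>
  have "real n * (mean_act h - (mean_act c + mean_act c') / 2) \<le> C'' + (C + C') / 2" for n
  proof -
    have "W (px n z) - W x + real n * mean_act h \<le> act n z"
      using dominated_act[of W "mean_act h" n z] W by (simp add: subsolution_def z_def)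
    then have "W (px n z) - W x + real n * mean_act h \<le>
        (U (px n z) - U x + real n * mean_act c + (U' (px n z) - U' x + real n * mean_act c')) / 2"
      using act[of n] act'[of n] by simp
    then show ?thesis
      using C[of "px n z" x] C'[of "px n z" x] C''[of "px n z" x] h[of "px n z - x"]
      by (simp add: abs_le_iff field_simps)
  qed
  then have "mean_act h \<le> (mean_act c + mean_act c') / 2"
    by (metis (no_types) ex_less_of_nat_mult diff_gt_0_iff_gt not_le)
  moreover have "(mean_act c + mean_act c') / 2 \<le> mean_act h" using mean_act_concave[of "1/2" c c'] by (simp add: h_def)
  ultimately have ah: "mean_act h = (mean_act c + mean_act c') / 2" by simp
  define Z where "Z y = (U y + U' y) / 2" for y
  have Z: "subsolution h Z"
    unfolding subsolution_def dominated_def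
  proof (intro conjI allI ballI)
    fix y w
    show "Z w - Z y + mean_act h \<le> S y w"
      using excess_nonneg[OF U, of y w] excess_nonneg[OF U', of y w] by (simp add: Z_def ah excess_def field_simps)
    fix r :: "real^'n" assume r: "r \<in> int_lattice"
    show "Z (y + r) = Z y + h \<bullet> r"
      unfolding Z_def subsolution_per[OF U r] subsolution_per[OF U' r] h by (simp add: field_simps)
  qed
  have "leaf_mom c y = leaf_mom c' y" for y
  proof -
    obtain w where w: "excess h Z y w = 0" using calibrated_exists[of h y] Z by metis
    have "excess h Z y w = (excess c U y w + excess c' U' y w) / 2"
      by (simp add: excess_def Z_def ah field_simps)
    then have "excess c U y w + excess c' U' y w = 0" using w by simp
    then have "excess c U y w = 0" "excess c' U' y w = 0"
      using add_nonneg_eq_0_iff[OF excess_nonneg[OF U, of y w] excess_nonneg[OF U', of y w]] by simp_all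
    then show ?thesis using leaf_mom_eqs(1)[OF U] leaf_mom_eqs(1)[OF U'] by simp
  qed
  \<comment> \<open>Potentials with equal gradients differ by a constant, and their increments along
    the lattice recover the classes.\<close>
  then have "((\<lambda>y. U y - U' y) has_derivative (\<lambda>h. 0)) (at y)" for y
    using has_derivative_diff[OF subsolution_deriv[OF U, of y] subsolution_deriv[OF U', of y]] by simp
  then obtain k where k: "\<And>y. U y - U' y = k"
    using has_derivative_zero_constant[of UNIV "\<lambda>y. U y - U' y"] by auto
  have "c \<bullet> r = c' \<bullet> r" if "r \<in> int_lattice" for r
    using subsolution_per[OF U that, of 0] subsolution_per[OF U' that, of 0] k[of r] k[of 0] by simp
  then have "c $ i = c' $ i" for i using axis_int_lattice[of i] by (metis inner_axis inner_real_def mult.right_neutral)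
  then show ?thesis by (simp add: vec_eq_iff)
qed

text \<open>A bounded momentum at \<open>x\<close> bounds the distance to the calibrated predecessor
  \<open>w\<close>. Nonnegative excess of the pairs \<open>w\<close>, \<open>x + s\<close> for unit
  lattice vectors \<open>s\<close> then bounds each component of \<open>c\<close>, because
  \<open>U\<close> grows by \<open>c \<bullet> s\<close> along \<open>s\<close>.\<close>

lemma leaf_mom_proper:
  assumes "norm (leaf_mom c x) \<le> M"
  shows "norm c \<le> CARD('n) * bnd ((M + bnd 0) / A)"
proof -
  obtain U where U: "subsolution c U" by (rule subsolution_exists)
  obtain w where w: "excess c U w x = 0" using calibrated_exists[of c x] U by metis
  define R where "R = (M + bnd 0) / A"
  define v where "v = x - w"
  have "A * (norm v)\<^sup>2 \<le> (S2 (x + - v) x - S2 x x) \<bullet> v"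
    using S2_monotone[of x "- v" x] by (simp add: inner_diff_left)
  also have "\<dots> \<le> norm (S2 (x + - v) x - S2 x x) * norm v" by (rule norm_cauchy_schwarz)
  also have "\<dots> \<le> (M + bnd 0) * norm v"
    using assms leaf_mom_eqs(2)[OF U w] bnd_S2[of x x 0] norm_triangle_ineq4[of "S2 w x" "S2 x x"]
    by (intro mult_right_mono) (auto simp: v_def)
  finally have R: "norm (x - w) \<le> R"
    unfolding v_def R_def by (rule norm_le_of_quadratic) (use bnd_ge1[of 0] order.trans[OF norm_ge_zero assms] in simp)
  have le: "c \<bullet> s \<le> bnd R" if s: "s \<in> int_lattice" "norm s = 1" for s
  proof -
    have "excess c U w (x + s) \<ge> 0" by (rule excess_nonneg[OF U])
    then have "c \<bullet> s \<le> S w (x + s) - S w x"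
      using w subsolution_per[OF U s(1), of x] by (simp add: excess_def)
    also have "\<dots> \<le> bnd R" using S_lipschitz2[OF R, of s] s by simp
    finally show ?thesis .
  qed
  have "\<bar>c $ i\<bar> \<le> bnd R" for i
    using le[OF axis_int_lattice, of i] le[OF int_lattice_uminus[OF axis_int_lattice], of i]
    by (simp add: inner_axis abs_le_iff)
  then have "(\<Sum>i\<in>UNIV. \<bar>c $ i\<bar>) \<le> (\<Sum>i\<in>(UNIV :: 'n set). bnd R)" by (intro sum_mono)
  then show ?thesis using norm_le_l1_cart[of c] by (simp add: R_def)
qed

text \<open>The lower limit \<open>W\<close> of normalized potentials of the classes
  \<open>ck\<close> is a subsolution of class \<open>c\<close>. A limit of calibrated successors is
  a calibrated successor for \<open>W\<close>, and this alone determines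
  \<open>leaf_mom c x\<close>.\<close>

lemma leaf_mom_closed_graph:
  assumes ck: "ck \<longlonglongrightarrow> c" and xk: "xk \<longlonglongrightarrow> x" and pk: "(\<lambda>k. leaf_mom (ck k) (xk k)) \<longlonglongrightarrow> p"
    and M: "\<And>k. norm (ck k) \<le> M"
  shows "leaf_mom c x = p"
proof -
  have "\<exists>U. subsolution (ck k) U \<and> U (xk k) = 0" for k
  proof -
    obtain U where U: "subsolution (ck k) U" by (rule subsolution_exists)
    have "subsolution (ck k) (\<lambda>y. U y + (- U (xk k)))" by (rule subsolution_add_const[OF U])
    then show ?thesis by (intro exI[of _ "\<lambda>y. U y + (- U (xk k))"]) simp
  qed
  then obtain U where U: "\<And>k. subsolution (ck k) (U k)" and U0: "\<And>k. U k (xk k) = 0" by metis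
  define B where "B = bnd (step_radius M)"
  have lip: "\<bar>U k \<eta> - U k \<xi>\<bar> \<le> B * norm (\<eta> - \<xi>)" for k \<eta> \<xi>
    unfolding B_def by (rule gradient_bounded_lipschitz[OF subsolution_deriv[OF U] leaf_mom_bounded[OF M]])
  have "\<exists>y. excess (ck k) (U k) (xk k) y = 0" for k using calibrated_exists[of "ck k" "xk k"] U by metis
  then obtain yk where yk: "\<And>k. excess (ck k) (U k) (xk k) (yk k) = 0" by metis
  have step: "norm (yk k - xk k) \<le> step_radius M" for k
    using yk[of k] by (intro excess_step[OF U[of k] M[of k]]) simp
  have "bounded (range xk)" by (rule convergent_imp_bounded[OF xk])
  then obtain X where X: "\<And>k. norm (xk k) \<le> X" unfolding bounded_iff by auto
  have "norm (yk k) \<le> step_radius M + X" for k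
    using norm_triangle_ineq[of "yk k - xk k" "xk k"] step[of k] X[of k] by simp
  then have "bounded (range yk)" unfolding bounded_iff by auto
  then obtain y r where r: "strict_mono r" "(yk \<circ> r) \<longlonglongrightarrow> y" using bounded_imp_convergent_subsequence by blast
  define u where "u k \<xi> = U (r k) \<xi>" for k \<xi>
  have c': "(\<lambda>k. ck (r k)) \<longlonglongrightarrow> c" and x': "(\<lambda>k. xk (r k)) \<longlonglongrightarrow> x" and y': "(\<lambda>k. yk (r k)) \<longlonglongrightarrow> y"
    using LIMSEQ_subseq_LIMSEQ[OF ck r(1)] LIMSEQ_subseq_LIMSEQ[OF xk r(1)] r(2) by (auto simp: o_def)
  have a': "(\<lambda>k. mean_act (ck (r k))) \<longlonglongrightarrow> mean_act c" using continuous_on_tendsto_compose[OF mean_act_cont c'] by simp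
  have ub: "\<bar>u k \<xi>\<bar> \<le> B * (norm \<xi> + X)" for k \<xi>
  proof -
    have "\<bar>u k \<xi>\<bar> \<le> B * norm (\<xi> - xk (r k))" using lip[of "r k" \<xi> "xk (r k)"] U0 by (simp add: u_def)
    also have "\<dots> \<le> B * (norm \<xi> + X)"
      using norm_triangle_ineq4[of \<xi> "xk (r k)"] X[of "r k"] bnd_ge1[of "step_radius M"]
      by (intro mult_left_mono) (auto simp: B_def)
    finally show ?thesis .
  qed
  define W where "W \<xi> = (SUP n. INF k\<in>{n..}. u k \<xi>)" for \<xi>
  have Wle: "W \<eta> \<le> W \<xi> + d" if "\<forall>\<^sub>F k in sequentially. u k \<eta> \<le> u k \<xi> + d" for \<eta> \<xi> d
    unfolding W_def
  proof (rule lower_limit_mono[OF _ _ that])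
    show "\<bar>u k \<eta>\<bar> \<le> max (B * (norm \<eta> + X)) (B * (norm \<xi> + X))"
      "\<bar>u k \<xi>\<bar> \<le> max (B * (norm \<eta> + X)) (B * (norm \<xi> + X))" for k
      using ub by (auto simp: le_max_iff_disj)
  qed
  have "subsolution c W"
    unfolding subsolution_def dominated_def
  proof (intro conjI allI ballI)
    fix \<xi> \<eta>
    have "W \<eta> \<le> W \<xi> + (S \<xi> \<eta> - mean_act c) + e" if "e > 0" for e
    proof -
      have "\<forall>\<^sub>F k in sequentially. mean_act (ck (r k)) > mean_act c - e"
        using a' that by (intro order_tendstoD(1)) auto
      moreover have "u k \<eta> \<le> u k \<xi> + (S \<xi> \<eta> - mean_act (ck (r k)))" for k
        using excess_nonneg[OF U, of "r k" \<xi> \<eta>] by (simp add: u_def excess_def)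
      ultimately have "\<forall>\<^sub>F k in sequentially. u k \<eta> \<le> u k \<xi> + (S \<xi> \<eta> - mean_act c + e)"
        by (elim eventually_mono) (smt (verit))
      from Wle[OF this] show ?thesis by simp
    qed
    then have "W \<eta> \<le> W \<xi> + (S \<xi> \<eta> - mean_act c)" by (rule field_le_epsilon)
    then show "W \<eta> - W \<xi> + mean_act c \<le> S \<xi> \<eta>" by simp
    fix s :: "real^'n" assume s: "s \<in> int_lattice"
    have cs: "(\<lambda>k. ck (r k) \<bullet> s) \<longlonglongrightarrow> c \<bullet> s" by (intro tendsto_intros c')
    have us: "u k (\<xi> + s) = u k \<xi> + ck (r k) \<bullet> s" for k
      using subsolution_per[OF U s] by (simp add: u_def)
    have "W (\<xi> + s) \<le> W \<xi> + c \<bullet> s + e \<and> W \<xi> + c \<bullet> s \<le> W (\<xi> + s) + e" if "e > 0" for e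
    proof -
      have ev: "\<forall>\<^sub>F k in sequentially. \<bar>ck (r k) \<bullet> s - c \<bullet> s\<bar> < e"
        using tendstoD[OF cs that] by (simp add: dist_real_def)
      have "\<forall>\<^sub>F k in sequentially. u k (\<xi> + s) \<le> u k \<xi> + (c \<bullet> s + e)"
        "\<forall>\<^sub>F k in sequentially. u k \<xi> \<le> u k (\<xi> + s) + (e - c \<bullet> s)"
        using ev unfolding us by (auto elim!: eventually_mono)
      from Wle[OF this(1)] Wle[OF this(2)] show ?thesis by simp
    qed
    then show "W (\<xi> + s) = W \<xi> + c \<bullet> s" by (meson antisym field_le_epsilon)
  qed
  note W = this
  \<comment> \<open>The Lipschitz constant \<open>B\<close> is common to all potentials, so
    convergence along moving points gives convergence at their limit.\<close>
  have conv: "(\<lambda>k. u k \<xi>) \<longlonglongrightarrow> l" if "s \<longlonglongrightarrow> \<xi>" "(\<lambda>k. u k (s k)) \<longlonglongrightarrow> l" for \<xi> s l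
  proof -
    have "(\<lambda>k. B * norm (\<xi> - s k)) \<longlonglongrightarrow> B * norm (\<xi> - \<xi>)" by (intro tendsto_intros that)
    then have "(\<lambda>k. B * norm (\<xi> - s k)) \<longlonglongrightarrow> 0" by simp
    moreover have "\<forall>\<^sub>F k in sequentially. norm (u k \<xi> - u k (s k)) \<le> B * norm (\<xi> - s k)"
      using lip by (simp add: u_def)
    ultimately have "(\<lambda>k. u k \<xi> - u k (s k)) \<longlonglongrightarrow> 0" by (rule Lim_null_comparison[rotated])
    from tendsto_add[OF this that(2)] show ?thesis by simp
  qed
  have "W x = 0"
    unfolding W_def by (rule lower_limit_eq_lim, rule conv[OF x']) (simp add: u_def U0)
  moreover have "W y = S x y - mean_act c"
    unfolding W_def
  proof (rule lower_limit_eq_lim, rule conv[OF y'])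
    have "u k (yk (r k)) = S (xk (r k)) (yk (r k)) - mean_act (ck (r k))" for k
      using yk[of "r k"] U0[of "r k"] by (simp add: u_def excess_def)
    then show "(\<lambda>k. u k (yk (r k))) \<longlonglongrightarrow> S x y - mean_act c"
      by (simp only:) (intro tendsto_intros x' y' a')
  qed
  ultimately have "excess c W x y = 0" by (simp add: excess_def)
  then have "leaf_mom c x = - S1 x y" by (rule leaf_mom_eqs(1)[OF W])
  moreover have "(\<lambda>k. leaf_mom (ck (r k)) (xk (r k))) \<longlonglongrightarrow> - S1 x y"
    unfolding leaf_mom_eqs(1)[OF U yk] by (intro tendsto_intros x' y')
  moreover have "(\<lambda>k. leaf_mom (ck (r k)) (xk (r k))) \<longlonglongrightarrow> p"
    using LIMSEQ_subseq_LIMSEQ[OF pk r(1)] by (simp add: o_def)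
  ultimately show ?thesis using LIMSEQ_unique by metis
qed

text \<open>A map into a compact set with closed graph is continuous. The momenta are bounded
  uniformly only for bounded classes, hence the restriction to balls.\<close>

lemma leaf_mom_cont: "continuous_on UNIV (\<lambda>w. leaf_mom (fst w) (snd w))"
proof -
  have "continuous_on (ball 0 M \<times> UNIV) (\<lambda>w. leaf_mom (fst w) (snd w))" for M
  proof (rule continuous_on_subset)
    show "continuous_on (cball 0 M \<times> UNIV) (\<lambda>w. leaf_mom (fst w) (snd w))"
    proof (rule continuous_from_closed_graph)
      show "compact (cball (0 :: real^'n) (bnd (step_radius M)))" by simp
      show "(\<lambda>w. leaf_mom (fst w) (snd w)) \<in> cball 0 M \<times> UNIV \<rightarrow> cball 0 (bnd (step_radius M))"
        using leaf_mom_bounded by auto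
      show "closed ((\<lambda>w. (w, leaf_mom (fst w) (snd w))) ` (cball 0 M \<times> UNIV))"
        unfolding closed_sequential_limits
      proof (intro allI impI, elim conjE)
        fix q l assume q: "\<forall>k. q k \<in> (\<lambda>w. (w, leaf_mom (fst w) (snd w))) ` (cball 0 M \<times> UNIV)" and lim: "q \<longlonglongrightarrow> l"
        have ql: "(\<lambda>k. fst (fst (q k))) \<longlonglongrightarrow> fst (fst l)" "(\<lambda>k. snd (fst (q k))) \<longlonglongrightarrow> snd (fst l)"
          "(\<lambda>k. snd (q k)) \<longlonglongrightarrow> snd l"
          by (intro tendsto_intros lim)+
        have qk: "snd (q k) = leaf_mom (fst (fst (q k))) (snd (fst (q k)))" "norm (fst (fst (q k))) \<le> M" for k
          using q[rule_format, of k] by auto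
        have "leaf_mom (fst (fst l)) (snd (fst l)) = snd l"
          using leaf_mom_closed_graph[OF ql(1,2) _ qk(2)] ql(3) qk(1) by simp
        moreover have "norm (fst (fst l)) \<le> M"
          using tendsto_norm[OF ql(1)] qk(2) by (intro LIMSEQ_le_const2) auto
        ultimately show "l \<in> (\<lambda>w. (w, leaf_mom (fst w) (snd w))) ` (cball 0 M \<times> UNIV)"
          by (intro image_eqI[of _ _ "fst l"]) (auto simp: mem_Times_iff prod_eq_iff)
      qed
    qed
  qed auto
  moreover have "w \<in> interior (ball 0 (norm (fst w) + 1) \<times> UNIV)" for w :: "(real^'n) \<times> (real^'n)"
    by (subst interior_open) (auto simp: mem_Times_iff intro: open_Times)
  ultimately have "isCont (\<lambda>w. leaf_mom (fst w) (snd w)) w" for w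
    by (rule continuous_on_interior)
  then show ?thesis by (simp add: continuous_at_imp_continuous_on)
qed

lemma leaf_mom_cont_comp:
  "continuous_on T f \<Longrightarrow> continuous_on T g \<Longrightarrow> continuous_on T (\<lambda>x. leaf_mom (f x) (g x))"
  using continuous_on_compose2[OF leaf_mom_cont continuous_on_Pair, of T f g] by simp

text \<open>Over each \<open>x\<close> every momentum belongs to exactly one class: the leaves fill
  the fibre without overlap.\<close>

lemma leaf_mom_bij: "bij (\<lambda>c. leaf_mom c x)"
proof (rule inj_coercive_bij)
  show "continuous_on UNIV (\<lambda>c. leaf_mom c x)" by (intro leaf_mom_cont_comp continuous_intros)
  show "inj (\<lambda>c. leaf_mom c x)" using leaf_mom_inj by (auto simp: inj_def)
  show "bounded {c. norm (leaf_mom c x) \<le> M}" for M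
    unfolding bounded_iff using leaf_mom_proper by blast
qed

lemma leaf_mom_surj: obtains c where "leaf_mom c x = p"
  using bij_is_surj[OF leaf_mom_bij[of x]] by (metis surjD)

end

section \<open>From the torus to the universal cover\<close>

lemma has_covering_derivativeI:
  assumes "\<rho> a = z" "\<And>w. G (\<rho> w) = \<sigma> (H w)" "(H has_derivative L) (at a)"
  shows "has_covering_derivative \<rho> \<sigma> G L z"
  unfolding has_covering_derivative_def using assms
  by (intro exI[of _ a] exI[of _ H]) simp

text \<open>After a deck translation the two lifts lie over the same points. Their difference is
  continuous and, by \<open>discrete\<close>, takes values separated by at least \<open>e\<close>,
  so it is locally constant.\<close>

lemma has_covering_derivative_unique:
  fixes \<rho> :: "'a::real_normed_vector \<Rightarrow> 'm" and \<sigma> :: "'b::real_normed_vector \<Rightarrow> 'k"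
  assumes deck: "\<And>a a' w. \<rho> a = \<rho> a' \<Longrightarrow> \<rho> (w + (a' - a)) = \<rho> w"
    and e: "e > 0" and discrete: "\<And>y y' z z'. \<sigma> y = \<sigma> y' \<Longrightarrow> \<sigma> z = \<sigma> z' \<Longrightarrow>
      norm ((y' - y) - (z' - z)) < e \<Longrightarrow> y' - y = z' - z"
    and L: "has_covering_derivative \<rho> \<sigma> G L z" and L': "has_covering_derivative \<rho> \<sigma> G L' z"
  shows "L = L'"
proof -
  obtain a H where a: "\<rho> a = z" "\<forall>\<^sub>F w in nhds a. G (\<rho> w) = \<sigma> (H w)" "(H has_derivative L) (at a)"
    using L unfolding has_covering_derivative_def by blast
  obtain a' H' where a': "\<rho> a' = z" "\<forall>\<^sub>F w in nhds a'. G (\<rho> w) = \<sigma> (H' w)" "(H' has_derivative L') (at a')"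
    using L' unfolding has_covering_derivative_def by blast
  define d where "d = a' - a"
  define K where "K w = H' (w + d)" for w
  have a'd: "a' = a + d" by (simp add: d_def)
  have KL: "(K has_derivative L') (at a)"
    unfolding K_def[abs_def]
    by (rule has_derivative_compose[of "\<lambda>w. w + d" "\<lambda>h. h"]) (use a'(3) a'd in \<open>auto intro!: derivative_eq_intros\<close>)
  have "filterlim (\<lambda>w. w + d) (nhds a') (nhds a)"
    unfolding a'd by (intro tendsto_intros filterlim_ident)
  then have "\<forall>\<^sub>F w in nhds a. G (\<rho> (w + d)) = \<sigma> (K w)"
    unfolding K_def using a'(2) by (rule eventually_compose_filterlim[rotated])
  moreover have "\<rho> (w + d) = \<rho> w" for w unfolding d_def using a(1) a'(1) by (intro deck) simp
  ultimately have eq: "\<forall>\<^sub>F w in nhds a. \<sigma> (H w) = \<sigma> (K w)"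
    using a(2) by (auto elim: eventually_elim2)
  have "isCont (\<lambda>w. K w - H w) a"
    using KL a(3) by (intro continuous_intros has_derivative_continuous)
  then have "filterlim (\<lambda>w. K w - H w) (nhds (K a - H a)) (nhds a)"
    using tendsto_at_iff_tendsto_nhds[of "\<lambda>w. K w - H w" a] by (simp add: isCont_def)
  then have "\<forall>\<^sub>F w in nhds a. dist (K w - H w) (K a - H a) < e" using e by (rule tendstoD)
  then have "\<forall>\<^sub>F w in nhds a. K w = H w + (K a - H a)"
    using eq
  proof eventually_elim
    case (elim w)
    have "\<sigma> (H a) = \<sigma> (K a)" using eq by (rule eventually_nhds_x_imp_x)
    then have "K w - H w = K a - H a"
      using elim by (intro discrete) (auto simp: dist_norm)
    then show ?case by (simp add: algebra_simps)
  qed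
  then have ev: "\<forall>\<^sub>F w in at a. H w + (K a - H a) = K w"
    by (auto simp: eventually_at_filter elim: eventually_mono)
  have "((\<lambda>w. H w + (K a - H a)) has_derivative L) (at a)"
    using a(3) by (auto intro!: derivative_eq_intros)
  from has_derivative_transform_eventually[OF this ev] have "(K has_derivative L) (at a)" by simp
  then show ?thesis using KL has_derivative_unique by blast
qed

lemma int_lattice_small:
  fixes r :: "real^'n"
  assumes "r \<in> int_lattice" "norm r < 1"
  shows "r = 0"
proof -
  have "r $ i = 0" for i
  proof -
    obtain k where k: "r $ i = of_int k" using assms(1) by (auto simp: int_lattice_def elim: Ints_cases)
    have "\<bar>r $ i\<bar> < 1" using component_le_norm_cart[of r i] assms(2) by simp
    then show ?thesis using k by (metis of_int_0 of_int_abs of_int_less_1_iff abs_ge_zero antisym_conv1 less_irrefl zero_less_abs_iff int_one_le_iff_zero_less not_le)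
  qed
  then show ?thesis by (simp add: vec_eq_iff)
qed

lemma cotangent_proj_Pair: "cotangent_proj (x, p) = (torus_proj x, p)"
  by (simp add: cotangent_proj_def)

lemma cotangent_proj_eq_iff:
  "cotangent_proj z = cotangent_proj w \<longleftrightarrow> (\<exists>r\<in>int_lattice. w = z + (r, 0))"
proof
  assume eq: "cotangent_proj z = cotangent_proj w"
  have "fst w - fst z \<in> int_lattice" using eq torus_proj_eq_iff by (auto simp: cotangent_proj_def map_prod_def case_prod_unfold)
  moreover have "snd w = snd z" using eq by (simp add: cotangent_proj_def map_prod_def case_prod_unfold)
  ultimately show "\<exists>r\<in>int_lattice. w = z + (r, 0)"
    by (intro bexI[of _ "fst w - fst z"]) (auto simp: prod_eq_iff)
qed (auto simp: cotangent_proj_def map_prod_def case_prod_unfold torus_proj_add)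

lemma cotangent_proj_add: "r \<in> int_lattice \<Longrightarrow> cotangent_proj (z + (r, 0)) = cotangent_proj z"
  by (rule cotangent_proj_eq_iff[THEN iffD2, symmetric]) blast

lemma surj_cotangent_proj: "surj cotangent_proj"
  unfolding cotangent_proj_def by (rule map_prod_surj[OF surj_torus_proj surj_id])

lemma deck_cotangent:
  assumes "cotangent_proj a = cotangent_proj a'"
  shows "cotangent_proj (w + (a' - a)) = cotangent_proj w"
proof -
  obtain r where "r \<in> int_lattice" "a' = a + (r, 0)" using assms cotangent_proj_eq_iff by metis
  then show ?thesis using cotangent_proj_add[of r w] by simp
qed

lemma discrete_torus:
  assumes "torus_proj y = torus_proj y'" "torus_proj z = torus_proj z'" "norm ((y' - y) - (z' - z)) < 1"
  shows "y' - y = z' - z"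
proof -
  have "(y' - y) - (z' - z) \<in> int_lattice"
    using assms(1,2) unfolding torus_proj_eq_iff by (rule int_lattice_diff)
  then have "(y' - y) - (z' - z) = 0" using assms(3) by (rule int_lattice_small)
  then show ?thesis by simp
qed

lemma discrete_cotangent:
  assumes "cotangent_proj y = cotangent_proj y'" "cotangent_proj z = cotangent_proj z'"
    and "norm ((y' - y) - (z' - z)) < 1"
  shows "y' - y = z' - z"
proof -
  obtain r s where rs: "r \<in> int_lattice" "s \<in> int_lattice" "y' = y + (r, 0)" "z' = z + (s, 0)"
    using assms(1,2) cotangent_proj_eq_iff by metis
  have "norm (r - s) < 1" using assms(3) rs by (simp add: norm_Pair)
  then have "r - s = 0" using int_lattice_small int_lattice_diff rs by blast
  then show ?thesis using rs by simp
qed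

lemma covering_derivative_cotangentI:
  assumes "has_covering_derivative cotangent_proj cotangent_proj G L z"
  shows "covering_derivative cotangent_proj cotangent_proj G z = L"
  unfolding covering_derivative_def
  by (rule has_covering_derivative_unique[OF deck_cotangent zero_less_one discrete_cotangent
        someI[of "\<lambda>L. has_covering_derivative cotangent_proj cotangent_proj G L z", OF assms] assms])

lemma vertical_eq: "vertical z = {v. fst v = 0}"
proof -
  obtain a where a: "cotangent_proj a = z" using surj_cotangent_proj by (metis surjD)
  have h: "has_covering_derivative cotangent_proj torus_proj fst fst z"
  proof (rule has_covering_derivativeI[of _ a _ _ _ fst])
    show "fst (cotangent_proj w) = torus_proj (fst w)" for w :: "(real^'a) \<times> (real^'a)"
      by (cases w) (simp add: cotangent_proj_Pair)
    show "(fst has_derivative fst) (at a)" by (auto intro!: derivative_eq_intros)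
  qed (rule a)
  have "covering_derivative cotangent_proj torus_proj fst z = fst"
    unfolding covering_derivative_def
    by (rule has_covering_derivative_unique[OF deck_cotangent zero_less_one discrete_torus
          someI[of "\<lambda>L. has_covering_derivative cotangent_proj torus_proj fst L z", OF h] h])
  then show ?thesis by (simp add: vertical_def)
qed

section \<open>The covering maps: topology and Lipschitz functions\<close>

lemma continuous_on_torus_proj: "continuous_on UNIV torus_proj"
  by (simp add: continuous_on_open_vimage open_torus_def)

lemma continuous_on_cotangent_proj: "continuous_on UNIV cotangent_proj"
proof -
  have "continuous_on UNIV (\<lambda>z. (torus_proj (fst z), snd z))"
    by (intro continuous_on_Pair continuous_on_compose2[OF continuous_on_torus_proj] continuous_intros) auto
  then show ?thesis by (simp add: cotangent_proj_def map_prod_def case_prod_unfold)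
qed

lemma open_torus_proj_image:
  assumes "open V"
  shows "open (torus_proj ` V)"
proof -
  have "torus_proj -` (torus_proj ` V) = (\<Union>r\<in>int_lattice. (+) r ` V)"
  proof (intro equalityI subsetI)
    fix x assume "x \<in> torus_proj -` (torus_proj ` V)"
    then obtain y where y: "y \<in> V" "torus_proj y = torus_proj x" by fastforce
    then have "x - y \<in> int_lattice" by (simp add: torus_proj_eq_iff)
    then show "x \<in> (\<Union>r\<in>int_lattice. (+) r ` V)"
      using y(1) by (intro UN_I[of "x - y"] image_eqI[of _ _ y]) auto
  next
    fix x assume "x \<in> (\<Union>r\<in>int_lattice. (+) r ` V)"
    then obtain r y where "r \<in> int_lattice" "y \<in> V" "x = r + y" by blast
    then show "x \<in> torus_proj -` (torus_proj ` V)"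
      using torus_proj_add[of r y] by (auto simp: add.commute)
  qed
  then show ?thesis using assms by (auto simp: open_torus_def intro!: open_UN open_translation)
qed

lemma open_cotangent_proj_image:
  assumes "open V"
  shows "open (cotangent_proj ` V)"
proof (rule open_prod_intro)
  fix t assume "t \<in> cotangent_proj ` V"
  then obtain z where z: "z \<in> V" "t = cotangent_proj z" by blast
  obtain B C where BC: "open B" "open C" "z \<in> B \<times> C" "B \<times> C \<subseteq> V"
    using open_prod_elim[OF assms z(1)] by blast
  show "\<exists>B C. open B \<and> open C \<and> t \<in> B \<times> C \<and> B \<times> C \<subseteq> cotangent_proj ` V"
  proof (intro exI conjI)
    show "open (torus_proj ` B)" "open C" using BC open_torus_proj_image by auto
    show "t \<in> torus_proj ` B \<times> C" using z BC by (auto simp: cotangent_proj_def)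
    show "torus_proj ` B \<times> C \<subseteq> cotangent_proj ` V"
    proof
      fix u assume "u \<in> torus_proj ` B \<times> C"
      then obtain x p where "u = (torus_proj x, p)" "x \<in> B" "p \<in> C" by blast
      then show "u \<in> cotangent_proj ` V"
        using BC(4) by (intro image_eqI[of _ _ "(x, p)"]) (auto simp: cotangent_proj_Pair)
    qed
  qed
qed

text \<open>The distance on the torus is an infimum over lifts, so lifts are taken that realize it
  up to \<open>d\<close>; with \<open>d = e / (K + 1)\<close> this costs at most
  \<open>e\<close>.\<close>

lemma torus_lipschitz_on:
  assumes K: "K-lipschitz_on UNIV (\<lambda>x. \<eta> (torus_proj x))"
  shows "K-lipschitz_on UNIV \<eta>"
proof (rule lipschitz_onI)
  show "K \<ge> 0" using K by (rule lipschitz_on_nonneg)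
  fix s t :: "'a torus"
  show "dist (\<eta> s) (\<eta> t) \<le> K * dist s t"
  proof (rule field_le_epsilon)
    fix e :: real assume "e > 0"
    define d where "d = e / (K + 1)"
    have d: "d > 0" "K * d \<le> e" using \<open>e > 0\<close> \<open>K \<ge> 0\<close> by (auto simp: d_def field_simps add_nonneg_pos)
    have ne: "torus_proj -` {s} \<noteq> {}" "torus_proj -` {t} \<noteq> {}"
      using surj_torus_proj by (metis empty_iff surjD vimage_singleton_eq)+
    have "setdist (torus_proj -` {s}) (torus_proj -` {t}) < dist s t + d"
      using d by (simp add: dist_torus_def)
    then obtain a b where ab: "torus_proj a = s" "torus_proj b = t" "dist a b < dist s t + d"
      using ne by (auto elim!: setdist_ltE)
    have "dist (\<eta> s) (\<eta> t) \<le> K * dist a b" using lipschitz_onD[OF K, of a b] ab by simp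
    also have "\<dots> \<le> K * (dist s t + d)" using ab \<open>K \<ge> 0\<close> by (intro mult_left_mono) auto
    also have "\<dots> \<le> K * dist s t + e" using d by (simp add: distrib_left)
    finally show "dist (\<eta> s) (\<eta> t) \<le> K * dist s t + e" .
  qed
qed

lemma lipschitz_on_torus_lift:
  assumes "K-lipschitz_on UNIV \<eta>"
  shows "K-lipschitz_on UNIV (\<lambda>x. \<eta> (torus_proj x))"
proof (rule lipschitz_onI)
  show "K \<ge> 0" using assms by (rule lipschitz_on_nonneg)
  fix x y :: "real^'a"
  have "dist (\<eta> (torus_proj x)) (\<eta> (torus_proj y)) \<le> K * dist (torus_proj x) (torus_proj y)"
    by (rule lipschitz_onD[OF assms]) auto
  also have "\<dots> \<le> K * dist x y"
    unfolding dist_torus_def using \<open>K \<ge> 0\<close> by (intro mult_left_mono setdist_le_dist) auto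
  finally show "dist (\<eta> (torus_proj x)) (\<eta> (torus_proj y)) \<le> K * dist x y" .
qed

lemma cotangent_proj_mem_section_graph:
  "cotangent_proj z \<in> section_graph \<eta> \<longleftrightarrow> snd z = \<eta> (torus_proj (fst z))"
  by (auto simp: section_graph_def cotangent_proj_def map_prod_def case_prod_unfold)

context twist_system
begin

context
  fixes F :: "'n torus \<times> (real^'n) \<Rightarrow> 'n torus \<times> (real^'n)"
  assumes lift: "\<And>z. F (cotangent_proj z) = cotangent_proj (Fb z)"
begin

section \<open>Iterates on the cotangent bundle of the torus and their differentials\<close>

lemma F_bij: "bij F"
proof (rule bijI)
  show "inj F"
  proof (rule injI)
    fix s t assume eq: "F s = F t"
    obtain z w where zw: "cotangent_proj z = s" "cotangent_proj w = t" using surj_cotangent_proj by (metis surjD)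
    then have "cotangent_proj (Fb z) = cotangent_proj (Fb w)" using eq lift by metis
    then obtain r where r: "r \<in> int_lattice" "Fb w = Fb (z + (r, 0))"
      using cotangent_proj_eq_iff Fb_per by metis
    then have "w = z + (r, 0)" using bij_is_inj[OF Fb_bij] by (simp add: inj_eq)
    then show "s = t" using zw r(1) cotangent_proj_add by metis
  qed
  show "surj F"
    unfolding surj_def using surj_cotangent_proj bij_is_surj[OF Fb_bij] lift by (metis surjD)
qed

lemma inv_F_lift: "inv F (cotangent_proj z) = cotangent_proj (inv Fb z)"
  by (rule inv_f_eq[OF bij_is_inj[OF F_bij]]) (simp add: lift surj_f_inv_f[OF bij_is_surj[OF Fb_bij]])

lemma funpow_lift: "(F ^^ n) (cotangent_proj z) = cotangent_proj ((Fb ^^ n) z)"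
  by (induction n) (auto simp: lift)

lemma funpow_inv_lift: "(inv F ^^ n) (cotangent_proj z) = cotangent_proj ((inv Fb ^^ n) z)"
  by (induction n) (auto simp: inv_F_lift)

lemma DFn_bij: "bij (DFn n z)"
proof -
  have "inj (DFn n z)" using linear_injective_0[OF DFn_lin] DFn_inj by blast
  then show ?thesis using linear_injective_imp_surjective[OF DFn_lin] by (simp add: bij_def)
qed

lemma Fbn_inverse: "(Fb ^^ n) ((inv Fb ^^ n) z) = z" "(inv Fb ^^ n) ((Fb ^^ n) z) = z"
  using fun_cong[OF fn_o_inv_fn_is_id[OF Fb_bij, of n], of z]
    fun_cong[OF inv_fn_o_fn_is_id[OF Fb_bij, of n], of z] unfolding o_apply by this+

lemma covering_derivative_funpow:
  "covering_derivative cotangent_proj cotangent_proj (F ^^ n) (cotangent_proj z) = DFn n z"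
proof (rule covering_derivative_cotangentI)
  show "has_covering_derivative cotangent_proj cotangent_proj (F ^^ n) (DFn n z) (cotangent_proj z)"
    by (rule has_covering_derivativeI[where a = z and H = "Fb ^^ n"]) (rule refl funpow_lift Fbn_has_derivative)+
qed

lemma covering_derivative_inv_funpow:
  "covering_derivative cotangent_proj cotangent_proj (inv F ^^ n) (cotangent_proj z) = inv (DFn n ((inv Fb ^^ n) z))"
proof (rule covering_derivative_cotangentI)
  define y where "y = (inv Fb ^^ n) z"
  have "((inv Fb ^^ n) has_derivative inv (DFn n y)) (at ((Fb ^^ n) y))"
  proof (rule has_derivative_inverse_strong[OF open_UNIV UNIV_I Fbn_cont Fbn_inverse(2) Fbn_has_derivative])
    show "DFn n y \<circ> inv (DFn n y) = id"
      using surj_f_inv_f[OF bij_is_surj[OF DFn_bij]] by (simp add: fun_eq_iff)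
  qed
  then have "((inv Fb ^^ n) has_derivative inv (DFn n ((inv Fb ^^ n) z))) (at z)"
    by (simp add: y_def Fbn_inverse)
  then show "has_covering_derivative cotangent_proj cotangent_proj (inv F ^^ n)
      (inv (DFn n ((inv Fb ^^ n) z))) (cotangent_proj z)"
    by (rule has_covering_derivativeI[where a = z and H = "inv Fb ^^ n", rotated 2]) (rule refl funpow_inv_lift)+
qed

text \<open>For a negative iterate the differential is the inverse of some \<open>DFn\<close>. If it
  sends a vertical vector to a vertical one, then \<open>DFn\<close> sends the latter back to the
  former, which is the case already settled by \<open>key\<close>.\<close>

lemma without_conjugate_points_iff: "without_conjugate_points F \<longleftrightarrow> no_conjugate"
proof
  assume wc: "without_conjugate_points F"
  show no_conjugate unfolding no_conjugate_def
  proof (intro allI impI)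
    fix n z w assume 0: "fst (DFn (Suc n) z (0, w)) = 0"
    have "int (Suc n) \<noteq> 0" by simp
    then have "{v. fst v = 0} \<inter> covering_derivative cotangent_proj cotangent_proj (int_iterate F (int (Suc n))) (cotangent_proj z) ` {v. fst v = 0} = {0}"
      using wc unfolding without_conjugate_points_def vertical_eq by blast
    moreover have "int_iterate F (int (Suc n)) = F ^^ Suc n" by (simp only: int_iterate_def nat_int) simp
    ultimately have "{v. fst v = 0} \<inter> DFn (Suc n) z ` {v. fst v = 0} = {0}"
      by (simp only: covering_derivative_funpow)
    then have "DFn (Suc n) z (0, w) = 0" using 0 by fastforce
    then show "w = 0" using DFn_inj[of "Suc n" z "(0, w)"] by (simp add: zero_prod_def)
  qed
next
  assume nc: no_conjugate
  have key: "v = 0" if "n \<noteq> 0" "fst v = 0" "fst (DFn n z v) = 0" for n z v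
  proof -
    obtain m where "n = Suc m" using \<open>n \<noteq> 0\<close> not0_implies_Suc by blast
    moreover have "v = (0, snd v)" using that(2) by (simp add: prod_eq_iff)
    ultimately have "snd v = 0" using nc that(3) unfolding no_conjugate_def by metis
    then show ?thesis using that(2) by (simp add: prod_eq_iff)
  qed
  show "without_conjugate_points F"
    unfolding without_conjugate_points_def vertical_eq
  proof (intro allI impI)
    fix t :: "'n torus \<times> (real^'n)" and n :: int assume n: "n \<noteq> 0"
    obtain z where z: "t = cotangent_proj z" using surj_cotangent_proj by (metis surjD)
    define L where "L = covering_derivative cotangent_proj cotangent_proj (int_iterate F n) t"
    have "v = 0" if "fst v = 0" "fst (L v) = 0" for v
    proof (cases "0 \<le> n")
      case True
      then have "L = DFn (nat n) z" by (simp add: L_def z int_iterate_def covering_derivative_funpow)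
      then show ?thesis using key[of "nat n" v z] n True that by simp
    next
      case False
      define y where "y = (inv Fb ^^ nat (- n)) z"
      have L: "L = inv (DFn (nat (- n)) y)"
        using False by (simp add: L_def z int_iterate_def covering_derivative_inv_funpow y_def)
      have v: "DFn (nat (- n)) y (L v) = v"
        unfolding L by (rule surj_f_inv_f[OF bij_is_surj[OF DFn_bij]])
      then have "L v = 0" using key[of "nat (- n)" "L v" y] n False that by simp
      then show ?thesis using v linear_0[OF DFn_lin] by metis
    qed
    moreover have "L 0 = 0"
    proof (cases "0 \<le> n")
      case True
      then have "L = DFn (nat n) z" by (simp add: L_def z int_iterate_def covering_derivative_funpow)
      then show ?thesis using linear_0[OF DFn_lin] by simp
    next
      case False
      then have "L = inv (DFn (nat (- n)) ((inv Fb ^^ nat (- n)) z))"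
        by (simp add: L_def z int_iterate_def covering_derivative_inv_funpow)
      then show ?thesis using inv_f_eq[OF bij_is_inj[OF DFn_bij] linear_0[OF DFn_lin]] by simp
    qed
    ultimately show "{v. fst v = 0} \<inter> L ` {v. fst v = 0} = {0}" by force
  qed
qed

text \<open>The leaf through a point lifts to an \<open>invariant_leaf\<close>: periodicity bounds
  the momentum, and injectivity of \<open>F\<close> turns the invariance of the leaf into the
  required equivalence.\<close>

lemma foliation_no_conjugate:
  assumes fol: "continuous_foliation \<F>"
    and leaves: "\<And>G. G \<in> \<F> \<Longrightarrow> lipschitz_lagrangian_graph G \<and> F ` G = G"
  shows no_conjugate
proof (rule leaves_no_conjugate)
  fix z
  have "\<Union>\<F> = UNIV" using fol by (simp add: continuous_foliation_def partition_on_def)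
  then obtain G where G: "G \<in> \<F>" "cotangent_proj z \<in> G" by (metis UNIV_I UnionE)
  obtain \<eta> K U where \<eta>: "G = section_graph \<eta>" "K-lipschitz_on UNIV \<eta>"
    "\<And>x. (U has_derivative (\<lambda>v. \<eta> (torus_proj x) \<bullet> v)) (at x)"
    using conjunct1[OF leaves[OF G(1)]] unfolding lipschitz_lagrangian_graph_def closed_form_def by blast
  define p where "p x = \<eta> (torus_proj x)" for x
  have lip: "K-lipschitz_on UNIV p" unfolding p_def by (rule lipschitz_on_torus_lift[OF \<eta>(2)])
  have mem: "cotangent_proj w \<in> G \<longleftrightarrow> snd w = p (fst w)" for w
    unfolding \<eta>(1) p_def by (rule cotangent_proj_mem_section_graph)
  have "bounded (range p)"
  proof -
    have "bounded (p ` cbox 0 1)"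
      by (intro compact_imp_bounded compact_continuous_image continuous_on_subset[OF lipschitz_on_continuous_on[OF lip]]) auto
    moreover have "range p \<subseteq> p ` cbox 0 1"
    proof safe
      fix x :: "real^'n"
      obtain r where r: "r \<in> int_lattice" "x - r \<in> cbox 0 1" by (rule exists_lattice_near)
      have "p x = p (x - r)" using torus_proj_add[OF r(1), of "x - r"] by (simp add: p_def)
      then show "p x \<in> p ` cbox 0 1" using r(2) by blast
    qed
    ultimately show ?thesis by (rule bounded_subset)
  qed
  moreover have "q = p x \<longleftrightarrow> snd (Fb (x, q)) = p (fst (Fb (x, q)))" for x q
  proof -
    have "q = p x \<longleftrightarrow> cotangent_proj (x, q) \<in> G" by (simp add: mem)
    also have "\<dots> \<longleftrightarrow> F (cotangent_proj (x, q)) \<in> F ` G"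
      using bij_is_inj[OF F_bij] by (simp add: inj_image_mem_iff)
    also have "\<dots> \<longleftrightarrow> cotangent_proj (Fb (x, q)) \<in> G" using leaves[OF G(1)] lift by simp
    finally show ?thesis by (simp add: mem)
  qed
  ultimately have "invariant_leaf U p"
    unfolding invariant_leaf_def using lip \<eta>(3) by (auto simp: p_def)
  moreover have "snd z = p (fst z)" using G(2) mem by simp
  ultimately show "\<exists>U p. invariant_leaf U p \<and> snd z = p (fst z)" by blast
qed

end

end

context twist_system_nc
begin

text \<open>The choice of representative is immaterial by \<open>leaf_mom_per\<close>.\<close>

definition eta :: "real^'n \<Rightarrow> 'n torus \<Rightarrow> real^'n" where
  "eta c t = leaf_mom c (inv torus_proj t)"

lemma eta_torus_proj: "eta c (torus_proj x) = leaf_mom c x"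
proof -
  have "torus_proj (inv torus_proj (torus_proj x)) = torus_proj x"
    by (rule surj_f_inv_f[OF surj_torus_proj])
  then have "x - inv torus_proj (torus_proj x) \<in> int_lattice" by (simp add: torus_proj_eq_iff)
  from leaf_mom_per[OF this, of c "inv torus_proj (torus_proj x)"] show ?thesis by (simp add: eta_def)
qed

lemma mem_leaf: "cotangent_proj z \<in> section_graph (eta c) \<longleftrightarrow> snd z = leaf_mom c (fst z)"
  by (simp add: cotangent_proj_mem_section_graph eta_torus_proj)

lemma leaf_range: "section_graph (eta c) = range (\<lambda>x. cotangent_proj (x, leaf_mom c x))"
proof -
  have "section_graph (eta c) = (\<lambda>t. (t, eta c t)) ` range torus_proj"
    by (simp add: section_graph_def surj_torus_proj)
  then show ?thesis by (simp add: image_image eta_torus_proj cotangent_proj_Pair)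
qed

lemma leaf_lagrangian: "lipschitz_lagrangian_graph (section_graph (eta c))"
proof -
  obtain U where U: "subsolution c U" by (rule subsolution_exists)
  obtain K where "K-lipschitz_on UNIV (leaf_mom c)" using leaf_mom_lipschitz by blast
  then have "K-lipschitz_on UNIV (eta c)" by (intro torus_lipschitz_on) (simp add: eta_torus_proj)
  moreover have "closed_form (eta c)"
    unfolding closed_form_def eta_torus_proj using subsolution_deriv[OF U] by blast
  ultimately show ?thesis unfolding lipschitz_lagrangian_graph_def by blast
qed

lemma leaf_invariant:
  assumes lift: "\<And>z. F (cotangent_proj z) = cotangent_proj (Fb z)"
  shows "F ` section_graph (eta c) = section_graph (eta c)"
proof (intro equalityI subsetI)
  fix t assume "t \<in> F ` section_graph (eta c)"
  then obtain x where x: "t = cotangent_proj (Fb (x, leaf_mom c x))" unfolding leaf_range using lift by auto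
  then show "t \<in> section_graph (eta c)"
    using mem_leaf[of "Fb (x, leaf_mom c x)" c] leaf_mom_invariant[of "leaf_mom c x" c x] by simp
next
  fix t assume t: "t \<in> section_graph (eta c)"
  obtain w where w: "t = cotangent_proj w" using surj_cotangent_proj by (metis surjD)
  obtain x q where xq: "Fb (x, q) = w" using bij_is_surj[OF Fb_bij] by (metis surjD prod.collapse)
  have "snd w = leaf_mom c (fst w)" using t w mem_leaf by simp
  then have "q = leaf_mom c x" using leaf_mom_invariant[of q c x] xq by simp
  then have "cotangent_proj (x, q) \<in> section_graph (eta c)" by (simp add: mem_leaf)
  then show "t \<in> F ` section_graph (eta c)" using lift[of "(x, q)"] xq w by (metis image_eqI)
qed

text \<open>The inverse chart sends \<open>(s, c)\<close> to the point over \<open>k s\<close> on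
  the leaf of class \<open>c\<close>, so that slices lie in leaves by construction. It is continuous
  and injective on a Euclidean space; invariance of domain makes it open.\<close>

lemma leaf_chart:
  fixes x0 :: "real^'n"
  obtains U and \<phi> :: "_ \<Rightarrow> (real^'n) \<times> (real^'n)" and \<psi> where "open U" "cotangent_proj (x0, p0) \<in> U" "homeomorphism U UNIV \<phi> \<psi>"
    "\<And>c. section_graph (eta c) \<inter> U = \<psi> ` (UNIV \<times> {c})"
proof -
  \<comment> \<open>Two points of a ball of radius 1/2 differ by less than 1, hence by no nonzero
    lattice vector; this makes \<open>\<psi>\<close> injective.\<close>
  have "ball x0 (1/2) homeomorphic ball (0 :: real^'n) 1" by (rule homeomorphic_balls) auto
  then have "ball x0 (1/2) homeomorphic (UNIV :: (real^'n) set)"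
    using homeomorphic_ball01_UNIV homeomorphic_trans by blast
  then obtain k' k where hom: "homeomorphism (ball x0 (1/2)) (UNIV :: (real^'n) set) k' k" unfolding homeomorphic_def by metis
  have k: "continuous_on UNIV k" "range k = ball x0 (1/2)" "inj k"
    using hom by (auto simp: homeomorphism_def intro: inj_on_inverseI[of _ k'])
  define \<Theta> where "\<Theta> w = (k (fst w), leaf_mom (snd w) (k (fst w)))" for w
  define \<psi> where "\<psi> w = cotangent_proj (\<Theta> w)" for w
  have \<Theta>c: "continuous_on UNIV \<Theta>"
    unfolding \<Theta>_def by (intro continuous_on_Pair leaf_mom_cont_comp continuous_on_compose2[OF k(1)] continuous_intros) auto
  have \<Theta>i: "inj \<Theta>"
  proof (rule injI)
    fix v w assume eq: "\<Theta> v = \<Theta> w"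
    then have eqs: "k (fst v) = k (fst w)" "leaf_mom (snd v) (k (fst v)) = leaf_mom (snd w) (k (fst w))"
      unfolding \<Theta>_def prod.inject by blast+
    have "fst v = fst w" using injD[OF k(3) eqs(1)] .
    moreover have "snd v = snd w" by (rule leaf_mom_inj[OF eqs(2)[unfolded eqs(1)]])
    ultimately show "v = w" by (rule prod_eqI)
  qed
  have \<Theta>o: "open (\<Theta> ` V)" if "open V" for V
    using invariance_of_domain[OF continuous_on_subset[OF \<Theta>c] that inj_on_subset[OF \<Theta>i]] by auto
  have \<psi>o: "open (\<psi> ` V)" if "open V" for V
    using open_cotangent_proj_image[OF \<Theta>o[OF that]] by (simp add: \<psi>_def[abs_def] image_image)
  have \<psi>c: "continuous_on UNIV \<psi>"
    unfolding \<psi>_def by (rule continuous_on_compose2[OF continuous_on_cotangent_proj \<Theta>c]) auto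
  have \<psi>i: "inj \<psi>"
  proof (rule injI)
    fix v w assume "\<psi> v = \<psi> w"
    then obtain r where r: "r \<in> int_lattice" "\<Theta> w = \<Theta> v + (r, 0)"
      unfolding \<psi>_def cotangent_proj_eq_iff by blast
    have "r = k (fst w) - k (fst v)" using r(2) by (simp add: \<Theta>_def)
    moreover have "k (fst w) \<in> ball x0 (1/2)" "k (fst v) \<in> ball x0 (1/2)" using k(2) by blast+
    ultimately have "norm r < 1"
      using dist_triangle2[of "k (fst w)" "k (fst v)" x0] by (simp add: dist_norm norm_minus_commute)
    then have "\<Theta> w = \<Theta> v" using r int_lattice_small[OF r(1)] by (simp add: zero_prod_def[symmetric])
    then show "v = w" using \<Theta>i by (simp add: inj_eq)
  qed
  have "open (range \<psi>)" using \<psi>o[OF open_UNIV] .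
  obtain \<phi> where \<phi>: "homeomorphism UNIV (range \<psi>) \<psi> \<phi>"
  proof (rule homeomorphism_injective_open_map[OF \<psi>c refl \<psi>i])
    fix V :: "((real^'n) \<times> (real^'n)) set" assume "openin (top_of_set UNIV) V"
    then have "open V" using openin_open_eq[OF open_UNIV] by blast
    then show "openin (top_of_set (range \<psi>)) (\<psi> ` V)"
      using \<psi>o openin_open_eq[OF \<open>open (range \<psi>)\<close>] by blast
  qed blast
  show thesis
  proof (rule that)
    show "open (range \<psi>)" by fact
    show "homeomorphism (range \<psi>) UNIV \<phi> \<psi>" by (rule homeomorphism_symD[OF \<phi>])
    have "x0 \<in> range k" using k(2) by simp
    then obtain s where "k s = x0" by blast
    moreover obtain c where "leaf_mom c x0 = p0" by (rule leaf_mom_surj)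
    ultimately have "\<Theta> (s, c) = (x0, p0)" by (simp add: \<Theta>_def)
    then show "cotangent_proj (x0, p0) \<in> range \<psi>" unfolding \<psi>_def by (metis rangeI)
    fix c
    have "\<psi> w \<in> section_graph (eta c) \<longleftrightarrow> snd w = c" for w
      using leaf_mom_inj[of "snd w" "k (fst w)" c] by (auto simp: \<psi>_def mem_leaf \<Theta>_def)
    then show "section_graph (eta c) \<inter> range \<psi> = \<psi> ` (UNIV \<times> {c})" by (auto simp: mem_Times_iff)
  qed
qed

lemma leaf_foliation: "continuous_foliation (range (\<lambda>c. section_graph (eta c)))"
proof -
  have conn: "connected (section_graph (eta c))" for c
  proof -
    have "continuous_on UNIV (\<lambda>x. cotangent_proj (x, leaf_mom c x))"
      by (rule continuous_on_compose2[OF continuous_on_cotangent_proj])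
        (auto intro!: continuous_on_Pair leaf_mom_cont_comp continuous_intros)
    then show ?thesis unfolding leaf_range by (rule connected_continuous_image[OF _ connected_UNIV])
  qed
  have part: "partition_on UNIV (range (\<lambda>c. section_graph (eta c)))"
  proof (rule partition_onI)
    have "\<exists>c. t \<in> section_graph (eta c)" for t
    proof -
      obtain z where "t = cotangent_proj z" using surj_cotangent_proj by (metis surjD)
      moreover obtain c where "leaf_mom c (fst z) = snd z" by (rule leaf_mom_surj)
      ultimately have "t \<in> section_graph (eta c)" by (simp add: mem_leaf)
      then show ?thesis by blast
    qed
    then show "\<Union> (range (\<lambda>c. section_graph (eta c))) = UNIV" by blast
    show "disjnt G G'" if "G \<in> range (\<lambda>c. section_graph (eta c))" "G' \<in> range (\<lambda>c. section_graph (eta c))" "G \<noteq> G'" for G G'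
    proof -
      obtain c c' where c: "G = section_graph (eta c)" "G' = section_graph (eta c')" using \<open>G \<in> _\<close> \<open>G' \<in> _\<close> by blast
      have False if "t \<in> G" "t \<in> G'" for t
      proof -
        obtain z where "t = cotangent_proj z" using surj_cotangent_proj by (metis surjD)
        then have "leaf_mom c (fst z) = leaf_mom c' (fst z)" using that c mem_leaf by metis
        then have "c = c'" by (rule leaf_mom_inj)
        then show False using c \<open>G \<noteq> G'\<close> by simp
      qed
      then show ?thesis by (auto simp: disjnt_def)
    qed
    show "{} \<notin> range (\<lambda>c. section_graph (eta c))" by (auto simp: section_graph_def)
  qed
  have "\<exists>U (\<phi> :: _ \<Rightarrow> (real^'n) \<times> (real^'n)) \<psi>.
        open U \<and> t \<in> U \<and> homeomorphism U UNIV \<phi> \<psi> \<and>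
        (\<forall>L\<in>range (\<lambda>c. section_graph (eta c)).
          components (L \<inter> U) = {\<psi> ` (UNIV \<times> {c}) | c. c \<in> snd ` \<phi> ` (L \<inter> U)})" for t
  proof -
    obtain x0 p0 where t: "t = cotangent_proj (x0, p0)" using surj_cotangent_proj by (metis surjD prod.collapse)
    obtain U and \<phi> :: "_ \<Rightarrow> (real^'n) \<times> (real^'n)" and \<psi> where U: "open U" "t \<in> U" "homeomorphism U UNIV \<phi> \<psi>"
      and leaf: "\<And>c. section_graph (eta c) \<inter> U = \<psi> ` (UNIV \<times> {c})"
      using leaf_chart[of x0 p0] t by metis
    \<comment> \<open>Each leaf meets the chart in one whole slice, so it has a single plaque
      there.\<close>
    have "components (section_graph (eta c) \<inter> U) = {\<psi> ` (UNIV \<times> {c'}) | c'. c' \<in> snd ` \<phi> ` (section_graph (eta c) \<inter> U)}" for c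
    proof -
      have \<psi>c: "continuous_on UNIV \<psi>" and \<phi>\<psi>: "\<And>w. \<phi> (\<psi> w) = w"
        using U(3) by (auto simp: homeomorphism_def)
      have "connected (\<psi> ` (UNIV \<times> {c}))"
        by (intro connected_continuous_image continuous_on_subset[OF \<psi>c] connected_Times connected_UNIV) auto
      then have "components (\<psi> ` (UNIV \<times> {c})) = {\<psi> ` (UNIV \<times> {c})}" by (simp add: components_eq_sing_iff)
      moreover have "snd ` \<phi> ` \<psi> ` (UNIV \<times> {c}) = {c}"
        by (auto simp: image_image \<phi>\<psi>)
      ultimately show ?thesis unfolding leaf by simp
    qed
    then show ?thesis using U by blast
  qed
  then show ?thesis unfolding continuous_foliation_def using conn part by blast
qed

end

theorem theorem2:
  fixes F :: "'n::finite torus \<times> (real^'n) \<Rightarrow> 'n torus \<times> (real^'n)"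
  assumes "twist_map F"
  shows "without_conjugate_points F \<longleftrightarrow>
    (\<exists>\<F>. continuous_foliation \<F> \<and>
      (\<forall>G\<in>\<F>. lipschitz_lagrangian_graph G \<and> F ` G = G))"
proof -
  obtain S Fb where S: "generating_function S" "generates S Fb"
    and lift: "\<And>z. F (cotangent_proj z) = cotangent_proj (Fb z)"
    using assms unfolding twist_map_def by metis
  obtain D1 D2 A where "twist_system S (partial1 S) (partial2 S) D1 D2 A Fb"
    using generating_function_twist_system[OF S] by blast
  then interpret twist_system S "partial1 S" "partial2 S" D1 D2 A Fb .
  show ?thesis
  proof
    assume "without_conjugate_points F"
    then have "no_conjugate" using without_conjugate_points_iff[OF lift] by blast
    then interpret twist_system_nc S "partial1 S" "partial2 S" D1 D2 A Fb
      by unfold_locales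
    show "\<exists>\<F>. continuous_foliation \<F> \<and> (\<forall>G\<in>\<F>. lipschitz_lagrangian_graph G \<and> F ` G = G)"
    proof (intro exI conjI ballI)
      show "continuous_foliation (range (\<lambda>c. section_graph (eta c)))" by (rule leaf_foliation)
      fix G assume "G \<in> range (\<lambda>c. section_graph (eta c))"
      then obtain c where c: "G = section_graph (eta c)" by (rule rangeE)
      show "lipschitz_lagrangian_graph G" unfolding c by (rule leaf_lagrangian)
      show "F ` G = G" unfolding c by (rule leaf_invariant[OF lift])
    qed
  next
    assume "\<exists>\<F>. continuous_foliation \<F> \<and> (\<forall>G\<in>\<F>. lipschitz_lagrangian_graph G \<and> F ` G = G)"
    then obtain \<F> where "continuous_foliation \<F>"
      and "\<And>G. G \<in> \<F> \<Longrightarrow> lipschitz_lagrangian_graph G \<and> F ` G = G" by (elim exE conjE) metis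
    then have no_conjugate by (rule foliation_no_conjugate[OF lift])
    then show "without_conjugate_points F" using without_conjugate_points_iff[OF lift] by blast
  qed
qed

end
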